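(* Let $A\subset\mathbb{R}^2$ be a finite point set, let $v$ be the number of points of $A$ lying in the interior of the convex hull $\operatorname{conv}(A)$, and let $b$ be the number of points of $A$ lying on the boundary of $\operatorname{conv}(A)$. Then the number of triangulations of $A$ is at most $$\frac{59^{v}\cdot 7^{b}}{\binom{v+b+6}{6}}.$$
   Context: A triangulation of a finite point set $A\subset\mathbb{R}^2$ is a geometric simplicial complex (with straight edges) covering $\operatorname{conv}(A)$ whose vertex set is exactly $A$; equivalently, a maximal non-crossing straight-edge graph with vertex set $A$. *)

theory Defs
  imports "HOL-Analysis.Analysis"
begin

text \<open>
  The library's \<^const>\<open>simplicial_complex\<close> is closed under the library's \<^const>\<open>face_of\<close>, for
  which the empty set is a face of everything. Every complex with at least one simplex therefore
  contains the empty simplex; requiring this explicitly only rules out the void family, so that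
  the empty point set has exactly one triangulation instead of two.
\<close>

definition triangulation_of :: "(real^2) set \<Rightarrow> (real^2) set set \<Rightarrow> bool" where
  "triangulation_of A \<K> \<longleftrightarrow>
     simplicial_complex \<K> \<and> {} \<in> \<K> \<and> \<Union>\<K> = convex hull A \<and> {x. {x} \<in> \<K>} = A"

text \<open>The cardinality of the following set is thus meaningful for finite \<open>A\<close>.\<close>

lemma finite_triangulations_of:
  assumes "finite A"
  shows "finite {\<K>. triangulation_of A \<K>}"
proof -
  have "\<K> \<subseteq> (\<lambda>C. convex hull C) ` Pow A" if tri: "triangulation_of A \<K>" for \<K>
  proof
    fix S assume S: "S \<in> \<K>"
    from tri have sc: "simplicial_complex \<K>" and vert: "{x. {x} \<in> \<K>} = A"
      by (auto simp: triangulation_of_def)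
    from sc S obtain n where "n simplex S"
      by (auto simp: simplicial_complex_def)
    then obtain C where C: "\<not> affine_dependent C" "S = convex hull C"
      by (auto simp: simplex)
    have "C \<subseteq> A"
    proof
      fix c assume "c \<in> C"
      with C have "{c} face_of S"
        by (simp add: extreme_point_of_convex_hull_affine_independent face_of_singleton)
      with sc S have "{c} \<in> \<K>"
        unfolding simplicial_complex_def by blast
      with vert show "c \<in> A" by blast
    qed
    with C show "S \<in> (\<lambda>C. convex hull C) ` Pow A" by blast
  qed
  then have "{\<K>. triangulation_of A \<K>} \<subseteq> Pow ((\<lambda>C. convex hull C) ` Pow A)"
    by blast
  with assms show ?thesis
    by (meson finite_Pow_iff finite_imageI finite_subset)
qed

end

theory Submission
  imports Defs
begin

text \<open>
  Let \<open>t(A)\<close> be the number of triangulations of \<open>A\<close>. In every triangulation the sum of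
  \<open>7 - deg p\<close> over the interior points and of \<open>5 - deg p\<close> over the boundary points is
  \<open>v + b + 6\<close>, so low-degree vertices abound. On the other hand a triangulation in which \<open>p\<close> has
  low degree arises from one of \<open>A - {p}\<close> by inserting \<open>p\<close> and then flipping edges opposite to \<open>p\<close>
  so that the star of \<open>p\<close> swallows triangles one by one. The swallowed triangles form a forest of
  binary trees rooted at the link of \<open>p\<close>, and counting these forests with weight \<open>7 - deg p\<close> gives
  \<open>4 * 1 + 3 * 3 + 2 * 9 + 1 * 28 = 59\<close> for an interior point and
  \<open>3 * 1 + 2 * 1 + 1 * 2 = 7\<close> for a boundary point. Hence
  \<open>(v + b + 6) t(A)\<close> is at most the sum of \<open>59 t(A - {p})\<close> over interior and \<open>7 t(A - {p})\<close> over
  boundary points, and the bound follows by induction on the number of points.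
\<close>

section \<open>Orientation of point triples\<close>

text \<open>No general position is assumed, and this shapes the second half. A triangulation is
  stuck at \<open>p\<close> when no flip shrinks the star of \<open>p\<close>. In general position a
  stuck star of an interior point is one triangle split in three, but with collinear points
  \<open>p\<close> may also lie on a segment between two neighbours, and its star then has up to
  four triangles. What matters is that stuck triangulations inject into the triangulations of
  \<open>A - {p}\<close>; the forest count must then be bounded for every possible number of roots,
  not just for the extremal 3 and 1. The degree enters through \<open>card (link T p)\<close>, the
  number of triangles at \<open>p\<close>. It equals the degree at an interior point and is one less
  at a boundary point, so \<open>5 - deg\<close> appears as \<open>4 - card (link T p)\<close>.
  Truncated subtraction only enlarges the sum, hence the degree identity is proved as a lower bound.
  The binomial coefficient comes from the ratio of \<open>n\<close> summands to the factor
  \<open>n + 6\<close> in each removal: the product of \<open>i / (i + 6)\<close> for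
  \<open>i\<close> from 1 to \<open>n\<close> is \<open>1 / ((n + 6) choose 6)\<close>.\<close>

definition orient :: "real^2 \<Rightarrow> real^2 \<Rightarrow> real^2 \<Rightarrow> real" where
  "orient a b c = (b$1 - a$1) * (c$2 - a$2) - (b$2 - a$2) * (c$1 - a$1)"

lemma orient_same [simp]: "orient a a b = 0" "orient a b a = 0" "orient b a a = 0"
  by (simp_all add: orient_def algebra_simps)

lemma orient_rot: "orient a b c = orient b c a"
  by (simp add: orient_def algebra_simps)

lemma orient_swap: "orient a c b = - orient a b c" "orient b a c = - orient a b c" "orient c b a = - orient a b c"
  by (simp_all add: orient_def algebra_simps)

text \<open>\<open>orient\<close> is twice a signed area. The factors with \<open>x\<close> are the
  barycentric coordinates of \<open>x\<close> in the triangle \<open>p c d\<close>, cleared of the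
  denominator \<open>orient p c d\<close>; they are pushed through the affine functional
  \<open>orient a b\<close>.\<close>

lemma orient_bary:
  "orient p c d * orient a b x = orient x c d * orient a b p + orient p x d * orient a b c + orient p c x * orient a b d"
  by (simp add: orient_def algebra_simps)

lemma orient_split: "orient x b c + orient a x c + orient a b x = orient a b c"
  by (simp add: orient_def algebra_simps)

text \<open>The three-term Pluecker relation for the vectors from \<open>p\<close> to the other
  points, the main tool for arguments about the order of directions around \<open>p\<close>.\<close>

lemma orient_plucker: "orient p a b * orient p c d - orient p a c * orient p b d + orient p a d * orient p b c = 0"
  by (simp add: orient_def algebra_simps)

lemma orient_comb: "u + v = 1 \<Longrightarrow> orient a b (u *\<^sub>R x + v *\<^sub>R y) = u * orient a b x + v * orient a b y"
proof -
  assume "u + v = 1"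
  then have v: "v = 1 - u" by simp
  show ?thesis unfolding v by (simp add: orient_def algebra_simps)
qed

lemma orient_comb3: "u + v + w = 1 \<Longrightarrow>
  orient a b (u *\<^sub>R x + v *\<^sub>R y + w *\<^sub>R z) = u * orient a b x + v * orient a b y + w * orient a b z"
proof -
  assume "u + v + w = 1"
  then have u: "u = 1 - v - w" by simp
  show ?thesis unfolding u by (simp add: orient_def algebra_simps)
qed

text \<open>Cramer's rule: division by \<open>orient a b c\<close> gives the barycentric coordinates
  of \<open>x\<close>.\<close>

lemma orient_decomp:
  "orient a b c *\<^sub>R x = orient x b c *\<^sub>R a + orient a x c *\<^sub>R b + orient a b x *\<^sub>R c"
  by (simp add: vec_eq_iff forall_2 orient_def algebra_simps)

text \<open>Any point \<open>b\<close> off the line through \<open>p\<close> and \<open>a\<close>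
  measures the position of \<open>w\<close> on it; the sign of the ratio tells the ray towards
  \<open>a\<close> from the opposite one.\<close>

lemma orient_ray:
  assumes "orient p a w = 0" "orient p a b \<noteq> 0"
  shows "w = p + (orient p w b / orient p a b) *\<^sub>R (a - p)"
proof -
  have "orient p a b *\<^sub>R w = orient w a b *\<^sub>R p + orient p w b *\<^sub>R a"
    using orient_decomp[of p a b w] assms by simp
  moreover have "orient w a b = orient p a b - orient p w b" using orient_split[of w a b p] assms by simp
  ultimately have *: "orient p a b *\<^sub>R w = orient p a b *\<^sub>R p + orient p w b *\<^sub>R (a - p)"
    by (simp add: algebra_simps)
  have "w = inverse (orient p a b) *\<^sub>R (orient p a b *\<^sub>R w)" using assms by simp
  also have "\<dots> = p + (orient p w b / orient p a b) *\<^sub>R (a - p)"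
    unfolding * using assms by (simp add: algebra_simps divide_inverse)
  finally show ?thesis .
qed

lemma convex_orient_ge: "convex {x. orient a b x \<ge> 0}" 
  by (auto simp: convex_def orient_comb)
lemma convex_orient_le: "convex {x. orient a b x \<le> 0}"
  by (auto simp: convex_def orient_comb add_nonpos_nonpos mult_nonneg_nonpos)

lemma orient_continuous [continuous_intros]: "continuous_on S (\<lambda>x. orient a b x)"
  unfolding orient_def by (intro continuous_intros)

lemma open_orient_gt: "open {x. orient a b x > 0}"
  by (intro open_Collect_less continuous_intros)

lemma negligible_orient:
  assumes "a \<noteq> b" shows "negligible {x. orient a b x = 0}"
proof -
  define n :: "real^2" where "n = (\<chi> i. if i = 1 then - (b$2 - a$2) else b$1 - a$1)"
  have n: "n \<bullet> x = (b$1-a$1)*x$2 - (b$2-a$2)*x$1" for x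
    by (simp add: n_def inner_vec_def sum_2 algebra_simps)
  have "n \<noteq> 0" using assms by (auto simp: n_def vec_eq_iff forall_2)
  then have "negligible {x. n \<bullet> x = n \<bullet> a}" by (intro negligible_hyperplane) auto
  moreover have "{x. orient a b x = 0} = {x. n \<bullet> x = n \<bullet> a}"
    by (auto simp: n orient_def algebra_simps)
  ultimately show ?thesis by simp
qed

lemma in_triangle_iff:
  assumes "orient a b c > 0"
  shows "x \<in> convex hull {a,b,c} \<longleftrightarrow> orient a b x \<ge> 0 \<and> orient b c x \<ge> 0 \<and> orient c a x \<ge> 0"
proof
  assume "x \<in> convex hull {a,b,c}"
  then obtain u v w where uvw: "u \<ge> 0" "v \<ge> 0" "w \<ge> 0" "u+v+w=1" "x = u *\<^sub>R a + v *\<^sub>R b + w *\<^sub>R c"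
    by (auto simp: convex_hull_3)
  have "orient b c a > 0" "orient c a b > 0" using assms orient_rot[of a b c] orient_rot[of b c a] by auto
  then show "orient a b x \<ge> 0 \<and> orient b c x \<ge> 0 \<and> orient c a x \<ge> 0"
    using uvw assms by (auto simp: orient_comb3)
next
  assume h: "orient a b x \<ge> 0 \<and> orient b c x \<ge> 0 \<and> orient c a x \<ge> 0"
  let ?D = "orient a b c"
  have "x = inverse ?D *\<^sub>R (?D *\<^sub>R x)" using assms by simp
  also have "\<dots> = (orient x b c / ?D) *\<^sub>R a + (orient a x c / ?D) *\<^sub>R b + (orient a b x / ?D) *\<^sub>R c"
    unfolding orient_decomp[of a b c x] by (simp add: algebra_simps divide_inverse)
  finally have "x = (orient x b c / ?D) *\<^sub>R a + (orient a x c / ?D) *\<^sub>R b + (orient a b x / ?D) *\<^sub>R c" .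
  moreover have "orient x b c \<ge> 0" "orient a x c \<ge> 0" using h orient_rot[of x b c] orient_rot[of c a x] by auto
  moreover have "orient x b c / ?D + orient a x c / ?D + orient a b x / ?D = 1"
    using orient_split[of x b c a] assms by (simp add: add_divide_distrib[symmetric])
  ultimately show "x \<in> convex hull {a,b,c}"
    unfolding convex_hull_3 using h assms
    by (intro CollectI exI[of _ "orient x b c / ?D"] exI[of _ "orient a x c / ?D"] exI[of _ "orient a b x / ?D"]) auto
qed

definition open_tri :: "real^2 \<Rightarrow> real^2 \<Rightarrow> real^2 \<Rightarrow> (real^2) set" where
  "open_tri a b c = {x. orient a b x > 0} \<inter> {x. orient b c x > 0} \<inter> {x. orient c a x > 0}"

lemma open_open_tri: "open (open_tri a b c)"
  unfolding open_tri_def by (intro open_Int open_orient_gt)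

lemma open_tri_subset: 
  assumes "orient a b c > 0" shows "open_tri a b c \<subseteq> interior (convex hull {a,b,c})"
  by (rule interior_maximal[OF _ open_open_tri]) (auto simp: in_triangle_iff[OF assms] open_tri_def)

lemma open_tri_nonempty:
  assumes "orient a b c > 0" shows "open_tri a b c \<noteq> {}"
proof -
  let ?x = "(1/3) *\<^sub>R a + (1/3) *\<^sub>R b + (1/3) *\<^sub>R c"
  have "orient b c a > 0" "orient c a b > 0" using assms orient_rot[of a b c] orient_rot[of b c a] by auto
  then have "?x \<in> open_tri a b c" using assms by (simp add: open_tri_def orient_comb3)
  then show ?thesis by auto
qed

section \<open>Triangulations as families of triangles\<close>

definition empty_tris :: "(real^2) set \<Rightarrow> (real^2) set set" where
  "empty_tris A = {t. (\<exists>a b c. t = {a,b,c} \<and> orient a b c > 0) \<and> t \<subseteq> A \<and> convex hull t \<inter> A \<subseteq> t}"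

text \<open>Requiring exactly one triangle only almost everywhere makes local modifications easy to verify.
  For collinear \<open>A\<close> the hull is negligible, and the empty family is the only member.\<close>

definition triangs :: "(real^2) set \<Rightarrow> (real^2) set set set" where
  "triangs A = {T. T \<subseteq> empty_tris A \<and> negligible {x \<in> convex hull A. card {t\<in>T. x \<in> convex hull t} \<noteq> 1}}"

lemma insert3_rot: "{a,b,c} = {b,c,a}" "{a,b,c} = {c,a,b}"
  by auto

lemma empty_tris_at:
  assumes "t \<in> empty_tris A" "p \<in> t"
  obtains c d where "t = {p,c,d}" "orient p c d > 0"
proof -
  obtain a b c where t: "t = {a,b,c}" "orient a b c > 0" using assms by (auto simp: empty_tris_def)
  then consider "p = a" | "p = b" | "p = c" using assms by auto
  then show ?thesis
  proof cases
    case 1 then show ?thesis using t that by blast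
  next
    case 2 then show ?thesis using t that[of c a] insert3_rot(1)[of a b c] orient_rot[of a b c] by auto
  next
    case 3 then show ?thesis using t that[of a b] insert3_rot(2)[of a b c] orient_rot[of c a b] by auto
  qed
qed

lemma orient_pos_distinct:
  assumes "orient a b c > 0" shows "a \<noteq> b" "b \<noteq> c" "a \<noteq> c"
  using assms by auto

lemma card_empty_tris: "t \<in> empty_tris A \<Longrightarrow> card t = 3"
  unfolding empty_tris_def using orient_pos_distinct by (auto simp: card_insert_if)

lemma finite_empty_tris: "finite A \<Longrightarrow> finite (empty_tris A)"
  by (rule finite_subset[of _ "Pow A"]) (auto simp: empty_tris_def)

lemma finite_triangs: "finite A \<Longrightarrow> finite (triangs A)"
  by (rule finite_subset[of _ "Pow (empty_tris A)"]) (auto simp: triangs_def finite_empty_tris)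

lemma triangs_finite: "finite A \<Longrightarrow> T \<in> triangs A \<Longrightarrow> finite T"
  by (auto simp: triangs_def intro: finite_subset[OF _ finite_empty_tris])

lemma triangs_empty_tris: "T \<in> triangs A \<Longrightarrow> t \<in> T \<Longrightarrow> t \<in> empty_tris A"
  by (auto simp: triangs_def)

text \<open>A nonempty open set is not negligible, so it contains a point off both exceptional sets.
  This is how the almost-everywhere condition in \<open>triangs\<close> is put to use.\<close>

lemma triangs_generic:
  assumes "T \<in> triangs A" "open U" "U \<noteq> {}" "U \<subseteq> convex hull A" "negligible N"
  obtains x where "x \<in> U" "x \<notin> N" "card {t\<in>T. x \<in> convex hull t} = 1"
proof -
  let ?N = "{x \<in> convex hull A. card {t\<in>T. x \<in> convex hull t} \<noteq> 1}"
  have "negligible (?N \<union> N)" using assms by (auto simp: triangs_def)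
  then have "\<not> U \<subseteq> ?N \<union> N" using open_not_negligible[OF assms(2,3)] negligible_subset by blast
  then show ?thesis using that assms(4) by blast
qed

lemma triangs_overlap:
  assumes T: "T \<in> triangs A" and t: "{a,b,c} \<in> T" "{d,e,f} \<in> T"
    and x: "x \<in> open_tri a b c" "x \<in> open_tri d e f" and o: "orient a b c > 0" "orient d e f > 0"
  shows "{a,b,c} = {d,e,f}"
proof -
  let ?U = "open_tri a b c \<inter> open_tri d e f"
  have "{a,b,c} \<subseteq> A" using triangs_empty_tris[OF T t(1)] by (auto simp: empty_tris_def)
  then have sub: "?U \<subseteq> convex hull A"
    using open_tri_subset[OF o(1)] interior_subset hull_mono by blast
  obtain y where y: "y \<in> ?U" "card {t\<in>T. y \<in> convex hull t} = 1"
  proof (rule triangs_generic[OF T _ _ sub negligible_empty])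
    show "open ?U" by (intro open_Int open_open_tri)
    show "?U \<noteq> {}" using x by auto
  qed
  then obtain t where "{t\<in>T. y \<in> convex hull t} = {t}" by (auto simp: card_1_singleton_iff)
  moreover have "y \<in> convex hull {a,b,c}" "y \<in> convex hull {d,e,f}"
    using y(1) open_tri_subset[OF o(1)] open_tri_subset[OF o(2)] interior_subset by blast+
  then have "{a,b,c} \<in> {t\<in>T. y \<in> convex hull t}" "{d,e,f} \<in> {t\<in>T. y \<in> convex hull t}" 
    using t by simp_all
  ultimately show ?thesis by simp
qed

text \<open>Finitely many closed triangles leave an open set uncovered. The hull is the closure of
  its interior, so an uncovered point yields an open uncovered part of the interior, in which no
  point is covered once.\<close>

lemma triangs_covers:
  assumes T: "T \<in> triangs A" and fin: "finite A" and ne: "interior (convex hull A) \<noteq> {}"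
    and x: "x \<in> convex hull A"
  shows "\<exists>t\<in>T. x \<in> convex hull t"
proof (rule ccontr)
  assume n: "\<not> ?thesis"
  let ?C = "\<Union>t\<in>T. convex hull t"
  have "closed ?C"
  proof (intro closed_UN ballI)
    show "finite T" using triangs_finite[OF fin T] .
    fix t assume "t \<in> T"
    then have "finite t" using triangs_empty_tris[OF T] fin by (auto simp: empty_tris_def intro: finite_subset)
    then show "closed (convex hull t)" by (simp add: compact_imp_closed finite_imp_compact_convex_hull)
  qed
  then have o: "open (- ?C)" by (rule open_Compl)
  have "x \<in> closure (interior (convex hull A))"
    using convex_closure_interior[OF convex_convex_hull ne] x closure_subset by blast
  then have ne': "- ?C \<inter> interior (convex hull A) \<noteq> {}"
    using open_Int_closure_eq_empty[OF o] n x by fastforce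
  obtain y where y: "y \<in> - ?C \<inter> interior (convex hull A)" "card {t\<in>T. y \<in> convex hull t} = 1"
  proof (rule triangs_generic[OF T _ ne' _ negligible_empty])
    show "open (- ?C \<inter> interior (convex hull A))" by (intro open_Int o open_interior)
    show "- ?C \<inter> interior (convex hull A) \<subseteq> convex hull A" using interior_subset by blast
  qed
  then obtain t where "{t\<in>T. y \<in> convex hull t} = {t}" by (auto simp: card_1_singleton_iff)
  then show False using y by auto
qed

lemma interior_hull_nonempty:
  assumes "orient a b c > 0" "a \<in> convex hull A" "b \<in> convex hull A" "c \<in> convex hull A"
  shows "interior (convex hull A) \<noteq> {}"
proof -
  have "convex hull {a,b,c} \<subseteq> convex hull A" by (rule hull_minimal) (use assms in auto)
  then show ?thesis using open_tri_nonempty[OF assms(1)] open_tri_subset[OF assms(1)] interior_mono by blast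
qed

section \<open>The star of a point\<close>

text \<open>The curve leaves \<open>p\<close> towards \<open>w\<close> and bends towards \<open>v\<close>, so for small \<open>e\<close> the sign of an affine
  functional along it is the lexicographic sign of its values at \<open>p\<close>, \<open>w\<close>, \<open>v\<close>.\<close>

definition curve :: "real^2 \<Rightarrow> real^2 \<Rightarrow> real^2 \<Rightarrow> real \<Rightarrow> real^2" where
  "curve p w v e = (1 - e - e\<^sup>2) *\<^sub>R p + e *\<^sub>R w + e\<^sup>2 *\<^sub>R v"

lemma orient_curve: "orient a b (curve p w v e) = (1 - e - e\<^sup>2) * orient a b p + e * orient a b w + e\<^sup>2 * orient a b v"
  unfolding curve_def by (rule orient_comb3) simp

definition lexpos :: "real \<Rightarrow> real \<Rightarrow> real \<Rightarrow> bool" where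
  "lexpos x y z \<longleftrightarrow> x > 0 \<or> (x = 0 \<and> (y > 0 \<or> (y = 0 \<and> z > 0)))"

lemma eventually_small: "(\<delta>::real) > 0 \<Longrightarrow> eventually (\<lambda>e. 0 < e \<and> e < \<delta>) (at_right 0)"
  by (auto simp: eventually_at_right_field)

lemma lexpos_eventually:
  assumes "lexpos x y z"
  shows "eventually (\<lambda>e. (1 - e - e\<^sup>2) * x + e * y + e\<^sup>2 * z > 0) (at_right 0)"
proof -
  consider "x > 0" | "x = 0" "y > 0" | "x = 0" "y = 0" "z > 0" using assms by (auto simp: lexpos_def)
  then show ?thesis
  proof cases
    case 1
    have "((\<lambda>e. (1 - e - e\<^sup>2) * x + e * y + e\<^sup>2 * z) \<longlongrightarrow> (1 - 0 - 0\<^sup>2) * x + 0 * y + 0\<^sup>2 * z) (at_right 0)"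
      by (intro tendsto_intros)
    then show ?thesis using 1 by (intro order_tendstoD(1)) auto
  next
    case 2
    have "((\<lambda>e. y + e * z) \<longlongrightarrow> y + 0 * z) (at_right 0)" by (intro tendsto_intros)
    then have "eventually (\<lambda>e. y + e * z > 0) (at_right 0)" using 2 by (intro order_tendstoD(1)) auto
    moreover have "eventually (\<lambda>e::real. 0 < e \<and> e < 1) (at_right 0)" by (rule eventually_small) simp
    ultimately show ?thesis
    proof eventually_elim
      case (elim e)
      then have "e * (y + e * z) > 0" by simp
      then show ?case using 2 by (simp add: algebra_simps power2_eq_square)
    qed
  next
    case 3
    have "eventually (\<lambda>e::real. 0 < e \<and> e < 1) (at_right 0)" by (rule eventually_small) simp
    then show ?thesis using 3 by (auto elim: eventually_mono)
  qed
qed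

lemma lexneg_eventually:
  assumes "lexpos (-x) (-y) (-z)"
  shows "eventually (\<lambda>e. (1 - e - e\<^sup>2) * x + e * y + e\<^sup>2 * z < 0) (at_right 0)"
  using lexpos_eventually[OF assms] by (rule eventually_mono) (simp add: algebra_simps)

definition lexin :: "real^2 \<Rightarrow> real^2 \<Rightarrow> real^2 \<Rightarrow> real^2 \<Rightarrow> real^2 \<Rightarrow> real^2 \<Rightarrow> bool" where
  "lexin p w v a b c \<longleftrightarrow> lexpos (orient a b p) (orient a b w) (orient a b v) \<and>
     lexpos (orient b c p) (orient b c w) (orient b c v) \<and> lexpos (orient c a p) (orient c a w) (orient c a v)"

lemma lexin_eventually:
  assumes "lexin p w v a b c" shows "eventually (\<lambda>e. curve p w v e \<in> open_tri a b c) (at_right 0)"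
  using assms unfolding lexin_def open_tri_def
  by (auto simp: orient_curve intro!: eventually_conj lexpos_eventually)

text \<open>A short initial piece of the curve lies in both open triangles. Overlaps near
  \<open>p\<close> are thereby detected by signs of orientations alone.\<close>

lemma triangs_lex_overlap:
  assumes T: "T \<in> triangs A" and t: "{a,b,c} \<in> T" "{d,e,f} \<in> T"
    and o: "orient a b c > 0" "orient d e f > 0"
    and l: "lexin p w v a b c" "lexin p w v d e f"
  shows "{a,b,c} = {d,e,f}"
proof -
  have "eventually (\<lambda>e'. curve p w v e' \<in> open_tri a b c \<and> curve p w v e' \<in> open_tri d e f) (at_right 0)"
    using l by (intro eventually_conj lexin_eventually)
  then obtain x where "x \<in> open_tri a b c" "x \<in> open_tri d e f"
    using eventually_happens'[OF trivial_limit_at_right_real] by blast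
  then show ?thesis using triangs_overlap[OF T t] o by blast
qed

lemma lexin_self: "orient p w v > 0 \<Longrightarrow> lexin p w v p w v" "orient p v w > 0 \<Longrightarrow> lexin p w v p v w"
  using orient_rot[of p w v] orient_rot[of w v p] orient_rot[of p v w] orient_rot[of v w p]
  by (auto simp: lexin_def lexpos_def)

lemma lexin_cone: "orient p a b > 0 \<Longrightarrow> orient p a w > 0 \<Longrightarrow> orient p w b > 0 \<Longrightarrow> lexin p w v p a b"
  using orient_rot[of p a b] orient_rot[of p w b] orient_rot[of w b p] by (auto simp: lexin_def lexpos_def)

text \<open>The order of \<open>a\<close> and \<open>b\<close> matters: seen from \<open>p\<close>,
  \<open>b\<close> is the counterclockwise successor of \<open>a\<close>.\<close>

definition link_edge :: "(real^2) set set \<Rightarrow> real^2 \<Rightarrow> real^2 \<Rightarrow> real^2 \<Rightarrow> bool" where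
  "link_edge T p a b \<longleftrightarrow> {p,a,b} \<in> T \<and> orient p a b > 0"

definition nbrs :: "(real^2) set set \<Rightarrow> real^2 \<Rightarrow> (real^2) set" where
  "nbrs T p = {w. \<exists>v. link_edge T p w v \<or> link_edge T p v w}"

lemma link_edge_nbrs: "link_edge T p a b \<Longrightarrow> a \<in> nbrs T p" "link_edge T p a b \<Longrightarrow> b \<in> nbrs T p"
  by (auto simp: nbrs_def)

lemma link_edge_A: "T \<in> triangs A \<Longrightarrow> link_edge T p a b \<Longrightarrow> p \<in> A \<and> a \<in> A \<and> b \<in> A"
  by (auto simp: link_edge_def empty_tris_def dest: triangs_empty_tris)

lemma nbrs_A: "T \<in> triangs A \<Longrightarrow> w \<in> nbrs T p \<Longrightarrow> w \<in> A"
  by (auto simp: nbrs_def dest: link_edge_A)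

lemma nbrs_ne: "w \<in> nbrs T p \<Longrightarrow> w \<noteq> p"
  by (auto simp: nbrs_def link_edge_def)

text \<open>A curve from \<open>p\<close> towards \<open>w\<close> would run inside
  \<open>p a b\<close> and inside a star triangle at \<open>w\<close>. The two triangles would
  coincide and \<open>w\<close> would be a vertex of \<open>p a b\<close>, which the strict signs
  forbid.\<close>

lemma not_in_cone:
  assumes T: "T \<in> triangs A" and l: "link_edge T p a b" and w: "w \<in> nbrs T p"
    and c: "orient p a w > 0" "orient p w b > 0"
  shows False
proof -
  obtain v where "link_edge T p w v \<or> link_edge T p v w" using w by (auto simp: nbrs_def)
  then have "{p,a,b} = {p,w,v} \<or> {p,a,b} = {p,v,w}"
  proof
    assume "link_edge T p w v"
    then show ?thesis using triangs_lex_overlap[OF T, of p a b p w v p w v] l lexin_cone[of p a b w v] c lexin_self(1)[of p w v]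
      unfolding link_edge_def by blast
  next
    assume "link_edge T p v w"
    then show ?thesis using triangs_lex_overlap[OF T, of p a b p v w p w v] l lexin_cone[of p a b w v] c lexin_self(2)[of p v w]
      unfolding link_edge_def by blast
  qed
  then have "w \<in> {p,a,b}" by blast
  then show False using c by auto
qed

text \<open>The nearer of two points on a ray from \<open>p\<close> lies on the edge from
  \<open>p\<close> to the farther one, which emptiness forbids. Stated for empty triangles so that
  it can also compare a star triangle with a candidate not yet known to be in
  \<open>T\<close>.\<close>

lemma ray_eq_empty_tris:
  assumes t: "{p,a,b} \<in> empty_tris A" "{p,w,v} \<in> empty_tris A" "orient p a b \<noteq> 0" "orient p w v \<noteq> 0"
    and z: "orient p a w = 0" "orient p a d * orient p w d > 0"
  shows "a = w"
proof -
  have key: "x = y" if t: "{p,x,u} \<in> empty_tris A" "orient p x u \<noteq> 0" "y \<in> A" "y \<noteq> p"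
    "y = p + s *\<^sub>R (x - p)" "0 < s" "s \<le> 1" for x y u s
  proof -
    have "y = (1 - s) *\<^sub>R p + s *\<^sub>R x + 0 *\<^sub>R u" using t by (simp add: algebra_simps)
    then have "y \<in> convex hull {p,x,u}" unfolding convex_hull_3 using t
      by (intro CollectI exI[of _ "1-s"] exI[of _ s] exI[of _ "0::real"]) auto
    then have "y \<in> {p,x,u}" using t by (auto simp: empty_tris_def)
    moreover have "orient p x (p + s *\<^sub>R (x - p)) = 0" by (simp add: orient_def algebra_simps)
    then have "orient p x y = 0" using t(5) by simp
    then have "y \<noteq> u" using t(2) by auto
    ultimately show "x = y" using t(4) by auto
  qed
  have A: "a \<in> A" "w \<in> A" "a \<noteq> p" "w \<noteq> p" using t by (auto simp: empty_tris_def)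
  define s where "s = orient p w d / orient p a d"
  have s0: "s > 0" using z by (auto simp: s_def zero_less_mult_iff zero_less_divide_iff)
  have w': "w = p + s *\<^sub>R (a - p)" unfolding s_def using z by (intro orient_ray) auto
  show ?thesis
  proof (cases "s \<le> 1")
    case True then show ?thesis using key[OF t(1,3) A(2,4) w' s0] by simp
  next
    case False
    have "a = p + inverse s *\<^sub>R (w - p)" unfolding w' using s0 by simp
    then show ?thesis using key[OF t(2,4) A(1,3), of "inverse s"] s0 False by (simp add: inverse_le_1_iff)
  qed
qed

lemma nbrs_triangle:
  assumes "T \<in> triangs A" "w \<in> nbrs T p"
  obtains v where "{p,w,v} \<in> empty_tris A" "orient p w v \<noteq> 0"
proof -
  obtain v where v: "link_edge T p w v \<or> link_edge T p v w" using assms by (auto simp: nbrs_def)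
  then have "{p,w,v} \<in> T" "orient p w v \<noteq> 0" using orient_swap(1)[of p v w] by (auto simp: link_edge_def insert_commute)
  then show ?thesis using that triangs_empty_tris[OF assms(1)] by blast
qed

lemma ray_eq:
  assumes T: "T \<in> triangs A" and a: "a \<in> nbrs T p" and w: "w \<in> nbrs T p"
    and z: "orient p a w = 0" "orient p a d * orient p w d > 0"
  shows "a = w"
  using nbrs_triangle[OF T a] nbrs_triangle[OF T w] ray_eq_empty_tris[OF _ _ _ _ z] by metis

lemma in_triangle_iff_signed:
  assumes s: "s = 1 \<or> s = (-1::real)" and p: "s * orient a b c > 0"
  shows "x \<in> convex hull {a,b,c} \<longleftrightarrow> s * orient a b x \<ge> 0 \<and> s * orient b c x \<ge> 0 \<and> s * orient c a x \<ge> 0"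
proof (cases "s = 1")
  case True then show ?thesis using p in_triangle_iff[of a b c] by simp
next
  case False
  then have s: "s = -1" using s by simp
  have "{a,b,c} = {a,c,b}" by auto
  then show ?thesis using p in_triangle_iff[of a c b x] orient_swap(1)[of a b c] orient_swap(2)[of a b x] orient_swap(2)[of b c x] orient_swap(2)[of a c x]
    unfolding s by auto
qed

text \<open>The sign \<open>s\<close> covers both orientations at once.\<close>

lemma star_direction:
  assumes T: "T \<in> triangs A" and fin: "finite A" and p: "p \<in> A"
    and az: "a \<in> convex hull A" "z \<in> convex hull A"
    and s: "s = 1 \<or> s = (-1::real)" and pos: "s * orient p a z > 0"
  obtains c d where "{p,c,d} \<in> T" "s * orient p c d > 0" "s * orient p c a \<ge> 0" "s * orient p a d > 0"
proof -
  have pA: "p \<in> convex hull A" using p hull_inc by fast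
  have ne: "interior (convex hull A) \<noteq> {}"
  proof (cases "s = 1")
    case True then show ?thesis using interior_hull_nonempty[of p a z] pos az pA by auto
  next
    case False then show ?thesis using interior_hull_nonempty[of p z a] s pos az pA orient_swap(1)[of p a z] by auto
  qed
  have ev: "eventually (\<lambda>e. \<exists>t\<in>T. curve p a z e \<in> convex hull t) (at_right 0)"
  proof -
    have "eventually (\<lambda>e::real. 0 < e \<and> e < 1/2) (at_right 0)" by (rule eventually_small) simp
    then show ?thesis
    proof eventually_elim
      case (elim e)
      then have "e * e \<le> (1/2) * (1/2)" by (intro mult_mono) auto
      then have "curve p a z e \<in> convex hull {p,a,z}"
        unfolding curve_def convex_hull_3 using elim
        by (intro CollectI exI[of _ "1-e-e\<^sup>2"] exI[of _ e] exI[of _ "e\<^sup>2"]) (auto simp: power2_eq_square)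
      moreover have "convex hull {p,a,z} \<subseteq> convex hull A" by (rule hull_minimal) (use az pA in auto)
      ultimately show ?case using triangs_covers[OF T fin ne] by blast
    qed
  qed
  have "\<exists>\<^sub>F e in at_right 0. \<exists>t\<in>T. curve p a z e \<in> convex hull t"
    using eventually_frequently[OF _ ev] by simp
  then have "\<exists>t\<in>T. \<exists>\<^sub>F e in at_right 0. curve p a z e \<in> convex hull t"
    by (rule frequently_bex_finite[OF triangs_finite[OF fin T]])
  \<comment> \<open>Among finitely many triangles, a single one contains points of the curve
    arbitrarily close to its start \<open>p\<close>. It is closed, so it contains \<open>p\<close>,
    and emptiness makes \<open>p\<close> a vertex.\<close>
  then obtain t where t: "t \<in> T" and fr: "\<exists>\<^sub>F e in at_right 0. curve p a z e \<in> convex hull t"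
    by blast
  have tE: "t \<in> empty_tris A" using triangs_empty_tris[OF T t] .
  have "p \<in> convex hull t"
  proof (rule ccontr)
    assume n: "p \<notin> convex hull t"
    have "finite t" using tE fin by (auto simp: empty_tris_def intro: finite_subset)
    then have "closed (convex hull t)" by (simp add: compact_imp_closed finite_imp_compact_convex_hull)
    then have o: "open (- (convex hull t))" by (rule open_Compl)
    have "((\<lambda>e. curve p a z e) \<longlongrightarrow> (1 - 0 - 0\<^sup>2) *\<^sub>R p + 0 *\<^sub>R a + 0\<^sup>2 *\<^sub>R z) (at_right 0)"
      unfolding curve_def by (intro tendsto_intros)
    then have "(curve p a z \<longlongrightarrow> p) (at_right 0)" by simp
    then have "eventually (\<lambda>e. curve p a z e \<in> - (convex hull t)) (at_right 0)"
      using topological_tendstoD[OF _ o] n by blast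
    then show False using fr by (auto simp: frequently_def)
  qed
  then have "p \<in> t" using tE p by (auto simp: empty_tris_def)
  then obtain c' d' where cd': "t = {p,c',d'}" "orient p c' d' > 0" using empty_tris_at[OF tE] by blast
  obtain c d where cd: "t = {p,c,d}" "s * orient p c d > 0"
  proof (cases "s = 1")
    case True then show ?thesis using that cd' by auto
  next
    case False then show ?thesis using that[of d' c'] cd' s orient_swap(1)[of p c' d'] by auto
  qed
  have mem: "x \<in> convex hull t \<Longrightarrow> s * orient p c x \<ge> 0 \<and> s * orient d p x \<ge> 0" for x
    unfolding cd(1) using in_triangle_iff_signed[OF s cd(2)] by auto
  have 1: "s * orient p c a \<ge> 0"
  proof (rule ccontr)
    assume "\<not> ?thesis"
    then have "lexpos (- (s * orient p c p)) (- (s * orient p c a)) (- (s * orient p c z))" by (auto simp: lexpos_def)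
    from lexneg_eventually[OF this] have "eventually (\<lambda>e. curve p a z e \<notin> convex hull t) (at_right 0)"
      by (rule eventually_mono) (use mem in \<open>fastforce simp: orient_curve algebra_simps\<close>)
    then show False using fr by (auto simp: frequently_def)
  qed
  have 2: "s * orient d p a > 0 \<or> (orient d p a = 0 \<and> s * orient d p z \<ge> 0)"
  proof (rule ccontr)
    assume "\<not> ?thesis"
    then have "lexpos (- (s * orient d p p)) (- (s * orient d p a)) (- (s * orient d p z))" using s by (auto simp: lexpos_def)
    from lexneg_eventually[OF this] have "eventually (\<lambda>e. curve p a z e \<notin> convex hull t) (at_right 0)"
      by (rule eventually_mono) (use mem in \<open>fastforce simp: orient_curve algebra_simps\<close>)
    then show False using fr by (auto simp: frequently_def)
  qed
  \<comment> \<open>For \<open>d\<close> on the line through \<open>p\<close> and \<open>a\<close>,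
    the Pluecker relation would equate a positive number with a nonpositive one.\<close>
  have 3: "s * orient p a d > 0"
  proof (rule ccontr)
    assume n: "\<not> ?thesis"
    have "orient d p a = orient p a d" "orient d p z = orient p z d" using orient_rot by metis+
    then have z: "orient p a d = 0" "s * orient p z d \<ge> 0" using 2 n by auto
    have "orient p a z * orient p c d = - orient p c a * orient p z d"
      using orient_plucker[of p a z c d] z orient_swap(1)[of p a c] by (simp add: algebra_simps)
    then have "(s * orient p a z) * (s * orient p c d) = - ((s * orient p c a) * (s * orient p z d))" by (simp add: algebra_simps)
    moreover have "(s * orient p a z) * (s * orient p c d) > 0" using pos cd(2) by simp
    moreover have "(s * orient p c a) * (s * orient p z d) \<ge> 0" using 1 z by simp
    ultimately show False by linarith
  qed
  show ?thesis using that[of c d] t cd 1 3 by simp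
qed

text \<open>Some star triangle \<open>p c d\<close> covers the directions just to the left of
  \<open>a\<close>. By \<open>not_in_cone\<close> its side \<open>p c\<close> points in the
  direction of \<open>a\<close>, so \<open>c = a\<close>.\<close>

lemma succ_exists:
  assumes T: "T \<in> triangs A" and fin: "finite A" and a: "a \<in> nbrs T p" and z: "z \<in> convex hull A" "orient p a z > 0"
  shows "\<exists>d. link_edge T p a d"
proof -
  have A: "a \<in> A" "p \<in> A" using nbrs_A[OF T a] a link_edge_A[OF T] by (auto simp: nbrs_def)
  then obtain c d where cd: "{p,c,d} \<in> T" "orient p c d > 0" "orient p c a \<ge> 0" "orient p a d > 0"
    using star_direction[OF T fin, of p a z 1] z hull_inc[of a A convex] by (auto simp del: hull_inc)
  then have link_edge: "link_edge T p c d" by (simp add: link_edge_def)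
  then have "orient p c a = 0" using not_in_cone[OF T link_edge a] cd by force
  then have "c = a" using ray_eq[OF T link_edge_nbrs(1)[OF link_edge] a, of d] cd by simp
  then show ?thesis using link_edge by blast
qed

lemma pred_exists:
  assumes T: "T \<in> triangs A" and fin: "finite A" and a: "a \<in> nbrs T p" and z: "z \<in> convex hull A" "orient p a z < 0"
  shows "\<exists>d. link_edge T p d a"
proof -
  have A: "a \<in> A" "p \<in> A" using nbrs_A[OF T a] a link_edge_A[OF T] by (auto simp: nbrs_def)
  then obtain c d where cd: "{p,c,d} \<in> T" "orient p c d < 0" "orient p c a \<le> 0" "orient p a d < 0"
    using star_direction[OF T fin, of p a z "-1"] z hull_inc[of a A convex] by (auto simp del: hull_inc)
  have link_edge: "link_edge T p d c" using cd orient_swap(1)[of p c d] by (simp add: link_edge_def insert_commute)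
  have "orient p c a = 0" using not_in_cone[OF T link_edge a] cd orient_swap(1)[of p c a] orient_swap(1)[of p a d] by force
  then have "c = a" using ray_eq[OF T link_edge_nbrs(2)[OF link_edge] a, of d] cd mult_neg_neg[of "orient p c d" "orient p a d"] by simp
  then show ?thesis using link_edge by blast
qed

text \<open>The Pluecker relation makes the product of the two numbers positive. This is what lets
  subcones be nested.\<close>

lemma cone_chain:
  assumes "orient p x y > 0" "orient p y w > 0" "orient p w z > 0" "orient p x z > 0"
  shows "orient p x w > 0 \<longleftrightarrow> orient p y z > 0"
proof -
  have "orient p x w * orient p y z = orient p x y * orient p w z + orient p x z * orient p y w"
    using orient_plucker[of p x y w z] by simp
  also have "\<dots> > 0" using assms by (simp add: add_pos_pos)
  finally show ?thesis by (auto simp: zero_less_mult_iff)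
qed

section \<open>Flips\<close>

text \<open>The quadrilateral \<open>p r q s\<close> is strictly convex, so its diagonal
  \<open>p q\<close> can be exchanged for \<open>r s\<close>. The star of \<open>p\<close> then
  loses one triangle.\<close>

definition flippable :: "(real^2) set set \<Rightarrow> real^2 \<Rightarrow> real^2 \<Rightarrow> real^2 \<Rightarrow> real^2 \<Rightarrow> bool" where
  "flippable T p r q s \<longleftrightarrow> link_edge T p r q \<and> link_edge T p q s \<and> orient p r s > 0 \<and> orient r q s > 0"

lemma finite_nbrs: "T \<in> triangs A \<Longrightarrow> finite A \<Longrightarrow> finite (nbrs T p)"
  by (rule finite_subset[of _ A]) (auto dest: nbrs_A)

text \<open>The induction shrinks the cone spanned by \<open>a\<close> and \<open>z\<close> until \<open>b\<close> is the only link vertex inside; then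
  \<open>a\<close>, \<open>b\<close>, \<open>z\<close> are consecutive.\<close>

lemma flippable_exists:
  assumes T: "T \<in> triangs A" and fin: "finite A"
  shows "a \<in> nbrs T p \<Longrightarrow> b \<in> nbrs T p \<Longrightarrow> z \<in> nbrs T p \<Longrightarrow> orient p a b > 0 \<Longrightarrow> orient p b z > 0 \<Longrightarrow> orient p a z > 0
    \<Longrightarrow> orient a b z > 0 \<Longrightarrow> \<exists>r q s. flippable T p r q s"
proof (induction "card {w \<in> nbrs T p. orient p a w > 0 \<and> orient p w z > 0}" arbitrary: a b z rule: less_induct)
  case less
  let ?V = "\<lambda>a z. {w \<in> nbrs T p. orient p a w > 0 \<and> orient p w z > 0}"
  have fV: "finite (?V a z)" for a z using finite_nbrs[OF T fin, of p] by simp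
  note ab = less.prems(4) and bz = less.prems(5) and az = less.prems(6) and abz = less.prems(7)
  have IH: ?case if "?V a' z' \<subseteq> ?V a z" "w \<in> ?V a z" "w \<notin> ?V a' z'"
    "a' \<in> nbrs T p" "b' \<in> nbrs T p" "z' \<in> nbrs T p" "orient p a' b' > 0" "orient p b' z' > 0" "orient p a' z' > 0" "orient a' b' z' > 0" for a' b' z' w
  proof -
    have "?V a' z' \<subset> ?V a z" using that by blast
    then show ?thesis using less.hyps[of a' z' b'] psubset_card_mono[OF fV] that by blast
  qed
  consider w where "w \<in> nbrs T p" "orient p b w > 0" "orient p w z > 0" | w where "w \<in> nbrs T p" "orient p a w > 0" "orient p w b > 0"
    | "\<And>w. w \<in> nbrs T p \<Longrightarrow> \<not> (orient p b w > 0 \<and> orient p w z > 0)" "\<And>w. w \<in> nbrs T p \<Longrightarrow> \<not> (orient p a w > 0 \<and> orient p w b > 0)"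
    by blast
  then show ?case
  proof cases
    case 1
    have aw: "orient p a w > 0" using cone_chain[of p a b w z] ab bz az 1 by simp
    show ?thesis
    proof (cases "orient a b w > 0")
      case True
      have "?V a w \<subseteq> ?V a z" 
        using cone_chain[of p a _ w z] 1 az aw by blast
      then show ?thesis using IH[of a w w b] less.prems 1 aw True by simp
    next
      case False
      \<comment> \<open>The path \<open>a b w\<close> does not turn left, so \<open>w\<close> bulges
        over the chord from \<open>b\<close> to \<open>z\<close>, and \<open>b\<close>,
        \<open>w\<close>, \<open>z\<close> is a smaller instance.\<close>
      have "orient p b z * orient a b w = orient w b z * orient a b p + orient p b w * orient a b z"
        using orient_bary[of p b z a b w] by simp
      moreover have "orient p b w * orient a b z > 0" using 1 abz by simp
      moreover have "orient p b z * orient a b w \<le> 0" using bz False by (simp add: mult_le_0_iff)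
      moreover have "orient a b p > 0" using ab orient_rot[of p a b] by simp
      moreover from calculation have "orient w b z * orient a b p < 0" by linarith
      ultimately have "orient w b z < 0" by (auto simp: mult_less_0_iff)
      then have "orient b w z > 0" using orient_swap(2)[of b w z] by simp
      moreover have "?V b z \<subseteq> ?V a z" using cone_chain[of p a b _ z] ab bz az by blast
      ultimately show ?thesis using IH[of b z b w] less.prems 1 by simp
    qed
  next
    case 2
    have wz: "orient p w z > 0" using cone_chain[of p a w b z] ab bz az 2 by simp
    show ?thesis
    proof (cases "orient w b z > 0")
      case True
      have "?V w z \<subseteq> ?V a z" 
        using cone_chain[of p a w _ z] 2 az wz by blast
      then show ?thesis using IH[of w z w b] less.prems 2 wz True by simp
    next
      case False
      have "orient p a b * orient b z w = orient w a b * orient b z p + orient p w b * orient b z a"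
        using orient_bary[of p a b b z w] by simp
      moreover have "orient p w b * orient b z a > 0" using 2 abz orient_rot[of a b z] by simp
      moreover have "orient p a b * orient b z w \<le> 0" using ab False orient_rot[of w b z] by (simp add: mult_le_0_iff)
      moreover have "orient b z p > 0" using bz orient_rot[of p b z] by simp
      moreover from calculation have "orient w a b * orient b z p < 0" by linarith
      ultimately have "orient w a b < 0" by (auto simp: mult_less_0_iff)
      then have "orient a w b > 0" using orient_swap(2)[of a w b] by simp
      moreover have "?V a b \<subseteq> ?V a z" using cone_chain[of p a _ b z] ab bz az by blast
      ultimately show ?thesis using IH[of a b b w] less.prems 2 by simp
    qed
  next
    case 3
    have hA: "x \<in> nbrs T p \<Longrightarrow> x \<in> convex hull A" for x using nbrs_A[OF T] hull_inc by metis
    obtain s where s: "link_edge T p b s" using succ_exists[OF T fin less.prems(2) hA[OF less.prems(3)] bz] by blast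
    have bs: "orient p b s > 0" using s by (simp add: link_edge_def)
    have "orient p s z \<ge> 0" using not_in_cone[OF T s less.prems(3) bz] orient_swap(1)[of p s z] by force
    then have "orient p s z = 0" using 3(1)[OF link_edge_nbrs(2)[OF s]] bs by force
    then have "s = z" using ray_eq[OF T link_edge_nbrs(2)[OF s] less.prems(3), of b] bs bz orient_swap(1)[of p b s] orient_swap(1)[of p b z]
      mult_neg_neg[of "orient p s b" "orient p z b"] by simp
    have ba: "orient p b a < 0" using ab orient_swap(1)[of p a b] by simp
    obtain r where r: "link_edge T p r b" using pred_exists[OF T fin less.prems(2) hA[OF less.prems(1)] ba] by blast
    have rb: "orient p r b > 0" using r by (simp add: link_edge_def)
    have "orient p a r \<ge> 0" using not_in_cone[OF T r less.prems(1) _ ab] orient_swap(1)[of p a r] by force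
    then have "orient p a r = 0" using 3(2)[OF link_edge_nbrs(1)[OF r]] rb by force
    then have "a = r" using ray_eq[OF T less.prems(1) link_edge_nbrs(1)[OF r], of b] rb ab by simp
    then show ?thesis using r s \<open>s = z\<close> az abz unfolding flippable_def by blast
  qed
qed

text \<open>Near the midpoint of \<open>a b\<close> both triangles contain all points on that side,
  so the curve from the midpoint towards \<open>c\<close> enters both.\<close>

lemma edge_side:
  assumes T: "T \<in> triangs A" and t: "{a,b,c} \<in> T" "{a,b,d} \<in> T" "orient a b c > 0" "orient a b d > 0"
  shows "c = d"
proof -
  define m where "m = (1/2) *\<^sub>R a + (1/2) *\<^sub>R b"
  have m: "orient x y m = (1/2) * orient x y a + (1/2) * orient x y b" for x y
    unfolding m_def by (rule orient_comb) simp
  have l: "lexin m c v a b e" if "orient a b c > 0" "orient a b e > 0" for e v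
    using that orient_rot[of a b e] orient_rot[of b e a] by (auto simp: lexin_def lexpos_def m)
  have "{a,b,c} = {a,b,d}" using triangs_lex_overlap[OF T t l[OF t(3,3), of c] l[OF t(3,4)]] .
  then show ?thesis using orient_pos_distinct[OF t(3)] orient_pos_distinct[OF t(4)] by auto
qed

lemma edge_multiplicity:
  assumes T: "T \<in> triangs A" and fin: "finite A" and e: "card e = 2"
  shows "card {t\<in>T. e \<subseteq> t} \<le> 2"
proof -
  obtain a b where e: "e = {a,b}" "a \<noteq> b" using e by (auto simp: card_2_iff)
  let ?S = "\<lambda>x y. {t\<in>T. \<exists>c. t = {x,y,c} \<and> orient x y c > 0}"
  have one: "card (?S x y) \<le> 1" for x y
  proof -
    have "finite (?S x y)" using triangs_finite[OF fin T] by simp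
    moreover have "u = v" if "u \<in> ?S x y" "v \<in> ?S x y" for u v
      using that edge_side[OF T] by blast
    ultimately have "card (?S x y) \<le> Suc 0" by (subst card_le_Suc0_iff_eq) blast+
    then show ?thesis by simp
  qed
  have "{t\<in>T. e \<subseteq> t} \<subseteq> ?S a b \<union> ?S b a"
  proof
    fix t assume t: "t \<in> {t\<in>T. e \<subseteq> t}"
    then obtain c d where cd: "t = {a,c,d}" "orient a c d > 0"
      using empty_tris_at[of t A a] triangs_empty_tris[OF T] e by auto
    then have "b = c \<or> b = d" using t e by auto
    then show "t \<in> ?S a b \<union> ?S b a"
    proof
      assume "b = c" then show ?thesis using cd t by blast
    next
      assume "b = d"
      then have "t = {b,a,c}" "orient b a c > 0" using cd orient_rot[of b a c] by auto
      then show ?thesis using t by blast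
    qed
  qed
  then have "card {t\<in>T. e \<subseteq> t} \<le> card (?S a b \<union> ?S b a)"
    using triangs_finite[OF fin T] by (intro card_mono) auto
  also have "\<dots> \<le> card (?S a b) + card (?S b a)" by (rule card_Un_le)
  finally show ?thesis using one[of a b] one[of b a] by linarith
qed

lemma empty_tris_open_tri:
  assumes "t \<in> empty_tris A"
  obtains U where "open U" "U \<noteq> {}" "U \<subseteq> convex hull t"
proof -
  obtain a b c where "t = {a,b,c}" "orient a b c > 0" using assms by (auto simp: empty_tris_def)
  then show ?thesis using that[of "open_tri a b c"] open_open_tri open_tri_nonempty open_tri_subset interior_subset by blast
qed

text \<open>A swap that keeps the multiplicities keeps almost every point covered once. A triangle
  of \<open>Y\<close> that had also been kept would share a generic point with a triangle of
  \<open>X\<close>, and \<open>T\<close> would cover that point twice. \<open>A'\<close> may be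
  smaller than \<open>A\<close>, so that the lemma serves for flips as well as for removing a
  point.\<close>

lemma triangs_replace:
  assumes T: "T \<in> triangs A" and fin: "finite A" and X: "X \<subseteq> T" and A': "A' \<subseteq> A"
    and E: "T - X \<subseteq> empty_tris A'" "Y \<subseteq> empty_tris A'" and N: "negligible N"
    and eq: "\<And>x. x \<in> convex hull A' \<Longrightarrow> x \<notin> N \<Longrightarrow> card {t\<in>X. x \<in> convex hull t} = card {t\<in>Y. x \<in> convex hull t}"
  shows "(T - X) \<union> Y \<in> triangs A'" "Y \<inter> (T - X) = {}"
proof -
  have fT: "finite T" using triangs_finite[OF fin T] .
  have fY: "finite Y" using E(2) finite_empty_tris[OF finite_subset[OF A' fin]] finite_subset by blast
  have hA: "convex hull A' \<subseteq> convex hull A" using A' by (rule hull_mono)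
  show dj: "Y \<inter> (T - X) = {}"
  proof (rule ccontr)
    assume "Y \<inter> (T - X) \<noteq> {}"
    then obtain t where t: "t \<in> Y" "t \<in> T" "t \<notin> X" by blast
    then have tE: "t \<in> empty_tris A'" using E by auto
    then have ts: "convex hull t \<subseteq> convex hull A'" by (intro hull_mono) (auto simp: empty_tris_def)
    obtain U where U: "open U" "U \<noteq> {}" "U \<subseteq> convex hull t" using empty_tris_open_tri[OF tE] by blast
    obtain x where x: "x \<in> U" "x \<notin> N" "card {t\<in>T. x \<in> convex hull t} = 1"
      using triangs_generic[OF T U(1,2) _ N] U(3) ts hA by blast
    have "card {t\<in>Y. x \<in> convex hull t} \<noteq> 0" using t x U fY by auto
    then have "card {t\<in>X. x \<in> convex hull t} \<noteq> 0" using eq x U ts by auto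
    then obtain t' where "t' \<in> X" "x \<in> convex hull t'" by (metis (mono_tags, lifting) card.empty empty_Collect_eq)
    then have "{t,t'} \<subseteq> {t\<in>T. x \<in> convex hull t}" "t \<noteq> t'" using t X x U by auto
    then show False using x card_mono[of "{t\<in>T. x \<in> convex hull t}" "{t,t'}"] fT by simp
  qed
  have "negligible {x \<in> convex hull A'. card {t\<in>(T - X) \<union> Y. x \<in> convex hull t} \<noteq> 1}"
  proof (rule negligible_subset)
    show "negligible ({x \<in> convex hull A. card {t\<in>T. x \<in> convex hull t} \<noteq> 1} \<union> N)"
      using T N by (auto simp: triangs_def)
    show "{x \<in> convex hull A'. card {t\<in>(T - X) \<union> Y. x \<in> convex hull t} \<noteq> 1} \<subseteq> \<dots>"
    proof
      fix x assume x: "x \<in> {x \<in> convex hull A'. card {t\<in>(T - X) \<union> Y. x \<in> convex hull t} \<noteq> 1}"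
      have "card {t\<in>T. x \<in> convex hull t} \<noteq> 1" if "x \<notin> N"
      proof -
        have "{t\<in>T. x \<in> convex hull t} = {t\<in>T - X. x \<in> convex hull t} \<union> {t\<in>X. x \<in> convex hull t}" using X by auto
        then have 1: "card {t\<in>T. x \<in> convex hull t} = card {t\<in>T - X. x \<in> convex hull t} + card {t\<in>X. x \<in> convex hull t}"
          using fT X finite_subset[OF X fT] by (subst card_Un_disjoint[symmetric]) auto
        have "{t\<in>(T-X) \<union> Y. x \<in> convex hull t} = {t\<in>T - X. x \<in> convex hull t} \<union> {t\<in>Y. x \<in> convex hull t}" by auto
        then have 2: "card {t\<in>(T-X) \<union> Y. x \<in> convex hull t} = card {t\<in>T - X. x \<in> convex hull t} + card {t\<in>Y. x \<in> convex hull t}"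
          using fT fY dj by (subst card_Un_disjoint[symmetric]) auto
        show ?thesis using 1 2 eq x that by auto
      qed
      then show "x \<in> {x \<in> convex hull A. card {t\<in>T. x \<in> convex hull t} \<noteq> 1} \<union> N" using x hA by auto
    qed
  qed
  then show "(T - X) \<union> Y \<in> triangs A'" using E by (auto simp: triangs_def)
qed

lemma triangle_halfplane:
  assumes "x \<in> convex hull {p,c,d}" "orient a b p \<ge> 0" "orient a b c \<ge> 0" "orient a b d \<ge> 0"
  shows "orient a b x \<ge> 0"
  using hull_minimal[of "{p,c,d}" "{x. orient a b x \<ge> 0}" convex] assms convex_orient_ge by auto

lemma card_filter_two: "t1 \<noteq> t2 \<Longrightarrow> card {t\<in>{t1,t2}. P t} = of_bool (P t1) + of_bool (P t2)"
proof -
  assume "t1 \<noteq> t2"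
  moreover have "{t\<in>{t1,t2}. P t} = (if P t1 then {t1} else {}) \<union> (if P t2 then {t2} else {})" by auto
  ultimately show ?thesis by auto
qed

text \<open>A strictly convex quadrilateral with counterclockwise vertices \<open>p\<close>,
  \<open>r\<close>, \<open>q\<close>, \<open>s\<close> and diagonals \<open>p q\<close> and
  \<open>r s\<close>.\<close>

locale quad =
  fixes p r q s :: "real^2"
  assumes rq: "orient p r q > 0" and qs: "orient p q s > 0" and rs: "orient p r s > 0" and rqs: "orient r q s > 0"
begin

lemma rots: "orient r q p > 0" "orient q p r > 0" "orient q s p > 0" "orient s p q > 0" "orient r s p > 0" "orient s p r > 0" "orient q s r > 0" "orient s r q > 0"
  using rq qs rs rqs orient_rot[of p r q] orient_rot[of r q p] orient_rot[of p q s] orient_rot[of q s p] orient_rot[of p r s] orient_rot[of r s p]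
    orient_rot[of r q s] orient_rot[of q s r] by auto

lemmas tri = in_triangle_iff[OF rq] in_triangle_iff[OF qs] in_triangle_iff[OF rs] in_triangle_iff[OF rqs]

lemma union: "x \<in> convex hull {p,r,q} \<or> x \<in> convex hull {p,q,s} \<longleftrightarrow> x \<in> convex hull {p,r,s} \<or> x \<in> convex hull {r,q,s}"
proof -
  note h = rots rq qs rs rqs
  have sw: "orient q p x = - orient p q x" "orient s r x = - orient r s x" by (rule orient_swap(2))+
  have 1: "x \<in> convex hull {p,r,q} \<or> x \<in> convex hull {p,q,s}" if "x \<in> convex hull {p,r,s}"
    using triangle_halfplane[OF that, of r q] triangle_halfplane[OF that, of q s] that h
    unfolding tri sw by force
  have 2: "x \<in> convex hull {p,r,q} \<or> x \<in> convex hull {p,q,s}" if "x \<in> convex hull {r,q,s}"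
    using triangle_halfplane[OF that, of p r] triangle_halfplane[OF that, of s p] that h
    unfolding tri sw by force
  have 3: "x \<in> convex hull {p,r,s} \<or> x \<in> convex hull {r,q,s}" if "x \<in> convex hull {p,r,q}"
    using triangle_halfplane[OF that, of s p] triangle_halfplane[OF that, of q s] that h
    unfolding tri sw by force
  have 4: "x \<in> convex hull {p,r,s} \<or> x \<in> convex hull {r,q,s}" if "x \<in> convex hull {p,q,s}"
    using triangle_halfplane[OF that, of p r] triangle_halfplane[OF that, of r q] that h
    unfolding tri sw by force
  show ?thesis using 1 2 3 4 by blast
qed

lemma excl: "x \<in> convex hull {p,r,q} \<Longrightarrow> x \<in> convex hull {p,q,s} \<Longrightarrow> orient p q x = 0"
  "x \<in> convex hull {p,r,s} \<Longrightarrow> x \<in> convex hull {r,q,s} \<Longrightarrow> orient r s x = 0"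
  unfolding tri using orient_swap(2)[of p q x] orient_swap(2)[of r s x] by auto

lemma distinct: "p \<noteq> r" "p \<noteq> q" "p \<noteq> s" "r \<noteq> q" "r \<noteq> s" "q \<noteq> s"
  using orient_pos_distinct[OF rq] orient_pos_distinct[OF qs] orient_pos_distinct[OF rs] by auto

lemma outside: "q \<notin> convex hull {p,r,s}" "p \<notin> convex hull {r,q,s}"
  unfolding tri using rots orient_swap(2)[of r s q] orient_swap(2)[of s r p] by auto

end

text \<open>Both pairs of triangles fill the same quadrilateral. So the new ones contain no point of
  \<open>A\<close> besides the four corners, and the multiplicities agree off the two
  diagonals.\<close>

lemma flip_triangs:
  assumes T: "T \<in> triangs A" and fin: "finite A" and f: "flippable T p r q s"
  defines "T1 \<equiv> (T - {{p,r,q},{p,q,s}}) \<union> {{p,r,s},{r,q,s}}"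
  shows "T1 \<in> triangs A" "{{p,r,s},{r,q,s}} \<inter> (T - {{p,r,q},{p,q,s}}) = {}"
proof -
  interpret quad p r q s using f by unfold_locales (auto simp: flippable_def link_edge_def)
  have in_T: "{p,r,q} \<in> T" "{p,q,s} \<in> T" using f by (auto simp: flippable_def link_edge_def)
  have sub: "{p,r,q,s} \<subseteq> A" using triangs_empty_tris[OF T in_T(1)] triangs_empty_tris[OF T in_T(2)] by (auto simp: empty_tris_def)
  have verts: "x \<in> {p,r,q,s}" if "x \<in> A" "x \<in> convex hull {p,r,s} \<or> x \<in> convex hull {r,q,s}" for x
  proof -
    have "convex hull {p,r,q} \<inter> A \<subseteq> {p,r,q}" "convex hull {p,q,s} \<inter> A \<subseteq> {p,q,s}"
      using triangs_empty_tris[OF T in_T(1)] triangs_empty_tris[OF T in_T(2)] unfolding empty_tris_def by blast+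
    then show ?thesis using that(1) iffD2[OF union that(2)] by blast
  qed
  have E: "{p,r,s} \<in> empty_tris A" "{r,q,s} \<in> empty_tris A"
    using verts outside sub rs rqs by (auto simp: empty_tris_def)
  have ne: "{p,r,q} \<noteq> {p,q,s}" "{p,r,s} \<noteq> {r,q,s}" using distinct by auto
  let ?N = "{x. orient p q x = 0} \<union> {x. orient r s x = 0}"
  have N: "negligible ?N" using distinct by (intro negligible_Un negligible_orient) auto
  have TE: "T - {{p,r,q},{p,q,s}} \<subseteq> empty_tris A" using triangs_empty_tris[OF T] by auto
  have c: "card {t\<in>{{p,r,q},{p,q,s}}. x \<in> convex hull t} = card {t\<in>{{p,r,s},{r,q,s}}. x \<in> convex hull t}"
    if "x \<notin> ?N" for x
    unfolding card_filter_two[OF ne(1)] card_filter_two[OF ne(2)]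
    using excl[of x] union[of x] that by (auto simp: of_bool_def)
  show "T1 \<in> triangs A" "{{p,r,s},{r,q,s}} \<inter> (T - {{p,r,q},{p,q,s}}) = {}"
    unfolding T1_def using triangs_replace[OF T fin _ _ TE _ N, of "{{p,r,s},{r,q,s}}"] in_T E c by auto
qed

section \<open>Counting the swallowed triangles\<close>

text \<open>\<open>ballot k m\<close> is the sum of the truncated differences \<open>m - n\<close> over all forests of \<open>k\<close> binary trees with \<open>n\<close> nodes altogether:
  the first tree is either empty or replaced by the two subtrees of its root.\<close>

fun ballot :: "nat \<Rightarrow> nat \<Rightarrow> nat" where
  "ballot k 0 = 0"
| "ballot 0 (Suc m) = Suc m"
| "ballot (Suc k) (Suc m) = ballot k (Suc m) + ballot (Suc (Suc k)) m"

text \<open>The empty forest alone contributes \<open>m\<close>.\<close>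

lemma ballot_ge: "m \<le> ballot k m"
  by (induction k m rule: ballot.induct) auto

text \<open>\<open>grown E S\<close> says that the triangles of \<open>S\<close> can be attached one by one, each along an edge in \<open>E\<close>
  or an edge of an earlier triangle. This formulation does not mention the order.\<close>

definition grown :: "'a set set \<Rightarrow> 'a set set \<Rightarrow> bool" where
  "grown E S \<longleftrightarrow> (\<forall>R. R \<subset> S \<longrightarrow>
     (\<exists>t\<in>S - R. \<exists>e. card e = 2 \<and> e \<subseteq> t \<and> (e \<in> E \<or> (\<exists>t'\<in>R. e \<subseteq> t'))))"

lemma grownD:
  assumes "grown E S" "R \<subset> S"
  obtains t e where "t \<in> S" "t \<notin> R" "card e = 2" "e \<subseteq> t" "e \<in> E \<or> (\<exists>t'\<in>R. e \<subseteq> t')"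
proof -
  have "\<exists>t\<in>S - R. \<exists>e. card e = 2 \<and> e \<subseteq> t \<and> (e \<in> E \<or> (\<exists>t'\<in>R. e \<subseteq> t'))"
    using assms unfolding grown_def by simp
  then show ?thesis using that by (elim bexE exE conjE DiffE)
qed

lemma grownI:
  assumes "\<And>R. R \<subset> S \<Longrightarrow> \<exists>t e. t \<in> S \<and> t \<notin> R \<and> card e = 2 \<and> e \<subseteq> t \<and> (e \<in> E \<or> (\<exists>t'\<in>R. e \<subseteq> t'))"
  shows "grown E S"
  unfolding grown_def
proof (intro allI impI)
  fix R assume "R \<subset> S"
  from assms[OF this] obtain t e where "t \<in> S" "t \<notin> R" "card e = 2 \<and> e \<subseteq> t \<and> (e \<in> E \<or> (\<exists>t'\<in>R. e \<subseteq> t'))"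
    by (elim exE conjE) (rule that, auto)
  then show "\<exists>t\<in>S - R. \<exists>e. card e = 2 \<and> e \<subseteq> t \<and> (e \<in> E \<or> (\<exists>t'\<in>R. e \<subseteq> t'))"
    by (intro bexI[of _ t] exI[of _ e]) auto
qed

lemma grown_weaken:
  assumes "grown E S" "\<And>t e. t \<in> S \<Longrightarrow> e \<subseteq> t \<Longrightarrow> e \<in> E \<Longrightarrow> e \<in> E'"
  shows "grown E' S"
proof (rule grownI)
  fix R assume "R \<subset> S"
  then obtain t e where te: "t \<in> S" "t \<notin> R" "card e = 2" "e \<subseteq> t" "e \<in> E \<or> (\<exists>t'\<in>R. e \<subseteq> t')"
    using grownD[OF assms(1)] by metis
  then show "\<exists>t e. t \<in> S \<and> t \<notin> R \<and> card e = 2 \<and> e \<subseteq> t \<and> (e \<in> E' \<or> (\<exists>t'\<in>R. e \<subseteq> t'))"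
    using assms(2)[of t e] by (intro exI[of _ t] exI[of _ e]) auto
qed

text \<open>If \<open>R\<close> already contains \<open>S\<close>, only \<open>t\<close> is missing
  and \<open>e\<close> attaches it. Otherwise a missing triangle of \<open>S\<close> attaches to
  \<open>R \<inter> S\<close>.\<close>

lemma grown_insert:
  assumes g: "grown E S" and e: "card e = 2" "e \<subseteq> t" "e \<in> E \<or> (\<exists>t'\<in>S. e \<subseteq> t')"
  shows "grown E (insert t S)"
  unfolding grown_def
proof (intro allI impI)
  fix R assume R: "R \<subset> insert t S"
  show "\<exists>t1\<in>insert t S - R. \<exists>e. card e = 2 \<and> e \<subseteq> t1 \<and> (e \<in> E \<or> (\<exists>t'\<in>R. e \<subseteq> t'))"
  proof (cases "S \<subseteq> R")
    case True
    then have "t \<notin> R" using R by auto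
    then show ?thesis using True e by blast
  next
    case False
    then have "R \<inter> S \<subset> S" by auto
    then obtain t1 e1 where "t1 \<in> S - (R \<inter> S)" "card e1 = 2 \<and> e1 \<subseteq> t1 \<and> (e1 \<in> E \<or> (\<exists>t'\<in>R \<inter> S. e1 \<subseteq> t'))"
      using g unfolding grown_def by meson
    then show ?thesis by blast
  qed
qed

text \<open>The recursion of \<open>ballot\<close> decides one root edge \<open>e\<close> at a time.
  At most one triangle \<open>t\<close> of \<open>U\<close> lies on \<open>e\<close>. Sets without
  \<open>t\<close> never use \<open>e\<close>; in sets with \<open>t\<close>, the other two edges of
  \<open>t\<close> replace \<open>e\<close> and one unit of weight is spent. The bounds on the
  number of triangles per edge are the invariant that makes this repeatable. Equality may fail, for
  instance because a root edge can lie in no triangle.\<close>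

lemma grown_count:
  assumes "finite U" "\<And>t. t \<in> U \<Longrightarrow> card t = 3" "finite E" "card E \<le> k"
    "\<And>e. e \<in> E \<Longrightarrow> card e = 2 \<and> card {t\<in>U. e \<subseteq> t} \<le> 1"
    "\<And>e. card e = 2 \<Longrightarrow> card {t\<in>U. e \<subseteq> t} \<le> 2"
  shows "(\<Sum>S\<in>{S. S \<subseteq> U \<and> grown E S}. m - card S) \<le> ballot k m"
  using assms
proof (induction k m arbitrary: U E rule: ballot.induct)
  case (1 k)
  then show ?case by simp
next
  case (2 m)
  then have "E = {}" by auto
  then have "{S. S \<subseteq> U \<and> grown E S} \<subseteq> {{}::'a set set}" unfolding grown_def by blast
  then have "(\<Sum>S\<in>{S. S \<subseteq> U \<and> grown E S}. Suc m - card S) \<le> (\<Sum>S\<in>{{}::'a set set}. Suc m - card S)"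
    by (intro sum_mono2) auto
  then show ?case by simp
next
  case (3 k m)
  show ?case
  proof (cases "E = {}")
    case True
    then have "{S. S \<subseteq> U \<and> grown E S} \<subseteq> {{}::'a set set}" unfolding grown_def by blast
    then have "(\<Sum>S\<in>{S. S \<subseteq> U \<and> grown E S}. Suc m - card S) \<le> (\<Sum>S\<in>{{}::'a set set}. Suc m - card S)"
      by (intro sum_mono2) auto
    also have "\<dots> \<le> ballot (Suc k) (Suc m)" using ballot_ge[of "Suc m" "Suc k"] by simp
    finally show ?thesis .
  next
    case False
    then obtain e where e: "e \<in> E" by auto
    let ?G = "\<lambda>U E. {S. S \<subseteq> U \<and> grown E S}"
    have e2: "card e = 2" using 3(7)[OF e] by simp
    have cE: "card (E - {e}) \<le> k" using e 3(6) 3(5) by (simp add: card_Diff_singleton)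
    have mono: "card {t\<in>U'. e' \<subseteq> t} \<le> card {t\<in>U. e' \<subseteq> t}" if "U' \<subseteq> U" for U' e'
      using that 3(3) by (intro card_mono) auto
    show ?thesis
    proof (cases "\<exists>t\<in>U. e \<subseteq> t")
      case no: False
      have "?G U E \<subseteq> ?G U (E - {e})" using no grown_weaken[of E _ "E - {e}"] by blast
      then have "(\<Sum>S\<in>?G U E. Suc m - card S) \<le> (\<Sum>S\<in>?G U (E - {e}). Suc m - card S)"
        using 3(3) by (intro sum_mono2) auto
      also have "\<dots> \<le> ballot k (Suc m)" using 3 cE by (intro "3.IH"(1)) auto
      finally show ?thesis by simp
    next
      case True
      then obtain t where t: "t \<in> U" "e \<subseteq> t" by blast
      have uniq: "t' = t" if "t' \<in> U" "e \<subseteq> t'" for t'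
      proof -
        have "card {t\<in>U. e \<subseteq> t} \<le> Suc 0" using 3(7)[OF e] by simp
        then show ?thesis using that t 3(3) card_le_Suc0_iff_eq[of "{t\<in>U. e \<subseteq> t}"] by simp
      qed
      \<comment> \<open>The other two edges of \<open>t\<close> become roots. Since \<open>t\<close>
        leaves \<open>U\<close>, each of them lies in at most one remaining triangle.\<close>
      let ?E' = "E - {e} \<union> ({e'. e' \<subseteq> t \<and> card e' = 2} - {e})"
      have ft: "finite t" using 3(4)[OF t(1)] card.infinite by fastforce
      have ct: "card {e'. e' \<subseteq> t \<and> card e' = 2} = 3"
        using n_subsets[OF ft, of 2] 3(4)[OF t(1)] by (simp add: numeral_3_eq_3 numeral_2_eq_2)
      have fe: "finite {e'. e' \<subseteq> t \<and> card e' = 2}" using ft by simp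
      have ct': "card ({e'. e' \<subseteq> t \<and> card e' = 2} - {e}) = 2"
        using ct fe t e2 by (simp add: card_Diff_singleton)
      have cE': "card ?E' \<le> Suc (Suc k)" using card_Un_le[of "E - {e}" "{e'. e' \<subseteq> t \<and> card e' = 2} - {e}"] cE ct' by simp
      have A: "(\<Sum>S\<in>?G (U - {t}) (E - {e}). Suc m - card S) \<le> ballot k (Suc m)"
      proof (rule "3.IH"(1))
        show "card e = 2 \<and> card {t' \<in> U - {t}. e \<subseteq> t'} \<le> 1" if "e \<in> E - {e'}" for e e'
          using that 3(7)[of e] mono[of "U - {t}" e] by fastforce
        show "card {t' \<in> U - {t}. e \<subseteq> t'} \<le> 2" if "card e = 2" for e
          using 3(8)[OF that] mono[of "U - {t}" e] by fastforce
      qed (use 3 cE in auto)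
      have B: "(\<Sum>S\<in>?G (U - {t}) ?E'. m - card S) \<le> ballot (Suc (Suc k)) m"
      proof (rule "3.IH"(2))
        show "card e' = 2 \<and> card {t' \<in> U - {t}. e' \<subseteq> t'} \<le> 1" if "e' \<in> ?E'" for e'
        proof (cases "e' \<in> E")
          case True then show ?thesis using 3(7)[of e'] mono[of "U - {t}" e'] by fastforce
        next
          case False
          then have e': "e' \<subseteq> t" "card e' = 2" using that by auto
          have "{t'\<in>U. e' \<subseteq> t'} = insert t {t' \<in> U - {t}. e' \<subseteq> t'}" using t e' by auto
          then have "card {t'\<in>U. e' \<subseteq> t'} = Suc (card {t' \<in> U - {t}. e' \<subseteq> t'})"
            using 3(3) by simp
          then show ?thesis using 3(8)[OF e'(2)] e' by simp
        qed
        show "card {t' \<in> U - {t}. e \<subseteq> t'} \<le> 2" if "card e = 2" for e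
          using 3(8)[OF that] mono[of "U - {t}" e] by fastforce
        show "finite ?E'" using 3(5) fe by simp
      qed (use 3 cE' in auto)
      have split: "?G U E = {S\<in>?G U E. t \<notin> S} \<union> {S\<in>?G U E. t \<in> S}" by auto
      have fG: "finite (?G U' E)" if "U' \<subseteq> U" for U' E by (rule finite_subset[of _ "Pow U"]) (use that 3(3) in auto)
      have sA: "(\<Sum>S\<in>{S\<in>?G U E. t \<notin> S}. Suc m - card S) \<le> (\<Sum>S\<in>?G (U - {t}) (E - {e}). Suc m - card S)"
      proof (rule sum_mono2)
        show "{S\<in>?G U E. t \<notin> S} \<subseteq> ?G (U - {t}) (E - {e})"
        proof
          fix S assume S: "S \<in> {S\<in>?G U E. t \<notin> S}"
          have "grown (E - {e}) S" by (rule grown_weaken[of E]) (use S uniq in auto)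
          then show "S \<in> ?G (U - {t}) (E - {e})" using S by auto
        qed
      qed (use fG in auto)
      have sB: "(\<Sum>S\<in>{S\<in>?G U E. t \<in> S}. Suc m - card S) \<le> (\<Sum>S\<in>?G (U - {t}) ?E'. m - card S)"
      proof -
        have inj: "inj_on (\<lambda>S. S - {t}) {S\<in>?G U E. t \<in> S}" by (auto simp: inj_on_def)
        have "(\<Sum>S\<in>{S\<in>?G U E. t \<in> S}. Suc m - card S) = (\<Sum>S\<in>{S\<in>?G U E. t \<in> S}. m - card (S - {t}))"
        proof (rule sum.cong[OF refl])
          fix S assume S: "S \<in> {S\<in>?G U E. t \<in> S}"
          then have fS: "finite S" using 3(3) finite_subset by auto
          have "card S > 0" using S fS by (auto simp: card_gt_0_iff)
          then show "Suc m - card S = m - card (S - {t})"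
            using S fS by (simp add: card_Diff_singleton)
        qed
        also have "\<dots> = (\<Sum>S\<in>(\<lambda>S. S - {t}) ` {S\<in>?G U E. t \<in> S}. m - card S)"
          unfolding sum.reindex[OF inj] o_def by (rule refl)
        also have "\<dots> \<le> (\<Sum>S\<in>?G (U - {t}) ?E'. m - card S)"
        proof (rule sum_mono2)
          show "(\<lambda>S. S - {t}) ` {S\<in>?G U E. t \<in> S} \<subseteq> ?G (U - {t}) ?E'"
          proof (intro subsetI, elim imageE)
            fix S' S assume S: "S \<in> {S\<in>?G U E. t \<in> S}" "S' = S - {t}"
            have "grown ?E' S'"
            proof (rule grownI)
              fix R assume R: "R \<subset> S'"
              \<comment> \<open>Growth of \<open>S\<close> is tested on \<open>insert t R\<close>:
                the next edge is not \<open>e\<close>, which lies in no triangle but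
                \<open>t\<close>, so it is an old root, an edge of \<open>t\<close> and thus a new
                root, or an edge of a triangle of \<open>R\<close>.\<close>
              have "insert t R \<subset> S" using R S by blast
              with S obtain t1 e1 where 1: "t1 \<in> S" "t1 \<notin> insert t R" "card e1 = 2" "e1 \<subseteq> t1"
                  "e1 \<in> E \<or> (\<exists>t'\<in>insert t R. e1 \<subseteq> t')"
                using grownD[of E S "insert t R"] by (metis (no_types, lifting) mem_Collect_eq)
              moreover have "e1 \<noteq> e" using uniq[of t1] 1 S by blast
              ultimately have ne: "e1 \<noteq> e" by simp
              have "e1 \<in> ?E' \<or> (\<exists>t'\<in>R. e1 \<subseteq> t')" using 1(5) ne 1(3) by blast
              moreover have "t1 \<in> S'" "t1 \<notin> R" using 1(1,2) S by blast+
              ultimately show "\<exists>t e. t \<in> S' \<and> t \<notin> R \<and> card e = 2 \<and> e \<subseteq> t \<and> (e \<in> ?E' \<or> (\<exists>t'\<in>R. e \<subseteq> t'))"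
                using 1(3,4) by (intro exI[of _ t1] exI[of _ e1] conjI)
            qed
            then show "S' \<in> ?G (U - {t}) ?E'" using S by blast
          qed
        qed (use fG in auto)
        finally show ?thesis .
      qed
      let ?X = "{S\<in>?G U E. t \<notin> S}" and ?Y = "{S\<in>?G U E. t \<in> S}"
      have "finite ?X" "finite ?Y" by (rule finite_subset[OF _ fG[of U E]], auto)+
      moreover have "?X \<inter> ?Y = {}" by blast
      ultimately have "(\<Sum>S\<in>?X \<union> ?Y. Suc m - card S) = (\<Sum>S\<in>?X. Suc m - card S) + (\<Sum>S\<in>?Y. Suc m - card S)"
        by (rule sum.union_disjoint)
      then have "(\<Sum>S\<in>?G U E. Suc m - card S) = (\<Sum>S\<in>?X. Suc m - card S) + (\<Sum>S\<in>?Y. Suc m - card S)"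
        by (simp only: split[symmetric])
      then show ?thesis using sA sB A B by simp
    qed
  qed
qed

section \<open>Encoding a triangulation by a stuck one and its swallowed triangles\<close>

definition link :: "(real^2) set set \<Rightarrow> real^2 \<Rightarrow> (real^2) set set" where
  "link T p = {e. p \<notin> e \<and> insert p e \<in> T}"

definition nonstar :: "(real^2) set set \<Rightarrow> real^2 \<Rightarrow> (real^2) set set" where
  "nonstar T p = {t\<in>T. p \<notin> t}"

definition stuck :: "(real^2) set set \<Rightarrow> real^2 \<Rightarrow> bool" where
  "stuck T p \<longleftrightarrow> (\<nexists>r q s. flippable T p r q s)"

lemma T_decomp: "T = nonstar T p \<union> insert p ` link T p"
proof -
  have "t \<in> insert p ` link T p" if "t \<in> T" "p \<in> t" for t
    using that by (intro image_eqI[of _ _ "t - {p}"]) (auto simp: link_def insert_absorb)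
  then show ?thesis by (auto simp: nonstar_def link_def)
qed

lemma card_link_elem: "T \<in> triangs A \<Longrightarrow> e \<in> link T p \<Longrightarrow> card e = 2"
  using card_empty_tris[of "insert p e" A] triangs_empty_tris[of T A "insert p e"]
  by (cases "finite e") (auto simp: link_def)

lemma finite_link: "finite A \<Longrightarrow> T \<in> triangs A \<Longrightarrow> finite (link T p)"
proof -
  assume "finite A" "T \<in> triangs A"
  then have "finite T" using triangs_finite by blast
  moreover have "link T p \<subseteq> (\<lambda>t. t - {p}) ` T"
    by (auto simp: link_def intro!: image_eqI[of _ _ "insert p _"])
  ultimately show ?thesis by (meson finite_imageI finite_subset)
qed

text \<open>Read backwards, from \<open>T1\<close> to \<open>T\<close>: the star of \<open>p\<close>
  swallows \<open>{r,q,s}\<close> across the link edge \<open>{r,s}\<close>, which is replaced by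
  the other two edges of that triangle.\<close>

lemma flip_structure:
  assumes T: "T \<in> triangs A" and fin: "finite A" and f: "flippable T p r q s"
  obtains T1 where "T1 \<in> triangs A" "link T1 p = (link T p - {{r,q},{q,s}}) \<union> {{r,s}}"
    "{r,q} \<in> link T p" "{q,s} \<in> link T p" "{r,q} \<noteq> {q,s}" "{r,s} \<notin> link T p"
    "{r,q,s} \<in> nonstar T1 p" "nonstar T p = nonstar T1 p - {{r,q,s}}" "card {r,q,s} = 3"
proof -
  interpret quad p r q s using f by unfold_locales (auto simp: flippable_def link_edge_def)
  have in_T: "{p,r,q} \<in> T" "{p,q,s} \<in> T" using f by (auto simp: flippable_def link_edge_def)
  let ?T1 = "(T - {{p,r,q},{p,q,s}}) \<union> {{p,r,s},{r,q,s}}"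
  have T1: "?T1 \<in> triangs A" and dj: "{{p,r,s},{r,q,s}} \<inter> (T - {{p,r,q},{p,q,s}}) = {}"
    using flip_triangs[OF T fin f] .
  have new: "{p,r,s} \<notin> {{p,r,q},{p,q,s}}" "{r,q,s} \<notin> {{p,r,q},{p,q,s}}" using distinct by auto
  have lnk: "link ?T1 p = (link T p - {{r,q},{q,s}}) \<union> {{r,s}}"
  proof (rule set_eqI)
    fix e
    show "e \<in> link ?T1 p \<longleftrightarrow> e \<in> (link T p - {{r,q},{q,s}}) \<union> {{r,s}}"
    proof (cases "p \<in> e")
      case True
      then show ?thesis using distinct by (auto simp: link_def)
    next
      case False
      have "insert p e = {p,r,q} \<longleftrightarrow> e = {r,q}" "insert p e = {p,q,s} \<longleftrightarrow> e = {q,s}" "insert p e = {p,r,s} \<longleftrightarrow> e = {r,s}"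
        using False distinct by (auto simp: insert_ident)
      moreover have "insert p e \<noteq> {r,q,s}" using distinct by auto
      ultimately show ?thesis using False unfolding link_def by simp
    qed
  qed
  have ns: "nonstar ?T1 p = insert {r,q,s} (nonstar T p)" "{r,q,s} \<notin> nonstar T p"
  proof -
    have "{r,q,s} \<notin> T" using new(2) dj by blast
    moreover have "p \<notin> {r,q,s}" using distinct by blast
    ultimately show "nonstar ?T1 p = insert {r,q,s} (nonstar T p)" "{r,q,s} \<notin> nonstar T p"
      unfolding nonstar_def by blast+
  qed
  have in_l: "{r,q} \<in> link T p" "{q,s} \<in> link T p" "{r,s} \<notin> link T p"
    using in_T new dj distinct unfolding link_def by auto
  show ?thesis
  proof (rule that[OF T1 lnk in_l(1,2) _ in_l(3)])
    show "{r,q} \<noteq> {q,s}" "card {r,q,s} = 3" using distinct by (auto simp: doubleton_eq_iff)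
    show "{r,q,s} \<in> nonstar ?T1 p" "nonstar T p = nonstar ?T1 p - {{r,q,s}}" using ns by auto
  qed
qed

text \<open>Every swallowed triangle changes the link by the symmetric difference with its boundary; the parity
  condition therefore recovers the link from the swallowed set without its order.\<close>

lemma encode:
  assumes fin: "finite A"
  shows "T \<in> triangs A \<Longrightarrow> \<exists>T0 S. T0 \<in> triangs A \<and> stuck T0 p \<and> S \<subseteq> nonstar T0 p \<and> grown (link T0 p) S \<and>
     nonstar T p = nonstar T0 p - S \<and> card (link T p) = card (link T0 p) + card S \<and>
     (\<forall>e. card e = 2 \<longrightarrow> (e \<in> link T p \<longleftrightarrow> ((e \<in> link T0 p) \<noteq> odd (card {t\<in>S. e \<subseteq> t}))))"
proof (induction "card (link T p)" arbitrary: T)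
  case 0
  have "stuck T p"
  proof (rule ccontr)
    assume "\<not> ?thesis"
    then obtain r q s where "flippable T p r q s" by (auto simp: stuck_def)
    then have "{r,q} \<in> link T p" by (auto simp: flippable_def link_edge_def link_def)
    then show False using 0 finite_link[OF fin] by auto
  qed
  then show ?case using 0 by (intro exI[of _ T] exI[of _ "{}"]) (auto simp: grown_def)
next
  case (Suc n)
  show ?case
  proof (cases "stuck T p")
    case True
    then show ?thesis using Suc by (intro exI[of _ T] exI[of _ "{}"]) (auto simp: grown_def)
  next
    case False
    then obtain r q s where f: "flippable T p r q s" by (auto simp: stuck_def)
    obtain T1 where T1: "T1 \<in> triangs A" "link T1 p = (link T p - {{r,q},{q,s}}) \<union> {{r,s}}"
      "{r,q} \<in> link T p" "{q,s} \<in> link T p" "{r,q} \<noteq> {q,s}" "{r,s} \<notin> link T p"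
      "{r,q,s} \<in> nonstar T1 p" "nonstar T p = nonstar T1 p - {{r,q,s}}" "card {r,q,s} = 3"
      using flip_structure[OF Suc.prems fin f] by blast
    have fl: "finite (link T p)" using finite_link[OF fin Suc.prems] .
    have "card (link T p - {{r,q},{q,s}}) = card (link T p) - 2"
      using T1 by (subst card_Diff_subset) auto
    moreover have "card {{r,q},{q,s}} \<le> card (link T p)" using T1 fl by (intro card_mono) auto
    ultimately have cl: "card (link T p) = Suc (card (link T1 p))"
      using T1 fl by simp
    obtain T0 S where IH: "T0 \<in> triangs A" "stuck T0 p" "S \<subseteq> nonstar T0 p" "grown (link T0 p) S"
     "nonstar T1 p = nonstar T0 p - S" "card (link T1 p) = card (link T0 p) + card S"
     "\<And>e. card e = 2 \<Longrightarrow> (e \<in> link T1 p \<longleftrightarrow> ((e \<in> link T0 p) \<noteq> odd (card {t\<in>S. e \<subseteq> t})))"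
      using Suc.hyps(1)[OF _ T1(1)] Suc.hyps(2) cl by auto
    have fS: "finite S" using IH(3) triangs_finite[OF fin IH(1)] by (auto simp: nonstar_def intro: finite_subset)
    have d: "r \<noteq> q" "q \<noteq> s" "r \<noteq> s" using T1(9) by (auto simp: card_insert_if split: if_splits)
    have rs2: "card {r,s} = 2" using d by simp
    have nS: "{r,q,s} \<notin> S" "{r,q,s} \<in> nonstar T0 p" using T1 IH by auto
    \<comment> \<open>As \<open>{r,s}\<close> is in the link of \<open>T1\<close>, the parity
      condition makes it a root edge or an edge of an already swallowed triangle.\<close>
    have "{r,s} \<in> link T0 p \<or> (\<exists>t'\<in>S. {r,s} \<subseteq> t')"
    proof (rule ccontr)
      assume n: "\<not> ?thesis"
      then have "{t\<in>S. {r,s} \<subseteq> t} = {}" by blast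
      then have "card {t\<in>S. {r,s} \<subseteq> t} = 0" by (simp only: card.empty)
      then show False using IH(7)[OF rs2] n T1(2) by auto
    qed
    then have g: "grown (link T0 p) (insert {r,q,s} S)" using grown_insert[OF IH(4) rs2, of "{r,q,s}"] by blast
    have par: "e \<in> link T p \<longleftrightarrow> ((e \<in> link T0 p) \<noteq> odd (card {t\<in>insert {r,q,s} S. e \<subseteq> t}))" if e: "card e = 2" for e
    proof -
      have "e \<subseteq> {r,q,s} \<longleftrightarrow> e \<in> {{r,q},{q,s},{r,s}}"
        using e d by (auto simp: card_2_iff)
      then have m: "e \<subseteq> {r,q,s} \<longleftrightarrow> e = {r,q} \<or> e = {q,s} \<or> e = {r,s}" by simp
      have "e \<in> link T1 p \<longleftrightarrow> (e \<in> link T p \<and> e \<noteq> {r,q} \<and> e \<noteq> {q,s}) \<or> e = {r,s}" unfolding T1(2) by blast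
      moreover have "{r,q} \<noteq> {r,s}" "{q,s} \<noteq> {r,s}" using d by auto
      ultimately have "e \<in> link T p \<longleftrightarrow> ((e \<in> link T1 p) \<noteq> (e \<subseteq> {r,q,s}))"
        unfolding m using T1(3,4,6) by metis
      moreover have "card {t\<in>insert {r,q,s} S. e \<subseteq> t} = card {t\<in>S. e \<subseteq> t} + of_bool (e \<subseteq> {r,q,s})"
      proof -
        have "{t\<in>insert {r,q,s} S. e \<subseteq> t} = (if e \<subseteq> {r,q,s} then insert {r,q,s} {t\<in>S. e \<subseteq> t} else {t\<in>S. e \<subseteq> t})" by auto
        then show ?thesis using nS fS by (simp del: insert_subset)
      qed
      ultimately show ?thesis using IH(7)[OF e] by auto
    qed
    have "nonstar T p = nonstar T0 p - insert {r,q,s} S" "insert {r,q,s} S \<subseteq> nonstar T0 p"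
      unfolding T1(8) IH(5) using nS IH(3) by (auto simp del: insert_iff)
    moreover have "card (link T p) = card (link T0 p) + card (insert {r,q,s} S)"
      using cl IH(6) nS fS by simp
    ultimately show ?thesis using IH(1,2) g par by blast
  qed
qed

text \<open>Each swallowed triangle adds one link edge, so the weight of \<open>T\<close> depends
  only on the pair \<open>(T0, S)\<close> from \<open>encode\<close>. That pair determines the
  triangles avoiding \<open>p\<close> and, by parity, the link, hence \<open>T\<close>. It remains
  to sum over the sets \<open>S\<close> for each stuck \<open>T0\<close>.\<close>

lemma point_bound:
  assumes fin: "finite A"
  shows "(\<Sum>T\<in>triangs A. m - card (link T p))
    \<le> (\<Sum>T\<in>{T\<in>triangs A. stuck T p}. ballot (card (link T p)) (m - card (link T p)))"
proof -
  let ?Q = "{T\<in>triangs A. stuck T p}"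
  let ?G = "\<lambda>T0. {S. S \<subseteq> nonstar T0 p \<and> grown (link T0 p) S}"
  define P where "P T x \<longleftrightarrow> (case x of (T0, S) \<Rightarrow> T0 \<in> ?Q \<and> S \<in> ?G T0 \<and>
     nonstar T p = nonstar T0 p - S \<and> card (link T p) = card (link T0 p) + card S \<and>
     (\<forall>e. card e = 2 \<longrightarrow> (e \<in> link T p \<longleftrightarrow> ((e \<in> link T0 p) \<noteq> odd (card {t\<in>S. e \<subseteq> t})))))" for T x
  have "\<forall>T\<in>triangs A. \<exists>x. P T x" 
  proof
    fix T assume "T \<in> triangs A"
    from encode[OF fin this, of p] obtain T0 S where "P T (T0,S)" unfolding P_def by auto
    then show "\<exists>x. P T x" ..
  qed
  then obtain enc where enc: "\<And>T. T \<in> triangs A \<Longrightarrow> P T (enc T)" by metis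
  have inj: "inj_on enc (triangs A)"
  proof (rule inj_onI)
    fix T T' assume T: "T \<in> triangs A" "T' \<in> triangs A" "enc T = enc T'"
    obtain T0 S where x: "enc T = (T0,S)" by force
    have 1: "P T (T0,S)" "P T' (T0,S)" using enc[OF T(1)] enc[OF T(2)] T(3) x by auto
    have ns: "nonstar T p = nonstar T' p" using 1 by (simp add: P_def)
    have "e \<in> link T p \<longleftrightarrow> e \<in> link T' p" if "card e = 2" for e using 1 that by (simp add: P_def)
    then have "link T p = link T' p" using card_link_elem T by blast
    then show "T = T'" using ns T_decomp[of T p] T_decomp[of T' p] by simp
  qed
  have fT: "T \<in> triangs A \<Longrightarrow> finite T" for T using triangs_finite[OF fin] .
  have fG: "finite (?G T0)" if "T0 \<in> ?Q" for T0
  proof -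
    have "finite (nonstar T0 p)" using that fT by (auto simp: nonstar_def)
    then show ?thesis by simp
  qed
  let ?w = "\<lambda>(T0,S). m - card (link T0 p) - card S"
  have "(\<Sum>T\<in>triangs A. m - card (link T p)) = (\<Sum>T\<in>triangs A. ?w (enc T))"
  proof (rule sum.cong[OF refl])
    fix T assume "T \<in> triangs A"
    then have "P T (enc T)" by (rule enc)
    then show "m - card (link T p) = ?w (enc T)" unfolding P_def by (auto split: prod.splits)
  qed
  also have "\<dots> = (\<Sum>x\<in>enc ` triangs A. ?w x)" by (simp add: sum.reindex[OF inj])
  also have "\<dots> \<le> (\<Sum>x\<in>Sigma ?Q ?G. ?w x)"
  proof (rule sum_mono2)
    show "finite (Sigma ?Q ?G)" using fG finite_triangs[OF fin] by (intro finite_SigmaI) auto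
    show "enc ` triangs A \<subseteq> Sigma ?Q ?G"
    proof
      fix x assume "x \<in> enc ` triangs A"
      then obtain T where "P T x" using enc by blast
      then show "x \<in> Sigma ?Q ?G" unfolding P_def by auto
    qed
  qed auto
  also have "\<dots> = (\<Sum>T0\<in>?Q. \<Sum>S\<in>?G T0. m - card (link T0 p) - card S)"
    using fG finite_triangs[OF fin] by (subst sum.Sigma) auto
  also have "\<dots> \<le> (\<Sum>T\<in>?Q. ballot (card (link T p)) (m - card (link T p)))"
  proof (rule sum_mono)
    fix T0 assume "T0 \<in> ?Q"
    then have T0: "T0 \<in> triangs A" by simp
    have sub: "nonstar T0 p \<subseteq> T0" by (auto simp: nonstar_def)
    show "(\<Sum>S\<in>?G T0. m - card (link T0 p) - card S) \<le> ballot (card (link T0 p)) (m - card (link T0 p))"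
    proof (rule grown_count)
      show "finite (nonstar T0 p)" using sub fT[OF T0] finite_subset by blast
      show "card t = 3" if "t \<in> nonstar T0 p" for t using that sub card_empty_tris triangs_empty_tris[OF T0] by blast
      show "finite (link T0 p)" using finite_link[OF fin T0] .
      show 2: "card {t \<in> nonstar T0 p. e \<subseteq> t} \<le> 2" if "card e = 2" for e
      proof -
        have "card {t \<in> nonstar T0 p. e \<subseteq> t} \<le> card {t \<in> T0. e \<subseteq> t}"
          using sub fT[OF T0] by (intro card_mono) auto
        then show ?thesis using edge_multiplicity[OF T0 fin that] by simp
      qed
      show "card e = 2 \<and> card {t \<in> nonstar T0 p. e \<subseteq> t} \<le> 1" if e: "e \<in> link T0 p" for e
      proof -
        have c: "card e = 2" using card_link_elem[OF T0 e] .
        have i: "insert p e \<in> T0" "insert p e \<notin> nonstar T0 p" using e by (auto simp: link_def nonstar_def)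
        \<comment> \<open>The star triangle takes one of the two places at \<open>e\<close>, so at
          most one triangle avoiding \<open>p\<close> lies on \<open>e\<close>.\<close>
        have "insert (insert p e) {t \<in> nonstar T0 p. e \<subseteq> t} \<subseteq> {t \<in> T0. e \<subseteq> t}" using i sub by auto
        then have "card (insert (insert p e) {t \<in> nonstar T0 p. e \<subseteq> t}) \<le> card {t \<in> T0. e \<subseteq> t}"
          using fT[OF T0] by (intro card_mono) auto
        moreover have "finite {t \<in> nonstar T0 p. e \<subseteq> t}" using sub fT[OF T0] finite_subset by fastforce
        ultimately show ?thesis using edge_multiplicity[OF T0 fin c] i c by simp
      qed
    qed simp
  qed
  finally show ?thesis .
qed

text \<open>Only \<open>k = 3\<close> reaches 59; a star of four triangles, which collinear points
  make possible, gives 25.\<close>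

lemma ballot_interior: assumes "k \<ge> 3" shows "ballot k (7 - k) \<le> 59"
proof -
  consider "k = 3" | "k = 4" | "k = 5" | "k = 6" | "k \<ge> 7" using assms by linarith
  then show ?thesis by cases (simp_all add: numeral_eq_Suc)
qed

text \<open>Only \<open>k = 1\<close> reaches 7; the values at \<open>k = 0\<close> and
  \<open>k = 2\<close> are both 4.\<close>

lemma ballot_boundary: "ballot k (4 - k) \<le> 7"
proof -
  consider "k = 0" | "k = 1" | "k = 2" | "k = 3" | "k \<ge> 4" by linarith
  then show ?thesis by cases (simp_all add: numeral_eq_Suc)
qed

section \<open>Removing a point from a stuck triangulation\<close>

text \<open>Says that \<open>A\<close> is not contained in a line, since a noncollinear triple is
  counterclockwise in one of its orders.\<close>

definition nondeg :: "(real^2) set \<Rightarrow> bool" where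
  "nondeg A \<longleftrightarrow> (\<exists>a\<in>A. \<exists>b\<in>A. \<exists>c\<in>A. orient a b c > 0)"

lemma orient_zero_zero: "orient p z x = 0 \<Longrightarrow> orient p z y = 0 \<Longrightarrow> orient p x y \<noteq> 0 \<Longrightarrow> z = p"
  using orient_decomp[of p x y z] orient_split[of z x y p] orient_swap(1)[of p z y] orient_swap(1)[of p z x] by auto

lemma nondeg_orient:
  assumes "nondeg A" "z \<noteq> p"
  obtains y where "y \<in> A" "orient p z y \<noteq> 0"
proof -
  obtain a b c where abc: "a \<in> A" "b \<in> A" "c \<in> A" "orient a b c > 0" using assms by (auto simp: nondeg_def)
  have "orient p b c \<noteq> 0 \<or> orient p c a \<noteq> 0 \<or> orient p a b \<noteq> 0"
    using orient_split[of p b c a] abc(4) orient_rot[of p a b] orient_rot[of a p c] orient_rot[of p c a] orient_rot[of a b p] by fastforce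
  then obtain x y where "x \<in> A" "y \<in> A" "orient p x y \<noteq> 0" using abc by blast
  then show ?thesis using orient_zero_zero[of p z x y] assms(2) that by blast
qed

text \<open>A point \<open>y\<close> off the line through \<open>p\<close> and \<open>z\<close>
  tells on which side of \<open>z\<close> the hull continues, and \<open>star_direction\<close>
  finds a star triangle there.\<close>

lemma cone_cover:
  assumes T: "T \<in> triangs A" and fin: "finite A" and nd: "nondeg A" and p: "p \<in> A" and z: "z \<in> A" "z \<noteq> p"
  obtains c d where "link_edge T p c d" "orient p c z \<ge> 0" "orient p z d \<ge> 0"
proof -
  obtain y where y: "y \<in> A" "orient p z y \<noteq> 0" using nondeg_orient[OF nd z(2)] by blast
  have A: "z \<in> convex hull A" "y \<in> convex hull A" using z y hull_inc by fast+
  show ?thesis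
  proof (cases "orient p z y > 0")
    case True
    then obtain c d where "{p,c,d} \<in> T" "orient p c d > 0" "orient p c z \<ge> 0" "orient p z d > 0"
      using star_direction[OF T fin p A, of 1] by auto
    then show ?thesis using that[of c d] by (simp add: link_edge_def)
  next
    case False
    then obtain c d where "{p,c,d} \<in> T" "orient p c d < 0" "orient p c z \<le> 0" "orient p z d < 0"
      using star_direction[OF T fin p A, of "-1"] y by auto
    then show ?thesis using that[of d c] orient_swap(1)[of p c d] orient_swap(1)[of p z d] orient_swap(1)[of p c z]
      by (simp add: link_edge_def insert_commute)
  qed
qed

text \<open>Otherwise \<open>z\<close> would lie in the triangle \<open>p c d\<close>, against its
  emptiness.\<close>

lemma beyond_link:
  assumes T: "T \<in> triangs A" and l: "link_edge T p c d" and z: "z \<in> A" "z \<noteq> p" "orient p c z \<ge> 0" "orient p z d \<ge> 0"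
  shows "orient c d z \<le> 0"
proof (rule ccontr)
  assume n: "\<not> ?thesis"
  have o: "orient p c d > 0" "{p,c,d} \<in> T" using l by (auto simp: link_edge_def)
  have "z \<in> convex hull {p,c,d}" using n z orient_rot[of d p z] by (auto simp: in_triangle_iff[OF o(1)])
  then have "z \<in> {p,c,d}" using triangs_empty_tris[OF T o(2)] z by (auto simp: empty_tris_def)
  then show False using n z by auto
qed

text \<open>The functional \<open>orient a b\<close> is positive at \<open>p\<close> and nonpositive
  at the neighbours. Any other \<open>z\<close> lies in the cone of a star triangle
  \<open>p c d\<close>, on or beyond \<open>c d\<close>, so its barycentric coordinate at
  \<open>p\<close> is nonpositive and those at \<open>c\<close> and \<open>d\<close> are
  nonnegative.\<close>

lemma supporting_all:
  assumes T: "T \<in> triangs A" and fin: "finite A" and nd: "nondeg A" and l: "link_edge T p a b"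
    and H: "\<And>w. w \<in> nbrs T p \<Longrightarrow> orient a b w \<le> 0" and z: "z \<in> A" "z \<noteq> p"
  shows "orient a b z \<le> 0"
proof -
  have p: "p \<in> A" using link_edge_A[OF T l] by simp
  obtain c d where cd: "link_edge T p c d" "orient p c z \<ge> 0" "orient p z d \<ge> 0" using cone_cover[OF T fin nd p z] by blast
  have o: "orient p c d > 0" using cd by (simp add: link_edge_def)
  have "orient c d z \<le> 0" using beyond_link[OF T cd(1) z cd(2,3)] .
  then have "orient z c d \<le> 0" using orient_rot[of z c d] by simp
  moreover have "orient a b p > 0" using l orient_rot[of p a b] by (simp add: link_edge_def)
  ultimately have "orient z c d * orient a b p \<le> 0" by (simp add: mult_nonpos_nonneg)
  moreover have "orient p z d * orient a b c \<le> 0" "orient p c z * orient a b d \<le> 0"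
    using cd H[OF link_edge_nbrs(1)[OF cd(1)]] H[OF link_edge_nbrs(2)[OF cd(1)]] by (simp_all add: mult_nonneg_nonpos)
  ultimately have "orient p c d * orient a b z \<le> 0" using orient_bary[of p c d a b z] by linarith
  then show ?thesis using o by (auto simp: mult_le_0_iff)
qed

text \<open>A neighbour \<open>b\<close> bulging over the chord \<open>a z\<close> would lead to a
  flip. Written with areas, its absence becomes a linear inequality.\<close>

lemma stuckD:
  assumes "T \<in> triangs A" "finite A" "stuck T p" "a \<in> nbrs T p" "b \<in> nbrs T p" "z \<in> nbrs T p"
    "orient p a b > 0" "orient p b z > 0" "orient p a z > 0"
  shows "orient p a b + orient p b z \<le> orient p a z"
proof -
  have "orient a b z \<le> 0" using flippable_exists[OF assms(1,2,4-9)] assms(3) by (fastforce simp: stuck_def)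
  moreover have "orient a b z = orient p b z + orient a p z + orient a b p" using orient_split[of p b z a] by simp
  moreover have "orient a p z = - orient p a z" "orient a b p = orient p a b" using orient_swap(2)[of p a z] orient_rot[of p a b] by auto
  ultimately show ?thesis by linarith
qed

text \<open>Two neighbours on the same ray from \<open>p\<close> coincide by \<open>ray_eq\<close>,
  so here \<open>p\<close> lies strictly between \<open>a\<close> and \<open>z\<close>.\<close>

definition opposite_pair :: "(real^2) set set \<Rightarrow> real^2 \<Rightarrow> bool" where
  "opposite_pair T p \<longleftrightarrow> (\<exists>a\<in>nbrs T p. \<exists>z\<in>nbrs T p. a \<noteq> z \<and> orient p a z = 0)"

text \<open>The three directions wind once around \<open>p\<close>, so \<open>p\<close> is interior
  to the triangle \<open>c d x\<close>.\<close>

definition spanning_link :: "(real^2) set set \<Rightarrow> real^2 \<Rightarrow> bool" where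
  "spanning_link T p \<longleftrightarrow> (\<exists>c d x. link_edge T p c d \<and> x \<in> nbrs T p \<and> orient p d x > 0 \<and> orient p x c > 0)"

text \<open>The signs of a neighbour \<open>w\<close> against the rays to \<open>a\<close> and
  \<open>b\<close> leave four cases. In two of them stuckness keeps \<open>w\<close> behind the line
  \<open>a b\<close>; one would put \<open>w\<close> into the cone of a star triangle, and one would
  make \<open>w\<close> the third vertex of a spanning link. From neighbours to all points it is
  \<open>supporting_all\<close>.\<close>

lemma supporting_link:
  assumes T: "T \<in> triangs A" and fin: "finite A" and nd: "nondeg A" and st: "stuck T p"
    and no: "\<not> opposite_pair T p" "\<not> spanning_link T p" and l: "link_edge T p a b" and z: "z \<in> A" "z \<noteq> p"
  shows "orient a b z \<le> 0"
proof (rule supporting_all[OF T fin nd l _ z])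
  fix w assume w: "w \<in> nbrs T p"
  have ab: "orient p a b > 0" using l by (simp add: link_edge_def)
  have split: "orient a b w = orient p b w - orient p a w + orient p a b" 
    using orient_split[of p b w a] orient_swap(2)[of p a w] orient_rot[of p a b] by simp
  note sw = orient_swap(1)[of p a w] orient_swap(1)[of p b w]
  show "orient a b w \<le> 0"
  proof (cases "w = a \<or> w = b")
    case True then show ?thesis by auto
  next
    case False
    then have "orient p a w \<noteq> 0" "orient p b w \<noteq> 0" using no(1) w link_edge_nbrs[OF l] by (auto simp: opposite_pair_def)
    then consider "orient p a w > 0" "orient p b w > 0" | "orient p a w > 0" "orient p b w < 0" | "orient p a w < 0" "orient p b w > 0" | "orient p a w < 0" "orient p b w < 0"
      by linarith
    then show ?thesis
    proof cases
      case 1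
      then show ?thesis using stuckD[OF T fin st link_edge_nbrs[OF l] w ab] split by simp
    next
      case 2
      then show ?thesis using not_in_cone[OF T l w] sw by simp
    next
      case 3
      then show ?thesis using no(2) l w sw by (auto simp: spanning_link_def)
    next
      case 4
      then show ?thesis using stuckD[OF T fin st w link_edge_nbrs[OF l]] ab split sw by simp
    qed
  qed
qed

text \<open>\<open>y\<close> is on or beyond \<open>c d\<close>, whereas \<open>c\<close> and
  \<open>d\<close> are on or beyond the line \<open>a b\<close> through \<open>y\<close>. This
  forces \<open>y\<close> onto \<open>c d\<close> and so into an empty triangle.\<close>

lemma supporting_no_cone:
  assumes c: "{p,c,d} \<in> empty_tris A" "orient p c d > 0" "y \<in> A" "orient c d y \<le> 0"
    and ab: "orient a b p > 0" "orient a b c \<le> 0" "orient a b d \<le> 0" "orient a b y = 0"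
    and y: "orient p c y > 0" "orient p y d > 0"
  shows False
proof -
  have "orient y c d * orient a b p + orient p y d * orient a b c + orient p c y * orient a b d = 0"
    using orient_bary[of p c d a b y] ab by simp
  moreover have "orient p y d * orient a b c \<le> 0" "orient p c y * orient a b d \<le> 0"
    using y ab by (simp_all add: mult_nonneg_nonpos)
  ultimately have "orient y c d * orient a b p \<ge> 0" by linarith
  then have "orient y c d \<ge> 0" using ab(1) by (auto simp: zero_le_mult_iff)
  then have "y \<in> convex hull {p,c,d}" using y orient_rot[of y c d] orient_rot[of d p y] by (auto simp: in_triangle_iff[OF c(2)])
  then have "y \<in> {p,c,d}" using c by (auto simp: empty_tris_def)
  then show False using y by auto
qed

text \<open>Serves as exceptional null set: off it, weak sign conditions on a point become
  strict.\<close>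

definition all_lines :: "(real^2) set \<Rightarrow> (real^2) set" where
  "all_lines A = (\<Union>(a,b)\<in>{(a,b)\<in>A \<times> A. a \<noteq> b}. {x. orient a b x = 0})"

lemma negligible_all_lines: "finite A \<Longrightarrow> negligible (all_lines A)"
  unfolding all_lines_def by (rule negligible_Union) (auto simp: negligible_orient intro: finite_subset[of _ "A \<times> A"])

lemma all_lines_D: "x \<notin> all_lines A \<Longrightarrow> a \<in> A \<Longrightarrow> b \<in> A \<Longrightarrow> a \<noteq> b \<Longrightarrow> orient a b x \<noteq> 0"
  by (auto simp: all_lines_def)

text \<open>If \<open>p\<close> is an extreme point, the link of \<open>p\<close> consists of the hull edges of \<open>A - {p}\<close> visible from \<open>p\<close>
  and hence does not depend on the triangulation.\<close>

lemma supporting_unique: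
  assumes T: "T \<in> triangs A" and fin: "finite A" and nd: "nondeg A" and st: "stuck T p"
    and no: "\<not> opposite_pair T p" "\<not> spanning_link T p"
    and t: "{p,a,b} \<in> empty_tris A" "orient p a b > 0" "\<And>z. z \<in> A \<Longrightarrow> z \<noteq> p \<Longrightarrow> orient a b z \<le> 0"
  shows "{p,a,b} \<in> T"
proof -
  have sub: "{p,a,b} \<subseteq> A" using t(1) by (auto simp: empty_tris_def)
  have "open_tri p a b \<subseteq> convex hull {p,a,b}" using open_tri_subset[OF t(2)] interior_subset by blast
  also have "\<dots> \<subseteq> convex hull A" using sub by (rule hull_mono)
  finally obtain x where x: "x \<in> open_tri p a b" "x \<notin> all_lines A" "card {t\<in>T. x \<in> convex hull t} = 1"
    using triangs_generic[OF T open_open_tri open_tri_nonempty[OF t(2)] _ negligible_all_lines[OF fin]] by blast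
  then obtain t' where "{t\<in>T. x \<in> convex hull t} = {t'}" by (auto simp: card_1_singleton_iff)
  then have t': "t' \<in> T" "x \<in> convex hull t'" by auto
  \<comment> \<open>Triangles avoiding \<open>p\<close> lie behind the line \<open>a b\<close>,
    whereas \<open>x\<close> is in front of it.\<close>
  have "p \<in> t'"
  proof (rule ccontr)
    assume "p \<notin> t'"
    then have "t' \<subseteq> {z. orient a b z \<le> 0}" using t(3) triangs_empty_tris[OF T t'(1)] by (auto simp: empty_tris_def)
    then have "convex hull t' \<subseteq> {z. orient a b z \<le> 0}" by (intro hull_minimal convex_orient_le)
    then show False using t' x by (auto simp: open_tri_def)
  qed
  then obtain c d where cd: "t' = {p,c,d}" "orient p c d > 0" using empty_tris_at triangs_empty_tris[OF T t'(1)] by blast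
  then have l: "link_edge T p c d" using t' by (simp add: link_edge_def)
  have E: "{p,c,d} \<in> empty_tris A" using triangs_empty_tris[OF T t'(1)] cd by simp
  have A: "c \<in> A" "d \<in> A" "a \<in> A" "b \<in> A" "p \<in> A" using E sub by (auto simp: empty_tris_def)
  have ne: "c \<noteq> p" "d \<noteq> p" "a \<noteq> p" "b \<noteq> p" using t(2) cd by auto
  have H: "orient c d z \<le> 0" if "z \<in> A" "z \<noteq> p" for z using supporting_link[OF T fin nd st no l that] .
  have x1: "orient p a x > 0" "orient p x b > 0" using x orient_rot[of b p x] by (auto simp: open_tri_def)
  have "orient p c x \<ge> 0" "orient p x d \<ge> 0" using t'(2) orient_rot[of d p x] unfolding cd(1) in_triangle_iff[OF cd(2)] by auto
  then have x2: "orient p c x > 0" "orient p x d > 0"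
    using all_lines_D[OF x(2) A(5) A(1)] all_lines_D[OF x(2) A(5) A(2)] ne orient_swap(1)[of p x d] by force+
  have abp: "orient a b p > 0" "orient c d p > 0" using t(2) cd orient_rot[of p a b] orient_rot[of p c d] by auto
  \<comment> \<open>The cones of \<open>p a b\<close> and \<open>p c d\<close> share the direction
    of \<open>x\<close>. If they differed, a side of one would run strictly inside the other,
    against \<open>supporting_no_cone\<close>; \<open>mid\<close> and \<open>mid2\<close> supply the
    missing cone inequality for the first and the second side.\<close>
  have mid: "orient p u w > 0" if "orient p v u > 0" "orient p u x > 0" "orient p x w > 0" "orient p v x > 0" "orient p v w > 0" for u v w
    using cone_chain[of p v u x w] that by simp
  have mid2: "orient p v u > 0" if "orient p u w > 0" "orient p x u > 0" "orient p v x > 0" "orient p x w > 0" "orient p v w > 0" for u v w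
    using cone_chain[of p v x u w] that by simp
  have "\<not> orient p c a > 0"
  proof
    assume h: "orient p c a > 0"
    show False using supporting_no_cone[OF E cd(2) A(3) H[OF A(3) ne(3)] abp(1) t(3)[OF A(1) ne(1)] t(3)[OF A(2) ne(2)] _ h]
      mid[OF h x1(1) x2(2) x2(1) cd(2)] by simp
  qed
  moreover have "\<not> orient p a c > 0"
  proof
    assume h: "orient p a c > 0"
    show False using supporting_no_cone[OF t(1,2) A(1) t(3)[OF A(1) ne(1)] abp(2) H[OF A(3) ne(3)] H[OF A(4) ne(4)] _ h]
      mid[OF h x2(1) x1(2) x1(1) t(2)] by simp
  qed
  moreover have "\<not> orient p b d > 0"
  proof
    assume h: "orient p b d > 0"
    show False using supporting_no_cone[OF E cd(2) A(4) H[OF A(4) ne(4)] abp(1) t(3)[OF A(1) ne(1)] t(3)[OF A(2) ne(2)] _ _ h]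
      mid2[OF h x1(2) x2(1) x2(2) cd(2)] by simp
  qed
  moreover have "\<not> orient p d b > 0"
  proof
    assume h: "orient p d b > 0"
    show False using supporting_no_cone[OF t(1,2) A(2) t(3)[OF A(2) ne(2)] abp(2) H[OF A(3) ne(3)] H[OF A(4) ne(4)] _ _ h]
      mid2[OF h x2(2) x1(1) x1(2) t(2)] by simp
  qed
  ultimately have 0: "orient p a c = 0" "orient p b d = 0" using orient_swap(1)[of p a c] orient_swap(1)[of p b d] by auto
  have "a = c" using ray_eq_empty_tris[OF t(1) E _ _ 0(1), of x] t(2) cd(2) x1 x2 by simp
  moreover have "b = d"
  proof (rule ray_eq_empty_tris[of p b a A d c])
    show "{p,b,a} \<in> empty_tris A" "{p,d,c} \<in> empty_tris A" using t(1) E by (simp_all add: insert_commute)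
    show "orient p b a \<noteq> 0" "orient p d c \<noteq> 0" using t(2) cd(2) orient_swap(1)[of p b a] orient_swap(1)[of p d c] by auto
    show "orient p b x * orient p d x > 0" using x1 x2 orient_swap(1)[of p b x] orient_swap(1)[of p d x] by (simp add: mult_neg_neg)
  qed (rule 0)
  ultimately show ?thesis using t' cd by simp
qed

text \<open>\<open>z\<close> is \<open>p + k (a - p)\<close> with a negative factor, since a
  positive one would put \<open>a\<close> and \<open>z\<close> on the same ray. Signs seen from
  \<open>z\<close> are thus negated signs seen from \<open>a\<close>; the \<open>k\<close> obtained
  is the absolute value of that factor.\<close>

lemma opposite_scale:
  assumes T: "T \<in> triangs A" and a: "a \<in> nbrs T p" and z: "z \<in> nbrs T p" and az: "a \<noteq> z" "orient p a z = 0"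
  obtains k where "k > 0" "\<And>y. orient p z y = - k * orient p a y" "p \<in> convex hull {a,z}"
proof -
  obtain v where v: "orient p a v \<noteq> 0" using nbrs_triangle[OF T a] by blast
  define k where "k = orient p z v / orient p a v"
  have zz: "z = p + k *\<^sub>R (a - p)" unfolding k_def by (rule orient_ray[OF az(2) v])
  have eq: "orient p z y = k * orient p a y" for y unfolding zz by (simp add: orient_def algebra_simps)
  have "k \<noteq> 0" using zz nbrs_ne[OF z] by auto
  moreover have "\<not> k > 0"
  proof
    assume "k > 0"
    then have "orient p a v * orient p z v > 0" unfolding eq using v by (auto simp: zero_less_mult_iff mult_less_0_iff)
    then show False using ray_eq[OF T a z az(2)] az(1) by blast
  qed
  ultimately have k: "k < 0" by simp
  \<comment> \<open>Solves \<open>p = (1 - u) a + u z\<close> for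
    \<open>z = p + k (a - p)\<close>.\<close>
  define u where "u = 1 / (1 - k)"
  have u: "u * (1 - k) = 1" "0 \<le> u" "u \<le> 1" using k by (auto simp: u_def)
  have "(1 - u) *\<^sub>R a + u *\<^sub>R z = (1 - u * (1 - k)) *\<^sub>R a + (u * (1 - k)) *\<^sub>R p"
    unfolding zz by (simp add: algebra_simps)
  then have "p = (1 - u) *\<^sub>R a + u *\<^sub>R z" unfolding u by simp
  then have "p \<in> convex hull {a,z}" unfolding convex_hull_2 using u
    by (intro CollectI exI[of _ "1 - u"] exI[of _ u]) auto
  then show ?thesis using that[of "-k"] eq k by simp
qed

text \<open>If \<open>c\<close> came before \<open>d\<close>, the missing bulge of \<open>c\<close>
  over \<open>a d\<close> would place \<open>d\<close> strictly farther from the line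
  \<open>a z\<close> than \<open>c\<close>, and the missing bulge of \<open>d\<close> over
  \<open>c z\<close> strictly nearer. Equal directions are left to \<open>ray_eq\<close>.\<close>

lemma opposite_side_unique:
  assumes T: "T \<in> triangs A" and fin: "finite A" and st: "stuck T p"
    and a: "a \<in> nbrs T p" and z: "z \<in> nbrs T p" and az: "a \<noteq> z" "orient p a z = 0"
    and c: "c \<in> nbrs T p" "orient p a c > 0" and d: "d \<in> nbrs T p" "orient p a d > 0"
  shows "c = d"
proof -
  obtain k where k: "k > 0" "\<And>y. orient p z y = - k * orient p a y" using opposite_scale[OF T a z az] by blast
  have no: False if c: "c \<in> nbrs T p" "orient p a c > 0" and d: "d \<in> nbrs T p" "orient p a d > 0" and cd: "orient p c d > 0" for c d
  proof -
    have z': "orient p c z = k * orient p a c" "orient p d z = k * orient p a d"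
      using k(2)[of c] k(2)[of d] orient_swap(1)[of p c z] orient_swap(1)[of p d z] by auto
    have "orient p a c + orient p c d \<le> orient p a d" using stuckD[OF T fin st a c(1) d(1) c(2) cd d(2)] .
    moreover have "orient p c d + orient p d z \<le> orient p c z"
      using stuckD[OF T fin st c(1) d(1) z cd] z' k(1) c d by simp
    ultimately have "orient p c d + k * orient p a d \<le> k * orient p a c" "k * orient p a c \<le> k * orient p a d"
      using z' cd k(1) by auto
    then show False using cd by linarith
  qed
  have "orient p c d = 0" using no[OF c d] no[OF d c] orient_swap(1)[of p c d] by fastforce
  moreover have "orient p c a * orient p d a > 0" using c d orient_swap(1)[of p a c] orient_swap(1)[of p a d] by (simp add: mult_neg_neg)
  ultimately show ?thesis using ray_eq[OF T c(1) d(1)] by blast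
qed

text \<open>Stuckness keeps \<open>w\<close> from bulging over \<open>d x\<close>. Then, depending
  on the side of the line \<open>p c\<close> on which \<open>w\<close> lies, \<open>d\<close> bulges
  over \<open>c w\<close> or \<open>x\<close> bulges over \<open>w c\<close>. The Pluecker relation
  turns this into a comparison of products.\<close>

lemma no_fourth:
  assumes T: "T \<in> triangs A" and fin: "finite A" and st: "stuck T p"
    and verts: "c \<in> nbrs T p" "d \<in> nbrs T p" "x \<in> nbrs T p" "w \<in> nbrs T p"
    and pos: "orient p c d > 0" "orient p d x > 0" "orient p x c > 0" and w: "orient p d w > 0" "orient p w x > 0" "orient p c w \<noteq> 0"
  shows False
proof -
  have 1: "orient p d w + orient p w x \<le> orient p d x" using stuckD[OF T fin st verts(2,4,3) w(1,2) pos(2)] .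
  have pl: "orient p c w * orient p d x = orient p w x * orient p c d - orient p d w * orient p x c"
    using orient_plucker[of p c w d x] orient_swap(1)[of p w d] orient_swap(1)[of p x c] by (simp add: algebra_simps)
  show False
  proof (cases "orient p c w > 0")
    case True
    have 2: "orient p c d + orient p d w \<le> orient p c w" using stuckD[OF T fin st verts(1,2,4) pos(1) w(1) True] .
    have "orient p w x * orient p c d \<le> orient p d x * orient p c d" using 1 w pos by (intro mult_right_mono) auto
    moreover have "orient p d w * orient p x c > 0" using w pos by simp
    ultimately have "orient p c w * orient p d x < orient p c d * orient p d x" using pl by (simp add: mult.commute)
    then have "orient p c w < orient p c d" using pos(2) by simp
    then show False using 2 w by linarith
  next
    case False
    then have wc: "orient p w c > 0" using w orient_swap(1)[of p c w] by simp
    have 2: "orient p w x + orient p x c \<le> orient p w c" using stuckD[OF T fin st verts(4,3,1) w(2) pos(3) wc] .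
    have "orient p w c * orient p d x = orient p d w * orient p x c - orient p w x * orient p c d"
      using pl orient_swap(1)[of p c w] by simp
    moreover have "orient p d w * orient p x c \<le> orient p d x * orient p x c" using 1 w pos by (intro mult_right_mono) auto
    moreover have "orient p w x * orient p c d > 0" using w pos by simp
    ultimately have "orient p w c * orient p d x < orient p x c * orient p d x" by (simp add: mult.commute)
    then have "orient p w c < orient p x c" using pos(2) by simp
    then show False using 2 w by linarith
  qed
qed

text \<open>Comparing unions suffices: almost every point is in just one triangle of
  \<open>T\<close>, hence in at most one of \<open>X\<close>.\<close>

lemma triangs_replace_cover:
  assumes T: "T \<in> triangs A" and fin: "finite A" and X: "X \<subseteq> T" and A': "A' \<subseteq> A"
    and E: "T - X \<subseteq> empty_tris A'" "Y \<subseteq> empty_tris A'" and N: "negligible N"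
    and eq: "\<And>x. (\<exists>t\<in>X. x \<in> convex hull t) \<longleftrightarrow> (\<exists>t\<in>Y. x \<in> convex hull t)"
    and uniq: "\<And>x t t'. x \<notin> N \<Longrightarrow> t \<in> Y \<Longrightarrow> t' \<in> Y \<Longrightarrow> x \<in> convex hull t \<Longrightarrow> x \<in> convex hull t' \<Longrightarrow> t = t'"
  shows "(T - X) \<union> Y \<in> triangs A'"
proof (rule triangs_replace[OF T fin X A' E])
  let ?N = "{x \<in> convex hull A. card {t\<in>T. x \<in> convex hull t} \<noteq> 1} \<union> N"
  show "negligible ?N" using T N by (auto simp: triangs_def)
  fix x assume x: "x \<in> convex hull A'" "x \<notin> ?N"
  then have "card {t\<in>T. x \<in> convex hull t} = 1" using hull_mono[OF A', of convex] by auto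
  then obtain t0 where t0: "{t\<in>T. x \<in> convex hull t} = {t0}" by (auto simp: card_1_singleton_iff)
  show "card {t\<in>X. x \<in> convex hull t} = card {t\<in>Y. x \<in> convex hull t}"
  proof (cases "\<exists>t\<in>Y. x \<in> convex hull t")
    case True
    then obtain t1 where t1: "t1 \<in> Y" "x \<in> convex hull t1" by blast
    then have Y1: "{t\<in>Y. x \<in> convex hull t} = {t1}" using uniq x by auto
    obtain t2 where "t2 \<in> X" "x \<in> convex hull t2" using eq[of x] True by blast
    then have "t2 \<in> {t\<in>X. x \<in> convex hull t}" by simp
    moreover have "{t\<in>X. x \<in> convex hull t} \<subseteq> {t\<in>T. x \<in> convex hull t}" using X by auto
    ultimately have "{t\<in>X. x \<in> convex hull t} = {t0}" unfolding t0 by blast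
    then show ?thesis using Y1 by simp
  next
    case False
    then have "{t\<in>X. x \<in> convex hull t} = {}" "{t\<in>Y. x \<in> convex hull t} = {}" using eq[of x] by blast+
    then show ?thesis by (simp only:)
  qed
qed

section \<open>Refilling the hole left by the star of a point\<close>

lemma nonstar_empty_tris: "T \<in> triangs A \<Longrightarrow> nonstar T p \<subseteq> empty_tris (A - {p})"
proof
  fix t assume "T \<in> triangs A" "t \<in> nonstar T p"
  then have t: "t \<in> empty_tris A" "p \<notin> t" using triangs_empty_tris by (auto simp: nonstar_def)
  then show "t \<in> empty_tris (A - {p})" unfolding empty_tris_def by blast
qed

lemma nonstar_not_in_hull: "T \<in> triangs A \<Longrightarrow> p \<in> A \<Longrightarrow> t \<in> nonstar T p \<Longrightarrow> p \<notin> convex hull t"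
  using triangs_empty_tris[of T A t] by (auto simp: nonstar_def empty_tris_def)

lemma nonstar_Diff: "nonstar T p = T - {t\<in>T. p \<in> t}"
  by (auto simp: nonstar_def)

lemma link_iff:
  assumes T: "T \<in> triangs A" shows "e \<in> link T p \<longleftrightarrow> (\<exists>u v. e = {u,v} \<and> link_edge T p u v)"
proof
  assume e: "e \<in> link T p"
  then have m: "insert p e \<in> T" "p \<notin> e" by (auto simp: link_def)
  obtain u v where uv: "insert p e = {p,u,v}" "orient p u v > 0" using empty_tris_at[OF triangs_empty_tris[OF T m(1)], of p] by blast
  moreover have "p \<notin> {u,v}" using uv(2) by auto
  ultimately have "e = {u,v}" using m(2) insert_ident[of p e "{u,v}"] by auto
  then show "\<exists>u v. e = {u,v} \<and> link_edge T p u v" using uv m by (auto simp: link_edge_def)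
next
  assume "\<exists>u v. e = {u,v} \<and> link_edge T p u v"
  then show "e \<in> link T p" by (auto simp: link_def link_edge_def)
qed

lemma star_iff:
  assumes T: "T \<in> triangs A" shows "t \<in> T \<and> p \<in> t \<longleftrightarrow> (\<exists>u v. t = {p,u,v} \<and> link_edge T p u v)"
proof
  assume t: "t \<in> T \<and> p \<in> t"
  then obtain u v where "t = {p,u,v}" "orient p u v > 0" using empty_tris_at triangs_empty_tris[OF T] by metis
  then show "\<exists>u v. t = {p,u,v} \<and> link_edge T p u v" using t by (auto simp: link_edge_def)
qed (auto simp: link_edge_def)

lemma star_cover:
  assumes T: "T \<in> triangs A"
  shows "(\<exists>t\<in>{t\<in>T. p \<in> t}. x \<in> convex hull t) \<longleftrightarrow> (\<exists>u v. link_edge T p u v \<and> x \<in> convex hull {p,u,v})"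
proof
  assume "\<exists>t\<in>{t\<in>T. p \<in> t}. x \<in> convex hull t"
  then obtain t where "t \<in> T \<and> p \<in> t" "x \<in> convex hull t" by auto
  then show "\<exists>u v. link_edge T p u v \<and> x \<in> convex hull {p,u,v}" unfolding star_iff[OF T] by auto
next
  assume "\<exists>u v. link_edge T p u v \<and> x \<in> convex hull {p,u,v}"
  then obtain u v where "link_edge T p u v" "x \<in> convex hull {p,u,v}" by blast
  then show "\<exists>t\<in>{t\<in>T. p \<in> t}. x \<in> convex hull t" by (intro bexI[of _ "{p,u,v}"]) (auto simp: link_edge_def)
qed

lemma empty_tris_hull: "t \<in> empty_tris A \<Longrightarrow> x \<in> convex hull t \<Longrightarrow> x \<in> A \<Longrightarrow> x \<in> t"
  by (auto simp: empty_tris_def)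

lemma segment_orient: "y \<in> convex hull {u,v} \<Longrightarrow> orient u v y = 0"
  unfolding convex_hull_2 by (auto simp: orient_comb)

lemma two_subsets:
  assumes "x \<noteq> y" "y \<noteq> z" "x \<noteq> z"
  shows "card e = 2 \<and> e \<subseteq> {x,y,z} \<longleftrightarrow> e = {x,y} \<or> e = {y,z} \<or> e = {x,z}"
  using assms by (auto simp: card_2_iff)

text \<open>The hypothesis on \<open>z\<close> places \<open>p\<close> between \<open>a\<close> and
  \<open>z\<close>, in the form provided by \<open>opposite_scale\<close>; the segment from
  \<open>p\<close> to \<open>c\<close> then cuts the triangle \<open>a c z\<close> in two.\<close>

lemma split_union:
  assumes c: "orient p a c > 0" and k: "k > 0" and z: "\<And>y. orient p z y = - k * orient p a y"
  shows "x \<in> convex hull {p,a,c} \<or> x \<in> convex hull {p,c,z} \<longleftrightarrow> x \<in> convex hull {a,c,z}"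
    "orient a c z > 0" "orient p c z > 0"
proof -
  have yz: "orient p y z = k * orient p a y" for y using z[of y] orient_swap(1)[of p y z] by simp
  have az: "orient p a z = 0" using yz[of a] by simp
  have zax: "orient z a y = (1 + k) * orient p a y" for y
  proof -
    have "orient z p y = k * orient p a y" using z[of y] orient_swap(2)[of p z y] by simp
    moreover have "orient z a p = 0" using orient_rot[of p z a] orient_swap(1)[of p a z] az by simp
    ultimately show ?thesis using orient_split[of p a y z] by (simp add: algebra_simps)
  qed
  have pcz: "orient p c z > 0" using yz[of c] c k by simp
  have acz: "orient a c z > 0" using zax[of c] c k orient_rot[of z a c] by simp
  show "orient a c z > 0" "orient p c z > 0" using acz pcz by auto
  have pos: "orient a c p > 0" "orient c z p > 0" "orient c z a > 0" 
    using c pcz acz orient_rot[of p a c] orient_rot[of p c z] orient_rot[of a c z] by auto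
  have 1: "x \<in> convex hull {p,a,c} \<or> x \<in> convex hull {p,c,z}" if "x \<in> convex hull {a,c,z}"
  proof -
    have x: "orient a c x \<ge> 0" "orient c z x \<ge> 0" "orient z a x \<ge> 0" using that unfolding in_triangle_iff[OF acz] by auto
    then have ax: "orient p a x \<ge> 0" unfolding zax using k by (simp add: zero_le_mult_iff)
    then have "k * orient p a x \<ge> 0" using k by simp
    then have "orient z p x \<ge> 0" using orient_swap(2)[of p z x] z[of x] by simp
    then show ?thesis using x ax orient_swap(2)[of p c x]
      unfolding in_triangle_iff[OF c] in_triangle_iff[OF pcz] by linarith
  qed
  have 2: "x \<in> convex hull {a,c,z}" if "x \<in> convex hull {p,a,c}"
    using that triangle_halfplane[OF that, of c z] pos zax[of x] k
    unfolding in_triangle_iff[OF acz] in_triangle_iff[OF c] by (auto simp: zero_le_mult_iff)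
  have 3: "x \<in> convex hull {a,c,z}" if "x \<in> convex hull {p,c,z}"
    using that triangle_halfplane[OF that, of a c] pos acz zax[of x] z[of x] orient_swap(2)[of p z x] k
    unfolding in_triangle_iff[OF acz] in_triangle_iff[OF pcz] by (auto simp: zero_le_mult_iff)
  show "x \<in> convex hull {p,a,c} \<or> x \<in> convex hull {p,c,z} \<longleftrightarrow> x \<in> convex hull {a,c,z}"
    using 1 2 3 by blast
qed

text \<open>On the side of \<open>c\<close>, \<open>a\<close> has a successor and \<open>z\<close>
  has a predecessor, and \<open>c\<close> is the only neighbour there.\<close>

lemma opposite_links:
  assumes T: "T \<in> triangs A" and fin: "finite A" and st: "stuck T p"
    and a: "a \<in> nbrs T p" and z: "z \<in> nbrs T p" and az: "a \<noteq> z" "orient p a z = 0"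
    and c: "c \<in> nbrs T p" "orient p a c > 0"
  shows "link_edge T p a c" "link_edge T p c z"
proof -
  obtain k where k: "k > 0" "\<And>y. orient p z y = - k * orient p a y" using opposite_scale[OF T a z az] by metis
  have hA: "w \<in> nbrs T p \<Longrightarrow> w \<in> convex hull A" for w using nbrs_A[OF T] hull_inc by metis
  obtain d where d: "link_edge T p a d" using succ_exists[OF T fin a hA[OF c(1)] c(2)] by blast
  then have "c = d" using opposite_side_unique[OF T fin st a z az c link_edge_nbrs(2)[OF d]] by (simp add: link_edge_def)
  then show "link_edge T p a c" using d by simp
  have "orient p z c < 0" using k c by simp
  then obtain e where e: "link_edge T p e z" using pred_exists[OF T fin z hA[OF c(1)]] by blast
  then have "orient p a e > 0" using k(2)[of e] k(1) orient_swap(1)[of p e z] by (simp add: link_edge_def zero_less_mult_iff)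
  then have "c = e" using opposite_side_unique[OF T fin st a z az c link_edge_nbrs(1)[OF e]] by simp
  then show "link_edge T p c z" using e by simp
qed

text \<open>By uniqueness \<open>v\<close> is not on the side of \<open>u\<close>. It is not
  strictly on the other side, since then \<open>z\<close> would lie in the cone of
  \<open>p u v\<close>. If it is on the line, it lies on the ray to \<open>z\<close>.\<close>

lemma opposite_link_edge_cases:
  assumes T: "T \<in> triangs A" and fin: "finite A" and st: "stuck T p"
    and a: "a \<in> nbrs T p" and z: "z \<in> nbrs T p" and az: "a \<noteq> z" "orient p a z = 0"
    and l: "link_edge T p u v" "u \<notin> {a,z}" "orient p a u > 0"
  shows "v = z"
proof (rule ccontr)
  assume n: "v \<noteq> z"
  obtain k where k: "k > 0" "\<And>y. orient p z y = - k * orient p a y" using opposite_scale[OF T a z az] by metis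
  have uv: "orient p u v > 0" using l by (simp add: link_edge_def)
  have "\<not> orient p a v > 0" using opposite_side_unique[OF T fin st a z az link_edge_nbrs(1)[OF l(1)] l(3) link_edge_nbrs(2)[OF l(1)]] uv by auto
  moreover have "orient p a v \<noteq> 0"
  proof
    assume 0: "orient p a v = 0"
    have "v \<noteq> a" using uv l(3) orient_swap(1)[of p a u] by auto
    then obtain k' where k': "k' > 0" "\<And>y. orient p v y = - k' * orient p a y" using opposite_scale[OF T a link_edge_nbrs(2)[OF l(1)] _ 0] by metis
    have "orient p v z = 0" using k'(2)[of z] az by simp
    moreover have "orient p v u * orient p z u > 0" unfolding k' k using k k' l(3) by simp
    ultimately have "v = z" using ray_eq[OF T link_edge_nbrs(2)[OF l(1)] z] by blast
    then show False using n by simp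
  qed
  ultimately have "orient p a v < 0" by simp
  then have "orient p z v > 0" using k by (simp add: mult_less_0_iff)
  moreover have "orient p u z > 0" using k(2)[of u] k(1) l(3) orient_swap(1)[of p u z] by simp
  ultimately show False using not_in_cone[OF T l(1) z] by simp
qed

lemma hull_side:
  assumes "x \<in> convex hull {a,c,z}" "orient p a z = 0"
  shows "orient p a c > 0 \<Longrightarrow> orient p a x \<ge> 0" "orient p a c < 0 \<Longrightarrow> orient p a x \<le> 0"
proof -
  show "orient p a x \<ge> 0" if "orient p a c > 0"
    using triangle_halfplane[OF assms(1), of p a] that assms(2) by simp
  show "orient p a x \<le> 0" if "orient p a c < 0"
    using triangle_halfplane[OF assms(1), of a p] that assms(2) orient_swap(2)[of p a c] orient_swap(2)[of p a x] orient_swap(2)[of p a z] 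
      orient_swap(2)[of p a a] by simp
qed

lemma interior_push:
  fixes p q :: "real^2"
  assumes "p \<in> interior S"
  obtains t where "t > 0" "p + t *\<^sub>R (p - q) \<in> S"
proof -
  obtain e where e: "e > 0" "ball p e \<subseteq> S" using assms by (auto simp: mem_interior)
  define t where "t = e / (2 * (1 + norm (p - q)))"
  have n: "1 + norm (p - q) > 0" by (simp add: add_pos_nonneg)
  then have t: "t > 0" using e by (simp add: t_def)
  have "norm (t *\<^sub>R (p - q)) \<le> t * (1 + norm (p - q))" using t by simp
  also have "\<dots> = e / 2" using n by (simp add: t_def field_simps)
  also have "\<dots> < e" using e by simp
  finally have "p + t *\<^sub>R (p - q) \<in> ball p e" by (simp add: dist_norm)
  then show ?thesis using that t e by blast
qed

lemma orient_push: "orient p a (p + t *\<^sub>R (p - q)) = - t * orient p a q"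
  by (simp add: orient_def algebra_simps)

text \<open>\<open>Y\<close> fills the hole left by the star of \<open>p\<close>. The triangles of \<open>Y\<close> are recognised as those whose hull
  contains \<open>p\<close>, so the original triangulation can be reconstructed.\<close>

definition filled :: "(real^2) set \<Rightarrow> (real^2) set set \<Rightarrow> real^2 \<Rightarrow> (real^2) set set \<Rightarrow> bool" where
  "filled A T p Y \<longleftrightarrow> nonstar T p \<union> Y \<in> triangs (A - {p}) \<and> Y \<noteq> {} \<and> (\<forall>t\<in>Y. p \<in> convex hull t \<and> t \<subseteq> A - {p}) \<and>
     link T p = {e. card e = 2 \<and> p \<notin> convex hull e \<and> (\<exists>t\<in>Y. e \<subseteq> t)} \<and>
     (p \<in> interior (convex hull A) \<longrightarrow> card (link T p) \<ge> 3)"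

text \<open>With \<open>p\<close> between \<open>a\<close> and \<open>z\<close>, a stuck star has at
  most one neighbour \<open>c\<close> on each side of the line. Merging \<open>p a c\<close> and
  \<open>p c z\<close> into \<open>a c z\<close> eliminates \<open>p\<close>. The only new edge is
  \<open>a z\<close>, and it passes through \<open>p\<close>, so the link consists of the edges of
  \<open>Y\<close> that miss \<open>p\<close>.\<close>

lemma filled_opposite:
  assumes T: "T \<in> triangs A" and fin: "finite A" and st: "stuck T p" and op: "opposite_pair T p"
  shows "\<exists>Y. filled A T p Y"
proof -
  obtain a z where a: "a \<in> nbrs T p" and z: "z \<in> nbrs T p" and az: "a \<noteq> z" "orient p a z = 0"
    using op by (auto simp: opposite_pair_def)
  have za: "z \<noteq> a" "orient p z a = 0" using az orient_swap(1)[of p a z] by auto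
  obtain k where k: "k > 0" "\<And>y. orient p z y = - k * orient p a y" and seg: "p \<in> convex hull {a,z}"
    using opposite_scale[OF T a z az] by metis
  have k': "1/k > 0" "\<And>y. orient p a y = - (1/k) * orient p z y" using k by auto
  have pA: "p \<in> A" using a link_edge_A[OF T] by (auto simp: nbrs_def)
  define C where "C = nbrs T p - {a,z}"
  \<comment> \<open>A third neighbour on the line would lie on the ray to \<open>a\<close> or on the
    ray to \<open>z\<close>.\<close>
  have C0: "orient p a c \<noteq> 0" if c: "c \<in> C" for c
  proof
    assume 0: "orient p a c = 0"
    have cW: "c \<in> nbrs T p" "c \<noteq> a" "c \<noteq> z" using c by (auto simp: C_def)
    obtain k2 where k2: "k2 > 0" "\<And>y. orient p c y = - k2 * orient p a y" using opposite_scale[OF T a cW(1) _ 0] cW by metis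
    obtain v where v: "orient p a v \<noteq> 0" using nbrs_triangle[OF T a] by blast
    have "orient p c v * orient p z v = (k2 * k) * (orient p a v * orient p a v)" unfolding k2 k by simp
    also have "\<dots> > 0" using k2 k v by (auto simp: zero_less_mult_iff)
    finally have "c = z" using ray_eq[OF T cW(1) z, of v] k2(2)[of z] az by simp
    then show False using cW by simp
  qed
  have CW: "c \<in> nbrs T p" "c \<in> A" "c \<noteq> p" "c \<noteq> a" "c \<noteq> z" if "c \<in> C" for c
    using that nbrs_A[OF T, of c p] nbrs_ne[of c T p] by (auto simp: C_def)
  have up: "link_edge T p a c" "link_edge T p c z" if "c \<in> C" "orient p a c > 0" for c
    using opposite_links[OF T fin st a z az CW(1)[OF that(1)] that(2)] by auto
  have down: "link_edge T p z c" "link_edge T p c a" if "c \<in> C" "orient p a c < 0" for c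
    using opposite_links[OF T fin st z a za CW(1)[OF that(1)]] k that by (auto simp: mult_less_0_iff)
  have lkC: "link_edge T p u v \<Longrightarrow> \<exists>c\<in>C. (orient p a c > 0 \<and> ((u = a \<and> v = c) \<or> (u = c \<and> v = z))) \<or>
     (orient p a c < 0 \<and> ((u = z \<and> v = c) \<or> (u = c \<and> v = a)))" for u v
  proof -
    assume l: "link_edge T p u v"
    have uv: "orient p u v > 0" using l by (simp add: link_edge_def)
    consider "u = a" | "u = z" | "u \<in> C" "orient p a u > 0" | "u \<in> C" "orient p a u < 0"
      using C0[of u] link_edge_nbrs(1)[OF l] by (fastforce simp: C_def)
    then show ?thesis
    proof cases
      case 1 then show ?thesis using uv az link_edge_nbrs(2)[OF l] by (intro bexI[of _ v]) (auto simp: C_def)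
    next
      case 2 
      then have "orient p a v < 0" using uv k(2)[of v] k(1) by (simp add: mult_less_0_iff)
      then show ?thesis using 2 uv az link_edge_nbrs(2)[OF l] by (intro bexI[of _ v]) (auto simp: C_def)
    next
      case 3
      then have "v = z" using opposite_link_edge_cases[OF T fin st a z az l] by (auto simp: C_def)
      then show ?thesis using 3 by blast
    next
      case 4
      then have "v = a" using opposite_link_edge_cases[OF T fin st z a za l] k(2)[of u] k(1) by (auto simp: C_def mult_less_0_iff)
      then show ?thesis using 4 by blast
    qed
  qed
  define Y where "Y = (\<lambda>c. {a,c,z}) ` C"
  have C_ne: "C \<noteq> {}"
  proof -
    obtain u v where "link_edge T p u v" using a by (auto simp: nbrs_def)
    then show ?thesis using lkC by blast
  qed
  have union: "(x \<in> convex hull {p,a,c} \<or> x \<in> convex hull {p,c,z}) \<longleftrightarrow> x \<in> convex hull {a,c,z}" if c: "c \<in> C" for x c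
  proof (cases "orient p a c > 0")
    case True then show ?thesis using split_union(1)[OF True k] by simp
  next
    case False
    then have "orient p z c > 0" using C0[OF c] k by (auto simp: mult_less_0_iff)
    from split_union(1)[OF this k'] show ?thesis by (simp add: insert_commute disj_commute)
  qed
  have tri: "\<exists>u v w. {a,c,z} = {u,v,w} \<and> orient u v w > 0" if c: "c \<in> C" for c
  proof (cases "orient p a c > 0")
    case True then show ?thesis using split_union(2)[OF True k] by blast
  next
    case False
    then have "orient p z c > 0" using C0[OF c] k by (auto simp: mult_less_0_iff)
    from split_union(2)[OF this k'] show ?thesis by (intro exI[of _ z] exI[of _ c] exI[of _ a]) auto
  qed
  have star: "{p,a,c} \<in> T" "{p,c,z} \<in> T" if c: "c \<in> C" for c
  proof -
    have "orient p a c > 0 \<or> orient p a c < 0" using C0[OF c] by auto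
    then show "{p,a,c} \<in> T" "{p,c,z} \<in> T"
      using up[OF c] down[OF c] by (auto simp: link_edge_def insert_commute)
  qed
  have aA: "a \<in> A - {p}" "z \<in> A - {p}" using nbrs_A[OF T] nbrs_ne a z by auto
  have YE: "Y \<subseteq> empty_tris (A - {p})"
  proof
    fix t assume "t \<in> Y"
    then obtain c where c: "c \<in> C" "t = {a,c,z}" by (auto simp: Y_def)
    have "convex hull t \<inter> (A - {p}) \<subseteq> t"
    proof
      fix x assume x: "x \<in> convex hull t \<inter> (A - {p})"
      then have "x \<in> convex hull {p,a,c} \<or> x \<in> convex hull {p,c,z}" using union[OF c(1)] c by simp
      then have "x \<in> {p,a,c} \<or> x \<in> {p,c,z}"
        using empty_tris_hull[OF triangs_empty_tris[OF T star(1)[OF c(1)]]] empty_tris_hull[OF triangs_empty_tris[OF T star(2)[OF c(1)]]] x by blast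
      then show "x \<in> t" using x c by auto
    qed
    then show "t \<in> empty_tris (A - {p})" using tri[OF c(1)] aA CW[OF c(1)] c(2) unfolding empty_tris_def by blast
  qed
  have eq: "(\<exists>t\<in>{t\<in>T. p \<in> t}. x \<in> convex hull t) \<longleftrightarrow> (\<exists>t\<in>Y. x \<in> convex hull t)" for x
  proof
    assume "\<exists>t\<in>{t\<in>T. p \<in> t}. x \<in> convex hull t"
    then obtain u v where l: "link_edge T p u v" "x \<in> convex hull {p,u,v}" unfolding star_cover[OF T] by blast
    obtain c where c: "c \<in> C" "{p,u,v} = {p,a,c} \<or> {p,u,v} = {p,c,z}" using lkC[OF l(1)] by blast
    then have "x \<in> convex hull {a,c,z}" using union[OF c(1), of x] l(2) by metis
    then show "\<exists>t\<in>Y. x \<in> convex hull t" using c by (auto simp: Y_def)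
  next
    assume "\<exists>t\<in>Y. x \<in> convex hull t"
    then obtain c where c: "c \<in> C" "x \<in> convex hull {a,c,z}" by (auto simp: Y_def)
    then show "\<exists>t\<in>{t\<in>T. p \<in> t}. x \<in> convex hull t" using union[OF c(1), of x] star[OF c(1)] by blast
  qed
  have one: "c = c'" if "c \<in> C" "c' \<in> C" "orient p a c > 0" "orient p a c' > 0" for c c'
    using opposite_side_unique[OF T fin st a z az] that CW by blast
  have one': "c = c'" if "c \<in> C" "c' \<in> C" "orient p a c < 0" "orient p a c' < 0" for c c'
    using opposite_side_unique[OF T fin st z a za, of c c'] that CW(1) k by (simp add: mult_less_0_iff)
  have TR': "(T - {t\<in>T. p \<in> t}) \<union> Y \<in> triangs (A - {p})"
  proof (rule triangs_replace_cover[OF T fin])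
    show "{t\<in>T. p \<in> t} \<subseteq> T" "A - {p} \<subseteq> A" by auto
    show "T - {t\<in>T. p \<in> t} \<subseteq> empty_tris (A - {p})" using nonstar_empty_tris[OF T] by (simp add: nonstar_Diff)
    show "Y \<subseteq> empty_tris (A - {p})" by (rule YE)
    show "negligible {x. orient p a x = 0}" using nbrs_ne[OF a] by (intro negligible_orient) auto
    show "(\<exists>t\<in>{t\<in>T. p \<in> t}. x \<in> convex hull t) \<longleftrightarrow> (\<exists>t\<in>Y. x \<in> convex hull t)" for x by (rule eq)
    fix x t t' assume x: "x \<notin> {x. orient p a x = 0}" "t \<in> Y" "t' \<in> Y" "x \<in> convex hull t" "x \<in> convex hull t'"
    then obtain c c' where c: "c \<in> C" "c' \<in> C" "t = {a,c,z}" "t' = {a,c',z}" by (auto simp: Y_def)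
    have "(orient p a c > 0 \<and> orient p a x > 0) \<or> (orient p a c < 0 \<and> orient p a x < 0)"
      using hull_side[of x a c z p] x c az C0[OF c(1)] by force
    moreover have "(orient p a c' > 0 \<and> orient p a x > 0) \<or> (orient p a c' < 0 \<and> orient p a x < 0)"
      using hull_side[of x a c' z p] x c az C0[OF c(2)] by force
    ultimately have "c = c'" using one[OF c(1,2)] one'[OF c(1,2)] by auto
    then show "t = t'" using c by simp
  qed
  have lnk: "e \<in> link T p \<longleftrightarrow> (\<exists>c\<in>C. e = {a,c} \<or> e = {c,z})" for e
  proof
    assume "e \<in> link T p"
    then obtain u v where "e = {u,v}" "link_edge T p u v" using link_iff[OF T] by blast
    then show "\<exists>c\<in>C. e = {a,c} \<or> e = {c,z}" using lkC[of u v] by (auto simp: insert_commute)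
  next
    assume "\<exists>c\<in>C. e = {a,c} \<or> e = {c,z}"
    then obtain c where "c \<in> C" "e = {a,c} \<or> e = {c,z}" by blast
    then show "e \<in> link T p" using star[of c] CW[of c] aA by (auto simp: link_def)
  qed
  have nseg: "p \<notin> convex hull {a,c}" "p \<notin> convex hull {c,z}" if c: "c \<in> C" for c
  proof -
    have "orient p a c \<noteq> 0" "orient p z c \<noteq> 0" using C0[OF c] k by auto
    then show "p \<notin> convex hull {a,c}" "p \<notin> convex hull {c,z}"
      using segment_orient[of p a c] segment_orient[of p c z] orient_rot[of p a c] orient_rot[of p c z] orient_swap(1)[of p c z] by auto
  qed
  have lnk2: "link T p = {e. card e = 2 \<and> p \<notin> convex hull e \<and> (\<exists>t\<in>Y. e \<subseteq> t)}"
  proof (intro set_eqI iffI)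
    fix e assume "e \<in> link T p"
    then obtain c where "c \<in> C" "e = {a,c} \<or> e = {c,z}" using lnk by blast
    then show "e \<in> {e. card e = 2 \<and> p \<notin> convex hull e \<and> (\<exists>t\<in>Y. e \<subseteq> t)}" using nseg[of c] CW[of c] by (auto simp: Y_def)
  next
    fix e assume e: "e \<in> {e. card e = 2 \<and> p \<notin> convex hull e \<and> (\<exists>t\<in>Y. e \<subseteq> t)}"
    then obtain c where c: "c \<in> C" "e \<subseteq> {a,c,z}" by (auto simp: Y_def)
    have "e \<noteq> {a,z}" using e seg by auto
    then have "e = {a,c} \<or> e = {c,z}" using two_subsets[of a c z e] c e CW[OF c(1)] az(1) by auto
    then show "e \<in> link T p" using c lnk by blast
  qed
  have pY: "\<forall>t\<in>Y. p \<in> convex hull t \<and> t \<subseteq> A - {p}"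
  proof
    fix t assume "t \<in> Y"
    then obtain c where c: "c \<in> C" "t = {a,c,z}" by (auto simp: Y_def)
    have "p \<in> convex hull {p,a,c}" by (simp add: hull_inc)
    then show "p \<in> convex hull t \<and> t \<subseteq> A - {p}" using union[OF c(1), of p] c aA CW[OF c(1)] by auto
  qed
  have deg: "card (link T p) \<ge> 3" if int: "p \<in> interior (convex hull A)"
  proof -
    obtain c where c: "c \<in> C" using C_ne by blast
    obtain t where t: "t > 0" "p + t *\<^sub>R (p - c) \<in> convex hull A" using interior_push[OF int] by blast
    \<comment> \<open>Pushing \<open>p\<close> away from \<open>c\<close> stays in the hull and
      leads across the line \<open>a z\<close>, so there is a neighbour on that side too.\<close>
    obtain e where e: "e \<in> C" "orient p a e * orient p a c < 0"
    proof (cases "orient p a c > 0")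
      case True
      then have "orient p a (p + t *\<^sub>R (p - c)) < 0" unfolding orient_push using t by simp
      then obtain d where d: "link_edge T p d a" using pred_exists[OF T fin a t(2)] by blast
      then have "orient p a d < 0" using orient_swap(1)[of p a d] by (simp add: link_edge_def)
      moreover from this have "d \<noteq> a" "d \<noteq> z" using az by auto
      ultimately show ?thesis using that[of d] link_edge_nbrs(1)[OF d] True by (auto simp: C_def mult_neg_pos)
    next
      case False
      then have n: "orient p a c < 0" using C0[OF c] by simp
      then have "orient p a (p + t *\<^sub>R (p - c)) > 0" unfolding orient_push using t by (simp add: mult_pos_neg)
      then obtain d where d: "link_edge T p a d" using succ_exists[OF T fin a t(2)] by blast
      then have "orient p a d > 0" by (simp add: link_edge_def)
      moreover from this have "d \<noteq> a" "d \<noteq> z" using az by auto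
      ultimately show ?thesis using that[of d] link_edge_nbrs(2)[OF d] n by (auto simp: C_def mult_pos_neg)
    qed
    then have "e \<noteq> c" by auto
    \<comment> \<open>The link has four edges in this case; three of them are enough.\<close>
    have sub: "{{a,c},{c,z},{a,e}} \<subseteq> link T p" using lnk c e by blast
    have "{a,c} \<noteq> {c,z}" "{a,c} \<noteq> {a,e}" "{c,z} \<noteq> {a,e}"
      using CW[OF c] CW[OF e(1)] \<open>e \<noteq> c\<close> az(1) by (auto simp: doubleton_eq_iff)
    then have "card {{a,c},{c,z},{a,e}} = 3" by simp
    then show ?thesis using card_mono[OF finite_link[OF fin T] sub] by simp
  qed
  have "filled A T p Y" unfolding filled_def nonstar_Diff
    using TR' pY lnk2 deg C_ne by (auto simp: Y_def)
  then show ?thesis ..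
qed

text \<open>Three neighbours around \<open>p\<close> leave no room for a fourth: one of the three
  cones is closed to it by \<open>not_in_cone\<close>, the other two by \<open>no_fourth\<close>. So
  the star is the triangle \<open>c d x\<close> split at \<open>p\<close>.\<close>

lemma filled_spanning:
  assumes T: "T \<in> triangs A" and fin: "finite A" and st: "stuck T p"
    and nop: "\<not> opposite_pair T p" and sp: "spanning_link T p"
  shows "\<exists>Y. filled A T p Y"
proof -
  obtain c d x where cd: "link_edge T p c d" and x: "x \<in> nbrs T p" and dx: "orient p d x > 0" and xc: "orient p x c > 0"
    using sp by (auto simp: spanning_link_def)
  have cdp: "orient p c d > 0" using cd by (simp add: link_edge_def)
  note cW = link_edge_nbrs(1)[OF cd] and dW = link_edge_nbrs(2)[OF cd]
  \<comment> \<open>A dependency with positive coefficients: no \<open>y\<close> is strictly to the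
    left of all three rays from \<open>p\<close>, or strictly to the right of all three.\<close>
  have rel: "orient p c y * orient p d x + orient p d y * orient p x c + orient p x y * orient p c d = 0" for y
    using orient_plucker[of p y c d x] orient_swap(1)[of p y c] orient_swap(1)[of p y d] orient_swap(1)[of p y x] orient_swap(1)[of p x c]
    by (simp add: algebra_simps)
  have Wd: "w \<in> {c,d,x}" if w: "w \<in> nbrs T p" for w
  proof (rule ccontr)
    assume n: "w \<notin> {c,d,x}"
    then have nz: "orient p c w \<noteq> 0" "orient p d w \<noteq> 0" "orient p x w \<noteq> 0" using nop w cW dW x by (auto simp: opposite_pair_def)
    note sw = orient_swap(1)[of p c w] orient_swap(1)[of p d w] orient_swap(1)[of p x w]
    have 1: "\<not> (orient p c w > 0 \<and> orient p w d > 0)" using not_in_cone[OF T cd w] by blast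
    have 2: "\<not> (orient p d w > 0 \<and> orient p w x > 0)" using no_fourth[OF T fin st cW dW x w cdp dx xc] nz by blast
    have 3: "\<not> (orient p x w > 0 \<and> orient p w c > 0)" using no_fourth[OF T fin st dW x cW w dx xc cdp] nz by blast
    have "(orient p c w > 0 \<and> orient p d w > 0 \<and> orient p x w > 0) \<or> (orient p c w < 0 \<and> orient p d w < 0 \<and> orient p x w < 0)"
      using 1 2 3 nz sw by linarith
    then show False
    proof
      assume h: "orient p c w > 0 \<and> orient p d w > 0 \<and> orient p x w > 0"
      then have "orient p c w * orient p d x > 0" "orient p d w * orient p x c > 0" "orient p x w * orient p c d > 0" using dx xc cdp by simp_all
      then show False using rel[of w] by linarith
    next
      assume h: "orient p c w < 0 \<and> orient p d w < 0 \<and> orient p x w < 0"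
      then have "orient p c w * orient p d x < 0" "orient p d w * orient p x c < 0" "orient p x w * orient p c d < 0" using dx xc cdp by (simp_all add: mult_neg_pos)
      then show False using rel[of w] by linarith
    qed
  qed
  have hA: "w \<in> nbrs T p \<Longrightarrow> w \<in> convex hull A" for w using nbrs_A[OF T] hull_inc by metis
  have dxl: "link_edge T p d x"
  proof -
    obtain e where e: "link_edge T p d e" using succ_exists[OF T fin dW hA[OF x] dx] by blast
    then have "orient p d e > 0" by (simp add: link_edge_def)
    then have "e = x" using Wd[OF link_edge_nbrs(2)[OF e]] cdp orient_swap(1)[of p c d] by auto
    then show ?thesis using e by simp
  qed
  have xcl: "link_edge T p x c"
  proof -
    obtain e where e: "link_edge T p x e" using succ_exists[OF T fin x hA[OF cW] xc] by blast
    then have "orient p x e > 0" by (simp add: link_edge_def)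
    then have "e = c" using Wd[OF link_edge_nbrs(2)[OF e]] dx orient_swap(1)[of p d x] by auto
    then show ?thesis using e by simp
  qed
  have lks: "link_edge T p u v \<Longrightarrow> (u = c \<and> v = d) \<or> (u = d \<and> v = x) \<or> (u = x \<and> v = c)" for u v
  proof -
    assume l: "link_edge T p u v"
    have "orient p u v > 0" using l by (simp add: link_edge_def)
    then show ?thesis using Wd[OF link_edge_nbrs(1)[OF l]] Wd[OF link_edge_nbrs(2)[OF l]] cdp dx xc
      orient_swap(1)[of p c d] orient_swap(1)[of p d x] orient_swap(1)[of p x c] by auto
  qed
  have cdx: "orient c d x > 0" using orient_split[of p d x c] dx xc cdp orient_rot[of p x c] orient_rot[of p c d] orient_rot[of c p x] orient_rot[of x c p] orient_rot[of c d p] by linarith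
  have ne: "c \<noteq> d" "d \<noteq> x" "c \<noteq> x" using orient_pos_distinct[OF cdx] by auto
  have p_in: "p \<in> convex hull {c,d,x}" using cdp dx xc orient_rot[of p c d] orient_rot[of p d x] orient_rot[of p x c]
    by (simp add: in_triangle_iff[OF cdx])
  have union: "y \<in> convex hull {p,c,d} \<or> y \<in> convex hull {p,d,x} \<or> y \<in> convex hull {p,x,c} \<longleftrightarrow> y \<in> convex hull {c,d,x}" for y
  proof
    have "convex hull {p,c,d} \<subseteq> convex hull {c,d,x}" "convex hull {p,d,x} \<subseteq> convex hull {c,d,x}" "convex hull {p,x,c} \<subseteq> convex hull {c,d,x}"
      using p_in by (intro hull_minimal convex_convex_hull; auto simp: hull_inc)+
    then show "y \<in> convex hull {p,c,d} \<or> y \<in> convex hull {p,d,x} \<or> y \<in> convex hull {p,x,c} \<Longrightarrow> y \<in> convex hull {c,d,x}" by blast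
  next
    assume y: "y \<in> convex hull {c,d,x}"
    have sw: "orient d p y = - orient p d y" "orient x p y = - orient p x y" "orient c p y = - orient p c y" by (rule orient_swap(2))+
    have 1: "\<not> (orient p c y < 0 \<and> orient p d y < 0 \<and> orient p x y < 0)" "\<not> (orient p c y > 0 \<and> orient p d y > 0 \<and> orient p x y > 0)"
    proof -
      show "\<not> (orient p c y < 0 \<and> orient p d y < 0 \<and> orient p x y < 0)"
      proof
        assume h: "orient p c y < 0 \<and> orient p d y < 0 \<and> orient p x y < 0"
        then have "orient p c y * orient p d x < 0" "orient p d y * orient p x c < 0" "orient p x y * orient p c d < 0" using dx xc cdp by (simp_all add: mult_neg_pos)
        then show False using rel[of y] by linarith
      qed
      show "\<not> (orient p c y > 0 \<and> orient p d y > 0 \<and> orient p x y > 0)"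
      proof
        assume h: "orient p c y > 0 \<and> orient p d y > 0 \<and> orient p x y > 0"
        then have "orient p c y * orient p d x > 0" "orient p d y * orient p x c > 0" "orient p x y * orient p c d > 0" using dx xc cdp by simp_all
        then show False using rel[of y] by linarith
      qed
    qed
    show "y \<in> convex hull {p,c,d} \<or> y \<in> convex hull {p,d,x} \<or> y \<in> convex hull {p,x,c}"
      using y 1 unfolding in_triangle_iff[OF cdx] in_triangle_iff[OF cdp] in_triangle_iff[OF dx] in_triangle_iff[OF xc] sw
      by linarith
  qed
  let ?Y = "{{c,d,x}}"
  have star: "{p,c,d} \<in> T" "{p,d,x} \<in> T" "{p,x,c} \<in> T" using cd dxl xcl by (auto simp: link_edge_def)
  have cA: "c \<in> A - {p}" "d \<in> A - {p}" "x \<in> A - {p}" using cW dW x nbrs_A[OF T] nbrs_ne by auto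
  have pA: "p \<in> A" using link_edge_A[OF T cd] by simp
  have YE: "?Y \<subseteq> empty_tris (A - {p})"
  proof -
    have "convex hull {c,d,x} \<inter> (A - {p}) \<subseteq> {c,d,x}"
    proof
      fix y assume y: "y \<in> convex hull {c,d,x} \<inter> (A - {p})"
      then have "y \<in> convex hull {p,c,d} \<or> y \<in> convex hull {p,d,x} \<or> y \<in> convex hull {p,x,c}" using union by blast
      then have "y \<in> {p,c,d} \<or> y \<in> {p,d,x} \<or> y \<in> {p,x,c}"
        using empty_tris_hull[OF triangs_empty_tris[OF T star(1)]] empty_tris_hull[OF triangs_empty_tris[OF T star(2)]] empty_tris_hull[OF triangs_empty_tris[OF T star(3)]] y by blast
      then show "y \<in> {c,d,x}" using y by auto
    qed
    then show ?thesis using cdx cA unfolding empty_tris_def by blast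
  qed
  have eq: "(\<exists>t\<in>{t\<in>T. p \<in> t}. y \<in> convex hull t) \<longleftrightarrow> (\<exists>t\<in>?Y. y \<in> convex hull t)" for y
  proof -
    have "(\<exists>t\<in>{t\<in>T. p \<in> t}. y \<in> convex hull t) \<longleftrightarrow> (\<exists>u v. link_edge T p u v \<and> y \<in> convex hull {p,u,v})"
      by (rule star_cover[OF T])
    also have "\<dots> \<longleftrightarrow> y \<in> convex hull {p,c,d} \<or> y \<in> convex hull {p,d,x} \<or> y \<in> convex hull {p,x,c}"
      using lks cd dxl xcl by blast
    finally show ?thesis using union by simp
  qed
  have TR': "(T - {t\<in>T. p \<in> t}) \<union> ?Y \<in> triangs (A - {p})"
  proof (rule triangs_replace_cover[OF T fin _ _ _ YE negligible_empty eq])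
    show "T - {t\<in>T. p \<in> t} \<subseteq> empty_tris (A - {p})" using nonstar_empty_tris[OF T] by (simp add: nonstar_Diff)
  qed auto
  have lnk: "e \<in> link T p \<longleftrightarrow> e = {c,d} \<or> e = {d,x} \<or> e = {c,x}" for e
  proof -
    have "e \<in> link T p \<longleftrightarrow> (\<exists>u v. e = {u,v} \<and> link_edge T p u v)" by (rule link_iff[OF T])
    also have "\<dots> \<longleftrightarrow> e = {c,d} \<or> e = {d,x} \<or> e = {x,c}" using lks cd dxl xcl by blast
    finally show ?thesis by (simp add: insert_commute)
  qed
  have nseg: "p \<notin> convex hull {c,d}" "p \<notin> convex hull {d,x}" "p \<notin> convex hull {c,x}"
    using segment_orient[of p c d] segment_orient[of p d x] segment_orient[of p c x] cdp dx xc orient_rot[of p c d] orient_rot[of p d x] orient_rot[of p c x]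
      orient_swap(1)[of p c x] by auto
  have lnk2: "link T p = {e. card e = 2 \<and> p \<notin> convex hull e \<and> (\<exists>t\<in>?Y. e \<subseteq> t)}"
  proof (rule set_eqI)
    fix e
    have "e \<in> {e. card e = 2 \<and> p \<notin> convex hull e \<and> (\<exists>t\<in>?Y. e \<subseteq> t)}
        \<longleftrightarrow> (card e = 2 \<and> e \<subseteq> {c,d,x}) \<and> p \<notin> convex hull e" by blast
    also have "\<dots> \<longleftrightarrow> (e = {c,d} \<or> e = {d,x} \<or> e = {c,x}) \<and> p \<notin> convex hull e"
      by (simp only: two_subsets[OF ne])
    also have "\<dots> \<longleftrightarrow> e \<in> link T p" unfolding lnk using nseg by metis
    finally show "e \<in> link T p \<longleftrightarrow> e \<in> {e. card e = 2 \<and> p \<notin> convex hull e \<and> (\<exists>t\<in>?Y. e \<subseteq> t)}" by (rule sym)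
  qed
  have "link T p = {{c,d},{d,x},{c,x}}" by (rule set_eqI) (simp only: lnk insert_iff empty_iff simp_thms)
  moreover have "{c,d} \<noteq> {d,x}" "{d,x} \<noteq> {c,x}" "{c,d} \<noteq> {c,x}" using ne by (auto simp: doubleton_eq_iff)
  ultimately have "card (link T p) = 3" by simp
  then have "filled A T p ?Y" unfolding filled_def nonstar_Diff using TR' p_in cA lnk2 by simp
  then show ?thesis ..
qed

text \<open>All link edges have \<open>A - {p}\<close> on their far side, so \<open>p\<close> is
  extreme, its star meets the hull of \<open>A - {p}\<close> only in a null set, and no hole has to
  be filled. The link is described without \<open>T\<close> so that it can be restored after the
  removal.\<close>

lemma remove_supporting:
  assumes T: "T \<in> triangs A" and fin: "finite A" and nd: "nondeg A" and p: "p \<in> A" and st: "stuck T p"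
    and no: "\<not> opposite_pair T p" "\<not> spanning_link T p"
  shows "nonstar T p \<in> triangs (A - {p})" "p \<notin> convex hull (A - {p})" "p \<notin> interior (convex hull A)"
    "link T p = {{a,b} | a b. {p,a,b} \<in> empty_tris A \<and> orient p a b > 0 \<and> (\<forall>z\<in>A. z \<noteq> p \<longrightarrow> orient a b z \<le> 0)}"
proof -
  have H: "orient a b z \<le> 0" if "link_edge T p a b" "z \<in> A" "z \<noteq> p" for a b z
    using supporting_link[OF T fin nd st no that] .
  have H': "convex hull (A - {p}) \<subseteq> {x. orient a b x \<le> 0}" if "link_edge T p a b" for a b
    using H[OF that] by (intro hull_minimal convex_orient_le) auto
  have "(T - {t\<in>T. p \<in> t}) \<union> {} \<in> triangs (A - {p})"
  proof (rule triangs_replace[OF T fin])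
    show "{t\<in>T. p \<in> t} \<subseteq> T" "A - {p} \<subseteq> A" "{} \<subseteq> empty_tris (A - {p})" by auto
    show "T - {t\<in>T. p \<in> t} \<subseteq> empty_tris (A - {p})" using nonstar_empty_tris[OF T] by (simp add: nonstar_Diff)
    show "negligible (all_lines A)" by (rule negligible_all_lines[OF fin])
    fix x assume x: "x \<in> convex hull (A - {p})" "x \<notin> all_lines A"
    have "\<not> (t \<in> T \<and> p \<in> t \<and> x \<in> convex hull t)" for t
    proof
      assume t: "t \<in> T \<and> p \<in> t \<and> x \<in> convex hull t"
      then obtain a b where ab: "t = {p,a,b}" "link_edge T p a b" using star_iff[OF T, of t p] by blast
      have o: "orient p a b > 0" using ab by (simp add: link_edge_def)
      have "orient a b x \<ge> 0" using t unfolding ab in_triangle_iff[OF o] by simp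
      moreover have "orient a b x \<le> 0" using H'[OF ab(2)] x by blast
      moreover have "orient a b x \<noteq> 0" using all_lines_D[OF x(2)] link_edge_A[OF T ab(2)] orient_pos_distinct[OF o] by blast
      ultimately show False by simp
    qed
    then have e: "{t \<in> {t \<in> T. p \<in> t}. x \<in> convex hull t} = {}" by blast
    show "card {t \<in> {t \<in> T. p \<in> t}. x \<in> convex hull t} = card {t \<in> {}. x \<in> convex hull t}" unfolding e by simp
  qed
  then show "nonstar T p \<in> triangs (A - {p})" by (simp add: nonstar_Diff)
  obtain y where y: "y \<in> A" "y \<noteq> p"
  proof -
    obtain a b where "a \<in> A" "b \<in> A" "a \<noteq> b" using nd orient_pos_distinct by (fastforce simp: nondeg_def)
    then show ?thesis using that by metis
  qed
  obtain a b where l: "link_edge T p a b" using cone_cover[OF T fin nd p y] by blast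
  have abp: "orient a b p > 0" using l orient_rot[of p a b] by (simp add: link_edge_def)
  then show "p \<notin> convex hull (A - {p})" using H'[OF l] by auto
  show "p \<notin> interior (convex hull A)"
  proof
    assume "p \<in> interior (convex hull A)"
    then obtain t where t: "t > 0" "p + t *\<^sub>R (p - a) \<in> convex hull A" using interior_push by blast
    have "orient a b (p + t *\<^sub>R (p - a)) = (1 + t) * orient a b p" by (simp add: orient_def algebra_simps)
    moreover have "convex hull A \<subseteq> {x. orient a b x \<le> orient a b p}"
    proof (rule hull_minimal)
      show "A \<subseteq> {x. orient a b x \<le> orient a b p}" using H[OF l] abp by fastforce
      show "convex {x. orient a b x \<le> orient a b p}"
        unfolding convex_def by (auto simp: orient_comb intro: convex_bound_le)
    qed
    ultimately have "(1 + t) * orient a b p \<le> orient a b p" using t(2) by auto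
    moreover have "t * orient a b p > 0" using t abp by simp
    ultimately show False by (simp add: algebra_simps)
  qed
  show "link T p = {{a,b} | a b. {p,a,b} \<in> empty_tris A \<and> orient p a b > 0 \<and> (\<forall>z\<in>A. z \<noteq> p \<longrightarrow> orient a b z \<le> 0)}" (is "_ = ?L")
  proof (intro set_eqI iffI)
    fix e assume "e \<in> link T p"
    then obtain u v where uv: "e = {u,v}" "link_edge T p u v" using link_iff[OF T] by blast
    then show "e \<in> ?L" using H[OF uv(2)] triangs_empty_tris[OF T, of "{p,u,v}"] by (auto simp: link_edge_def)
  next
    fix e assume "e \<in> ?L"
    then obtain u v where uv: "e = {u,v}" "{p,u,v} \<in> empty_tris A" "orient p u v > 0" "\<And>z. z \<in> A \<Longrightarrow> z \<noteq> p \<Longrightarrow> orient u v z \<le> 0" by blast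
    then have "link_edge T p u v" using supporting_unique[OF T fin nd st no uv(2-4)] by (simp add: link_edge_def)
    then show "e \<in> link T p" using uv link_iff[OF T] by blast
  qed
qed

lemma stuck_cases:
  assumes T: "T \<in> triangs A" and fin: "finite A" and st: "stuck T p"
  shows "(\<exists>Y. filled A T p Y) \<or> (\<not> opposite_pair T p \<and> \<not> spanning_link T p)"
  using filled_opposite[OF T fin st] filled_spanning[OF T fin st] by blast

lemma stuck_interior_degree:
  assumes T: "T \<in> triangs A" and fin: "finite A" and nd: "nondeg A" and p: "p \<in> A" and st: "stuck T p"
    and int: "p \<in> interior (convex hull A)"
  shows "card (link T p) \<ge> 3"
  using stuck_cases[OF T fin st] remove_supporting(3)[OF T fin nd p st] int by (auto simp: filled_def)

text \<open>The removal of \<open>p\<close> can be undone. If \<open>p\<close> is outside the hull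
  of \<open>A - {p}\<close>, its star was cut off and the link is the fixed family
  \<open>?L\<close>. Otherwise the triangles whose hull contains \<open>p\<close> are the filling,
  their edges missing \<open>p\<close> form the link, and the other triangles had been kept.\<close>

lemma card_stuck:
  assumes fin: "finite A" and nd: "nondeg A" and p: "p \<in> A"
  shows "card {T\<in>triangs A. stuck T p} \<le> card (triangs (A - {p}))"
proof -
  let ?Q = "{T\<in>triangs A. stuck T p}"
  let ?L = "{{a,b} | a b. {p,a,b} \<in> empty_tris A \<and> orient p a b > 0 \<and> (\<forall>z\<in>A. z \<noteq> p \<longrightarrow> orient a b z \<le> 0)}"
  define P where "P T T' \<longleftrightarrow> T' \<in> triangs (A - {p}) \<and>
     ((p \<notin> convex hull (A - {p}) \<and> nonstar T p = T' \<and> link T p = ?L) \<or>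
      (p \<in> convex hull (A - {p}) \<and> nonstar T p = {t\<in>T'. p \<notin> convex hull t} \<and>
        link T p = {e. card e = 2 \<and> p \<notin> convex hull e \<and> (\<exists>t\<in>T'. p \<in> convex hull t \<and> e \<subseteq> t)}))" for T T'
  have "\<exists>T'. P T T'" if "T \<in> ?Q" for T
  proof -
    have T: "T \<in> triangs A" "stuck T p" using that by auto
    show ?thesis
    proof (cases "\<exists>Y. filled A T p Y")
      case True
      then obtain Y where Y: "filled A T p Y" by blast
      have 1: "t \<in> Y \<Longrightarrow> p \<in> convex hull t" "t \<in> nonstar T p \<Longrightarrow> p \<notin> convex hull t" for t
        using Y nonstar_not_in_hull[OF T(1) p] by (auto simp: filled_def)
      obtain t where t: "t \<in> Y" "t \<subseteq> A - {p}" using Y by (auto simp: filled_def)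
      then have "p \<in> convex hull (A - {p})" using 1(1)[OF t(1)] hull_mono[OF t(2), of convex] by blast
      moreover have "nonstar T p = {t\<in>nonstar T p \<union> Y. p \<notin> convex hull t}" using 1 by blast
      moreover have "(\<exists>t\<in>Y. e \<subseteq> t) \<longleftrightarrow> (\<exists>t\<in>nonstar T p \<union> Y. p \<in> convex hull t \<and> e \<subseteq> t)" for e using 1 by blast
      ultimately have "P T (nonstar T p \<union> Y)" using Y unfolding P_def filled_def by simp
      then show ?thesis ..
    next
      case False
      then have no: "\<not> opposite_pair T p" "\<not> spanning_link T p" using stuck_cases[OF T(1) fin T(2)] by auto
      have "P T (nonstar T p)" unfolding P_def using remove_supporting[OF T(1) fin nd p T(2) no] by simp
      then show ?thesis ..
    qed
  qed
  then obtain f where f: "\<And>T. T \<in> ?Q \<Longrightarrow> P T (f T)" by metis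
  have "inj_on f ?Q"
  proof (rule inj_onI)
    fix T T' assume T: "T \<in> ?Q" "T' \<in> ?Q" "f T = f T'"
    have 1: "P T (f T)" "P T' (f T)" using f[OF T(1)] f[OF T(2)] T(3) by simp_all
    have "nonstar T p = nonstar T' p" "link T p = link T' p"
      using 1 unfolding P_def by (elim conjE disjE; simp)+
    then show "T = T'" using T_decomp[of T p] T_decomp[of T' p] by simp
  qed
  moreover have "f ` ?Q \<subseteq> triangs (A - {p})" using f unfolding P_def by blast
  moreover have "finite (triangs (A - {p}))" using fin by (intro finite_triangs) auto
  ultimately show ?thesis by (rule card_inj_on_le)
qed

lemma vertex_bound:
  assumes fin: "finite A" and nd: "nondeg A" and p: "p \<in> A"
  shows "p \<in> interior (convex hull A) \<Longrightarrow> (\<Sum>T\<in>triangs A. 7 - card (link T p)) \<le> 59 * card (triangs (A - {p}))"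
    "(\<Sum>T\<in>triangs A. 4 - card (link T p)) \<le> 7 * card (triangs (A - {p}))"
proof -
  let ?Q = "{T\<in>triangs A. stuck T p}"
  have "(\<Sum>T\<in>?Q. ballot (card (link T p)) (4 - card (link T p))) \<le> (\<Sum>T\<in>?Q. 7)"
    by (intro sum_mono ballot_boundary)
  then show "(\<Sum>T\<in>triangs A. 4 - card (link T p)) \<le> 7 * card (triangs (A - {p}))"
    using point_bound[OF fin, of 4 p] card_stuck[OF fin nd p] by simp
  assume int: "p \<in> interior (convex hull A)"
  have "(\<Sum>T\<in>?Q. ballot (card (link T p)) (7 - card (link T p))) \<le> (\<Sum>T\<in>?Q. 59)"
    using stuck_interior_degree[OF _ fin nd p _ int] by (intro sum_mono ballot_interior) auto
  then show "(\<Sum>T\<in>triangs A. 7 - card (link T p)) \<le> 59 * card (triangs (A - {p}))"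
    using point_bound[OF fin, of 7 p] card_stuck[OF fin nd p] by simp
qed

section \<open>Counting degrees\<close>

lemma generic_slope:
  assumes "finite (A :: (real^2) set)"
  obtains s where "inj_on (\<lambda>x. x$1 + s * x$2) A"
proof -
  \<comment> \<open>Pairs with equal second coordinates divide by zero and contribute the value 0;
    excluding 0 as well does no harm.\<close>
  let ?bad = "(\<lambda>(a,b). - (a$1 - b$1) / (a$2 - b$2)) ` (A \<times> A)"
  have "finite ?bad" using assms by simp
  then obtain s where s: "s \<notin> ?bad" using ex_new_if_finite[OF infinite_UNIV_char_0] by blast
  have "inj_on (\<lambda>x. x$1 + s * x$2) A"
  proof (rule inj_onI)
    fix a b assume ab: "a \<in> A" "b \<in> A" "a$1 + s * a$2 = b$1 + s * b$2"
    then have e: "s * (a$2 - b$2) = - (a$1 - b$1)" by (simp add: algebra_simps)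
    have "a$2 = b$2"
    proof (rule ccontr)
      assume "a$2 \<noteq> b$2"
      then have "s = - (a$1 - b$1) / (a$2 - b$2)" using e by (simp add: field_simps)
      then show False using s ab by auto
    qed
    then show "a = b" using e by (simp add: vec_eq_iff forall_2)
  qed
  then show ?thesis by (rule that)
qed

lemma nondeg_other:
  assumes "nondeg A" obtains q where "q \<in> A" "q \<noteq> p"
proof -
  obtain a b where "a \<in> A" "b \<in> A" "a \<noteq> b" using assms orient_pos_distinct by (fastforce simp: nondeg_def)
  then show ?thesis using that by metis
qed

text \<open>Moving from \<open>p\<close> a little away from \<open>q\<close> would push
  \<open>f\<close> below its minimum on the hull. The factor \<open>\<sigma>\<close> allows minima
  and maxima of a functional to be treated alike.\<close>

lemma extreme_not_interior:
  fixes f :: "real^2 \<Rightarrow> real"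
  assumes p: "\<And>q. q \<in> A \<Longrightarrow> f p \<le> f q" and q: "q \<in> A" "f q \<noteq> f p"
    and f: "\<And>x. f x = \<sigma> * (x$1 + s * x$2)"
  shows "p \<notin> interior (convex hull A)"
proof
  assume "p \<in> interior (convex hull A)"
  then obtain t where t: "t > 0" "p + t *\<^sub>R (p - q) \<in> convex hull A" using interior_push by blast
  have lin: "f (u *\<^sub>R x + v *\<^sub>R y) = u * f x + v * f y" for u v x y
    unfolding f by (simp add: algebra_simps)
  have "convex {x. f p \<le> f x}"
    unfolding convex_def
  proof (intro ballI allI impI)
    fix x y u v assume h: "x \<in> {x. f p \<le> f x}" "y \<in> {x. f p \<le> f x}" "0 \<le> u" "0 \<le> v" "u + v = (1::real)"
    have "u * f p + v * f p \<le> u * f x + v * f y" using h by (intro add_mono mult_left_mono) auto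
    moreover have "u * f p + v * f p = f p" using h(5) by (simp add: distrib_right[symmetric])
    ultimately show "u *\<^sub>R x + v *\<^sub>R y \<in> {x. f p \<le> f x}" by (simp add: lin)
  qed
  then have "convex hull A \<subseteq> {x. f p \<le> f x}" using p by (intro hull_minimal) auto
  then have "f p \<le> f (p + t *\<^sub>R (p - q))" using t by blast
  also have "f (p + t *\<^sub>R (p - q)) = f p + t * (f p - f q)" unfolding f by (simp add: algebra_simps)
  finally have "t * (f p - f q) \<ge> 0" by simp
  then have "f p \<ge> f q" using t by (simp add: zero_le_mult_iff)
  then show False using p[OF q(1)] q(2) by simp
qed

text \<open>A generic linear functional selects in each triangle a middle vertex; the level line through that
  vertex enters the triangle on one of its two sides. An interior point sees one triangle on each
  side, a boundary point at most one, and the two extreme points none.\<close>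

lemma triangle_count:
  assumes T: "T \<in> triangs A" and fin: "finite A" and nd: "nondeg A"
  shows "card T + 2 \<le> 2 * card (A \<inter> interior (convex hull A)) + card (A - interior (convex hull A))"
proof -
  obtain s where s: "inj_on (\<lambda>x. x$1 + s * x$2) A" using generic_slope[OF fin] by blast
  define f where "f x = x$1 + s * x$2" for x :: "real^2"
  \<comment> \<open>\<open>u\<close> spans the level lines of \<open>f\<close>; moving along it
    changes \<open>orient a b\<close> at the rate \<open>f b - f a\<close>.\<close>
  define u :: "real^2" where "u = (\<chi> i. if i = 1 then - s else 1)"
  have u: "u$1 = - s" "u$2 = 1" by (simp_all add: u_def)
  have f_eq: "a \<in> A \<Longrightarrow> b \<in> A \<Longrightarrow> f a = f b \<Longrightarrow> a = b" for a b using s by (auto simp: inj_on_def f_def)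
  have cru: "orient a b (p + t *\<^sub>R u) = orient a b p + t * (f b - f a)" for a b p t
    by (simp add: orient_def f_def u algebra_simps)
  have cru1: "orient a b (p + u) = orient a b p + (f b - f a)" "orient a b (p - u) = orient a b p - (f b - f a)" for a b p
    using cru[of a b p 1] cru[of a b p "-1"] by simp_all
  let ?I = "interior (convex hull A)"
  \<comment> \<open>The triangles with middle vertex \<open>p\<close> that are entered by the ray
    from \<open>p\<close> in direction \<open>u\<close>; for \<open>Dn\<close> the direction is
    \<open>- u\<close>.\<close>
  define Up where "Up p = {t\<in>T. \<exists>c d. t = {p,c,d} \<and> orient p c d > 0 \<and> f d < f p \<and> f p < f c}" for p
  define Dn where "Dn p = {t\<in>T. \<exists>c d. t = {p,c,d} \<and> orient p c d > 0 \<and> f c < f p \<and> f p < f d}" for p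
  \<comment> \<open>With last argument \<open>p\<close> the curve is a straight ray.\<close>
  have lexU: "lexin p (p + u) p p c d" if "orient p c d > 0" "f d < f p" "f p < f c" for p c d
    using that orient_rot[of p c d] by (auto simp: lexin_def lexpos_def cru1)
  have lexD: "lexin p (p - u) p p c d" if "orient p c d > 0" "f c < f p" "f p < f d" for p c d
    using that orient_rot[of p c d] by (auto simp: lexin_def lexpos_def cru1)
  have fT: "finite T" using triangs_finite[OF fin T] .
  have fU: "finite (Up p)" "finite (Dn p)" for p using fT by (auto simp: Up_def Dn_def)
  have cU: "card (Up p) \<le> 1" for p
  proof -
    have "t = t'" if t: "t \<in> Up p" "t' \<in> Up p" for t t'
    proof -
      obtain c d where 1: "t = {p,c,d}" "orient p c d > 0" "f d < f p" "f p < f c" using t(1) unfolding Up_def by blast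
      obtain c' d' where 2: "t' = {p,c',d'}" "orient p c' d' > 0" "f d' < f p" "f p < f c'" using t(2) unfolding Up_def by blast
      have "t \<in> T" "t' \<in> T" using t unfolding Up_def by blast+
      then have "{p,c,d} \<in> T" "{p,c',d'} \<in> T" using 1(1) 2(1) by simp_all
      from triangs_lex_overlap[OF T this 1(2) 2(2) lexU[OF 1(2-4)] lexU[OF 2(2-4)]]
      show ?thesis using 1(1) 2(1) by simp
    qed
    then show ?thesis unfolding One_nat_def card_le_Suc0_iff_eq[OF fU(1)] by blast
  qed
  have cD: "card (Dn p) \<le> 1" for p
  proof -
    have "t = t'" if t: "t \<in> Dn p" "t' \<in> Dn p" for t t'
    proof -
      obtain c d where 1: "t = {p,c,d}" "orient p c d > 0" "f c < f p" "f p < f d" using t(1) unfolding Dn_def by blast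
      obtain c' d' where 2: "t' = {p,c',d'}" "orient p c' d' > 0" "f c' < f p" "f p < f d'" using t(2) unfolding Dn_def by blast
      have "t \<in> T" "t' \<in> T" using t unfolding Dn_def by blast+
      then have "{p,c,d} \<in> T" "{p,c',d'} \<in> T" using 1(1) 2(1) by simp_all
      from triangs_lex_overlap[OF T this 1(2) 2(2) lexD[OF 1(2-4)] lexD[OF 2(2-4)]]
      show ?thesis using 1(1) 2(1) by simp
    qed
    then show ?thesis unfolding One_nat_def card_le_Suc0_iff_eq[OF fU(2)] by blast
  qed
  have in_int: "open_tri a b c \<subseteq> ?I" if "{a,b,c} \<in> T" "orient a b c > 0" for a b c
  proof -
    have "{a,b,c} \<subseteq> A" using triangs_empty_tris[OF T that(1)] by (auto simp: empty_tris_def)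
    then have "interior (convex hull {a,b,c}) \<subseteq> ?I" by (intro interior_mono hull_mono)
    then show ?thesis using open_tri_subset[OF that(2)] by blast
  qed
  have both: "p \<in> ?I" if ne: "Up p \<noteq> {}" "Dn p \<noteq> {}" for p
  proof -
    obtain c d where 1: "{p,c,d} \<in> T" "orient p c d > 0" "f d < f p" "f p < f c" using ne(1) unfolding Up_def by blast
    obtain c' d' where 2: "{p,c',d'} \<in> T" "orient p c' d' > 0" "f c' < f p" "f p < f d'" using ne(2) unfolding Dn_def by blast
    have "eventually (\<lambda>e. curve p (p + u) p e \<in> open_tri p c d \<and> curve p (p - u) p e \<in> open_tri p c' d') (at_right 0)"
      using lexU[OF 1(2-4)] lexD[OF 2(2-4)] by (intro eventually_conj lexin_eventually)
    then obtain e where e: "curve p (p + u) p e \<in> open_tri p c d" "curve p (p - u) p e \<in> open_tri p c' d'"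
      using eventually_happens'[OF trivial_limit_at_right_real] by blast
    then have "curve p (p + u) p e \<in> ?I" "curve p (p - u) p e \<in> ?I" using in_int 1(1,2) 2(1,2) by blast+
    then have "(1/2) *\<^sub>R curve p (p + u) p e + (1/2) *\<^sub>R curve p (p - u) p e \<in> ?I"
      using convex_interior[OF convex_convex_hull, of A] by (intro convexD) auto
    moreover have "(1/2) *\<^sub>R curve p (p + u) p e + (1/2) *\<^sub>R curve p (p - u) p e = p"
      by (simp add: curve_def vec_eq_iff algebra_simps)
    ultimately show ?thesis by simp
  qed
  have cov: "T \<subseteq> (\<Union>p\<in>A. Up p \<union> Dn p)"
  proof
    fix t assume t: "t \<in> T"
    then obtain a b c where abc: "t = {a,b,c}" "orient a b c > 0" "t \<subseteq> A" using triangs_empty_tris[OF T t] by (auto simp: empty_tris_def)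
    then have ne: "f a \<noteq> f b" "f b \<noteq> f c" "f a \<noteq> f c" using f_eq orient_pos_distinct[OF abc(2)] by auto
    have r: "t = {b,c,a}" "t = {c,a,b}" "orient b c a > 0" "orient c a b > 0" 
      using abc insert3_rot[of a b c] orient_rot[of a b c] orient_rot[of b c a] by auto
    consider "f a < f b \<and> f b < f c \<or> f c < f b \<and> f b < f a" | "f b < f a \<and> f a < f c \<or> f c < f a \<and> f a < f b"
      | "f a < f c \<and> f c < f b \<or> f b < f c \<and> f c < f a" using ne by linarith
    then show "t \<in> (\<Union>p\<in>A. Up p \<union> Dn p)"
    proof cases
      case 1
      then have "t \<in> Up b \<union> Dn b" using r t unfolding Up_def Dn_def by blast
      then show ?thesis using abc by blast
    next
      case 2
      then have "t \<in> Up a \<union> Dn a" using abc t unfolding Up_def Dn_def by blast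
      then show ?thesis using abc by blast
    next
      case 3
      then have "t \<in> Up c \<union> Dn c" using r t unfolding Up_def Dn_def by blast
      then show ?thesis using abc by blast
    qed
  qed
  have A_ne: "A \<noteq> {}" using nd by (auto simp: nondeg_def)
  define m where "m = arg_min_on f A"
  define M where "M = arg_min_on (\<lambda>x. - f x) A"
  have m: "m \<in> A" "\<And>q. q \<in> A \<Longrightarrow> f m \<le> f q" unfolding m_def using arg_min_if_finite(1)[OF fin A_ne] arg_min_least[OF fin A_ne] by auto
  have M: "M \<in> A" "\<And>q. q \<in> A \<Longrightarrow> f q \<le> f M" unfolding M_def using arg_min_if_finite(1)[OF fin A_ne] arg_min_least[OF fin A_ne, of _ "\<lambda>x. - f x"] by auto
  obtain q where q: "q \<in> A" "q \<noteq> m" using nondeg_other[OF nd] by blast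
  have "f q \<noteq> f m" using q m f_eq by blast
  then have "m \<noteq> M" using M(2)[OF q(1)] m(2)[OF q(1)] by auto
  have mB: "m \<notin> ?I" using extreme_not_interior[of A f m q 1 s] m q \<open>f q \<noteq> f m\<close> by (simp add: f_def)
  have "f m \<noteq> f M" using \<open>m \<noteq> M\<close> m M f_eq by blast
  then have MB: "M \<notin> ?I"
  proof (intro extreme_not_interior[of A "\<lambda>x. - f x" M m "-1" s])
    show "- f M \<le> - f q" if "q \<in> A" for q using M(2)[OF that] by simp
  qed (use m in \<open>auto simp: f_def\<close>)
  have sub: "c \<in> A \<and> d \<in> A" if "{p,c,d} \<in> T" for p c d using triangs_empty_tris[OF T that] by (auto simp: empty_tris_def)
  have mE: "Up m = {}" "Dn m = {}" using m(2) sub unfolding Up_def Dn_def by force+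
  have ME: "Up M = {}" "Dn M = {}" using M(2) sub unfolding Up_def Dn_def by force+
  let ?B = "A - ?I"
  have fB: "finite ?B" "finite (A \<inter> ?I)" using fin by auto
  have "card T \<le> card (\<Union>p\<in>A. Up p \<union> Dn p)" using cov fin fU by (intro card_mono) auto
  also have "\<dots> \<le> (\<Sum>p\<in>A. card (Up p \<union> Dn p))" by (rule card_UN_le[OF fin])
  also have "\<dots> = (\<Sum>p\<in>A \<inter> ?I. card (Up p \<union> Dn p)) + (\<Sum>p\<in>?B. card (Up p \<union> Dn p))"
    using fB by (subst sum.union_disjoint[symmetric]) (auto intro: sum.cong)
  also have "(\<Sum>p\<in>A \<inter> ?I. card (Up p \<union> Dn p)) \<le> (\<Sum>p\<in>A \<inter> ?I. 2)"
  proof (rule sum_mono)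
    show "card (Up p \<union> Dn p) \<le> 2" for p using card_Un_le[of "Up p" "Dn p"] cU[of p] cD[of p] by linarith
  qed
  also have "(\<Sum>p\<in>?B. card (Up p \<union> Dn p)) = (\<Sum>p\<in>?B - {m,M}. card (Up p \<union> Dn p))"
    using fB mE ME by (intro sum.mono_neutral_right) auto
  also have "\<dots> \<le> (\<Sum>p\<in>?B - {m,M}. 1)"
  proof (rule sum_mono)
    fix p assume "p \<in> ?B - {m,M}"
    then have "Up p = {} \<or> Dn p = {}" using both by blast
    then show "card (Up p \<union> Dn p) \<le> 1" using cU[of p] cD[of p] by auto
  qed
  finally have "card T \<le> 2 * card (A \<inter> ?I) + card (?B - {m,M})" by simp
  moreover have "card ?B = card (?B - {m,M}) + 2"
  proof -
    have "card (?B - {m,M}) = card ?B - card {m,M}" using m M mB MB by (intro card_Diff_subset) auto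
    moreover have "card {m,M} \<le> card ?B" using m M mB MB fB by (intro card_mono) auto
    ultimately show ?thesis using \<open>m \<noteq> M\<close> by simp
  qed
  ultimately show ?thesis by simp
qed

lemma card_link: "card (link T p) = card {t\<in>T. p \<in> t}"
proof -
  have "bij_betw (insert p) (link T p) {t\<in>T. p \<in> t}"
    unfolding bij_betw_def
  proof
    show "inj_on (insert p) (link T p)" by (auto simp: inj_on_def link_def insert_ident)
    show "insert p ` link T p = {t\<in>T. p \<in> t}"
      using T_decomp[of T p] by (auto simp: nonstar_def link_def)
  qed
  then show ?thesis by (rule bij_betw_same_card)
qed

lemma sum_degrees:
  assumes T: "T \<in> triangs A" and fin: "finite A"
  shows "(\<Sum>p\<in>A. card (link T p)) = 3 * card T"
proof -
  have fT: "finite T" using triangs_finite[OF fin T] .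
  have "(\<Sum>p\<in>A. card {t\<in>T. p \<in> t}) = (\<Sum>t\<in>T. card {p\<in>A. p \<in> t})"
    using sum_multicount_gen[OF fin fT, of "\<lambda>p t. p \<in> t" "\<lambda>t. card {p\<in>A. p \<in> t}"] by simp
  also have "\<dots> = (\<Sum>t\<in>T. 3)"
  proof (rule sum.cong[OF refl])
    fix t assume "t \<in> T"
    then have t: "t \<in> empty_tris A" using triangs_empty_tris[OF T] by blast
    then have "{p\<in>A. p \<in> t} = t" by (auto simp: empty_tris_def)
    then show "card {p\<in>A. p \<in> t} = 3" using card_empty_tris[OF t] by simp
  qed
  finally show ?thesis by (simp add: card_link)
qed

text \<open>With \<open>v\<close> interior and \<open>b\<close> boundary points,
  \<open>7 v + 4 b - 3 card T\<close> is at least \<open>v + b + 6\<close> by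
  \<open>triangle_count\<close>, and truncated differences are no smaller than true ones.\<close>

lemma degree_inequality:
  assumes T: "T \<in> triangs A" and fin: "finite A" and nd: "nondeg A"
  shows "card A + 6 \<le> (\<Sum>p\<in>A \<inter> interior (convex hull A). 7 - card (link T p)) + (\<Sum>p\<in>A - interior (convex hull A). 4 - card (link T p))"
proof -
  let ?I = "A \<inter> interior (convex hull A)" and ?B = "A - interior (convex hull A)"
  let ?d = "\<lambda>p. card (link T p)"
  have f: "finite ?I" "finite ?B" using fin by auto
  have A: "A = ?I \<union> ?B" "?I \<inter> ?B = {}" by auto
  have "7 * card ?I = (\<Sum>p\<in>?I. 7)" by simp
  also have "\<dots> \<le> (\<Sum>p\<in>?I. (7 - ?d p) + ?d p)" by (intro sum_mono) auto
  finally have 1: "7 * card ?I \<le> (\<Sum>p\<in>?I. 7 - ?d p) + (\<Sum>p\<in>?I. ?d p)" by (simp add: sum.distrib)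
  have "4 * card ?B = (\<Sum>p\<in>?B. 4)" by simp
  also have "\<dots> \<le> (\<Sum>p\<in>?B. (4 - ?d p) + ?d p)" by (intro sum_mono) auto
  finally have 2: "4 * card ?B \<le> (\<Sum>p\<in>?B. 4 - ?d p) + (\<Sum>p\<in>?B. ?d p)" by (simp add: sum.distrib)
  have "(\<Sum>p\<in>?I \<union> ?B. ?d p) = (\<Sum>p\<in>?I. ?d p) + (\<Sum>p\<in>?B. ?d p)" using f A(2) by (rule sum.union_disjoint)
  then have 3: "(\<Sum>p\<in>?I. ?d p) + (\<Sum>p\<in>?B. ?d p) = 3 * card T" using sum_degrees[OF T fin] A(1) by simp
  have "card (?I \<union> ?B) = card ?I + card ?B" using f A(2) by (rule card_Un_disjoint)
  then have 4: "card A = card ?I + card ?B" using A(1) by simp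
  show ?thesis using 1 2 3 4 triangle_count[OF T fin nd] by linarith
qed

lemma recursion:
  assumes fin: "finite A" and nd: "nondeg A"
  shows "(card A + 6) * card (triangs A) \<le> (\<Sum>p\<in>A \<inter> interior (convex hull A). 59 * card (triangs (A - {p})))
     + (\<Sum>p\<in>A - interior (convex hull A). 7 * card (triangs (A - {p})))"
proof -
  let ?I = "A \<inter> interior (convex hull A)" and ?B = "A - interior (convex hull A)"
  have "(card A + 6) * card (triangs A) = (\<Sum>T\<in>triangs A. card A + 6)" by simp
  also have "\<dots> \<le> (\<Sum>T\<in>triangs A. (\<Sum>p\<in>?I. 7 - card (link T p)) + (\<Sum>p\<in>?B. 4 - card (link T p)))"
    using degree_inequality[OF _ fin nd] by (intro sum_mono) auto
  also have "\<dots> = (\<Sum>p\<in>?I. \<Sum>T\<in>triangs A. 7 - card (link T p)) + (\<Sum>p\<in>?B. \<Sum>T\<in>triangs A. 4 - card (link T p))"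
    by (simp add: sum.distrib sum.swap[of _ "triangs A"])
  also have "\<dots> \<le> (\<Sum>p\<in>?I. 59 * card (triangs (A - {p}))) + (\<Sum>p\<in>?B. 7 * card (triangs (A - {p})))"
    using vertex_bound[OF fin nd] by (intro add_mono sum_mono) auto
  finally show ?thesis .
qed

section \<open>Induction on the number of points\<close>

lemma binomial_step: "(n + 1) * ((n + 7) choose 6) = (n + 7) * ((n + 6) choose 6)"
proof -
  have "n + 7 - 6 = n + 1" "n + 7 - 1 = n + 6" by simp_all
  then show ?thesis using binomial_absorb_comp[of "n + 7" 6] by (simp only:)
qed

text \<open>Successive terms have the quotient \<open>(n + 7) / (n + 1)\<close>, which is at most 7.
  Settles collinear sets, for which \<open>triangs A\<close> has at most one member.\<close>

lemma binomial_le_power: "(n + 6) choose 6 \<le> 7 ^ n"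
proof (induction n)
  case 0 then show ?case by simp
next
  case (Suc n)
  have "(n + 1) * ((n + 7) choose 6) \<le> (7 * (n + 1)) * ((n + 6) choose 6)"
    unfolding binomial_step by (intro mult_right_mono) auto
  then have "(n + 1) * ((n + 7) choose 6) \<le> (n + 1) * (7 * ((n + 6) choose 6))" by (simp only: mult.assoc mult.left_commute)
  then have "(n + 7) choose 6 \<le> 7 * ((n + 6) choose 6)" using mult_le_cancel1[of "n+1"] by simp
  then show ?case using Suc by (simp add: add.commute)
qed

text \<open>Removing a point can turn interior points into boundary points; this only lowers the
  bound, as 7 is less than 59.\<close>

lemma power_exchange:
  fixes v v' n :: nat assumes "v' \<le> v" "v \<le> n"
  shows "(59::nat) ^ v' * 7 ^ (n - v') \<le> 59 ^ v * 7 ^ (n - v)"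
proof -
  have "n - v' = (v - v') + (n - v)" using assms by simp
  then have "(59::nat) ^ v' * 7 ^ (n - v') = 59 ^ v' * 7 ^ (v - v') * 7 ^ (n - v)" by (simp add: power_add)
  also have "\<dots> \<le> 59 ^ v' * 59 ^ (v - v') * 7 ^ (n - v)" by (intro mult_right_mono mult_left_mono power_mono) auto
  also have "\<dots> = 59 ^ v * 7 ^ (n - v)" using assms by (simp add: power_add[symmetric])
  finally show ?thesis .
qed

lemma triangs_degenerate:
  assumes "\<not> nondeg A" shows "card (triangs A) \<le> 1"
proof -
  have "empty_tris A = {}" using assms by (auto simp: empty_tris_def nondeg_def)
  then have "triangs A \<subseteq> {{}}" by (auto simp: triangs_def)
  then have "card (triangs A) \<le> card {{}::(real^2) set set}" by (intro card_mono) auto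
  then show ?thesis by simp
qed

text \<open>Multiplied by \<open>(n + 6) choose 6\<close>, each of the \<open>n + 1\<close> terms in
  \<open>recursion\<close> is at most the full bound, and \<open>binomial_step\<close> trades the
  factor \<open>n + 7\<close> for the next binomial coefficient. Keeping that coefficient on the
  left avoids division.\<close>

lemma triangs_bound:
  assumes "finite A"
  shows "card (triangs A) * ((card A + 6) choose 6)
    \<le> 59 ^ card (A \<inter> interior (convex hull A)) * 7 ^ (card A - card (A \<inter> interior (convex hull A)))"
  using assms
proof (induction "card A" arbitrary: A)
  case 0
  then have "A = {}" by simp
  then have "card (triangs A) \<le> 1" using triangs_degenerate[of A] by (simp add: nondeg_def)
  then show ?case using \<open>A = {}\<close> by simp
next
  case (Suc n)
  note fin = Suc.prems
  let ?v = "\<lambda>A. card (A \<inter> interior (convex hull A))"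
  let ?R = "59 ^ ?v A * 7 ^ (card A - ?v A) :: nat"
  have vle: "?v A \<le> card A" using fin by (intro card_mono) auto
  show ?case
  proof (cases "nondeg A")
    case False
    have "card (triangs A) * ((card A + 6) choose 6) \<le> 1 * 7 ^ card A"
      using triangs_degenerate[OF False] binomial_le_power by (intro mult_mono) auto
    also have "\<dots> \<le> ?R" using power_exchange[of 0 "?v A" "card A"] vle by simp
    finally show ?thesis .
  next
    case True
    let ?I = "A \<inter> interior (convex hull A)" and ?B = "A - interior (convex hull A)"
    let ?C = "(n + 6) choose 6"
    have v': "?v (A - {p}) \<le> card (?I - {p})" for p
    proof (rule card_mono)
      have "interior (convex hull (A - {p})) \<subseteq> interior (convex hull A)" by (intro interior_mono hull_mono) auto
      then show "(A - {p}) \<inter> interior (convex hull (A - {p})) \<subseteq> ?I - {p}" by auto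
    qed (use fin in auto)
    have IH: "card (triangs (A - {p})) * ?C \<le> 59 ^ ?v (A - {p}) * 7 ^ (n - ?v (A - {p}))" if "p \<in> A" for p
    proof -
      have c: "card (A - {p}) = n" using Suc.hyps(2) that fin by simp
      show ?thesis using Suc.hyps(1)[OF c[symmetric]] fin unfolding c by simp
    qed
    have vA: "?v A \<le> Suc n" using vle Suc.hyps(2) by simp
    have I: "59 * card (triangs (A - {p})) * ?C \<le> ?R" if p: "p \<in> ?I" for p
    proof -
      have v0: "?v A > 0" using p fin by (auto simp: card_gt_0_iff)
      have "?v (A - {p}) \<le> ?v A - 1" using v'[of p] p fin by (simp add: card_Diff_singleton)
      then have "59 ^ ?v (A - {p}) * 7 ^ (n - ?v (A - {p})) \<le> (59::nat) ^ (?v A - 1) * 7 ^ (n - (?v A - 1))"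
        using vA by (intro power_exchange) auto
      then have "59 * (card (triangs (A - {p})) * ?C) \<le> 59 * (59 ^ (?v A - 1) * 7 ^ (n - (?v A - 1)))"
        using IH[of p] p by (intro mult_left_mono) auto
      also have "\<dots> = ?R" using v0 Suc.hyps(2) vA by (cases "?v A") (auto simp: Suc_diff_le)
      finally show ?thesis by (simp add: mult.assoc)
    qed
    have B: "7 * card (triangs (A - {p})) * ?C \<le> ?R" if p: "p \<in> ?B" for p
    proof -
      have "?I - {p} = ?I" using p by auto
      then have "?v (A - {p}) \<le> ?v A" using v'[of p] by simp
      moreover have "?v A \<le> n"
      proof -
        have "?I \<subseteq> A - {p}" using p by auto
        then have "card ?I \<le> card (A - {p})" using fin by (intro card_mono) auto
        then show ?thesis using p fin Suc.hyps(2) by simp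
      qed
      ultimately have "59 ^ ?v (A - {p}) * 7 ^ (n - ?v (A - {p})) \<le> (59::nat) ^ ?v A * 7 ^ (n - ?v A)"
        by (intro power_exchange)
      then have "7 * (card (triangs (A - {p})) * ?C) \<le> 7 * (59 ^ ?v A * 7 ^ (n - ?v A))"
        using IH[of p] p by (intro mult_left_mono) auto
      also have "\<dots> = ?R" using Suc.hyps(2)[symmetric] \<open>?v A \<le> n\<close> by (simp add: Suc_diff_le)
      finally show ?thesis by (simp add: mult.assoc)
    qed
    have cA: "card A = Suc n" using Suc.hyps(2) by simp
    have cIB: "card ?I + card ?B = Suc n" using fin cA card_Diff_subset_Int[of A "interior (convex hull A)"] vle by simp
    have "(n + 7) * card (triangs A) * ?C \<le> ((\<Sum>p\<in>?I. 59 * card (triangs (A - {p}))) + (\<Sum>p\<in>?B. 7 * card (triangs (A - {p})))) * ?C"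
      using recursion[OF fin True] cA by (intro mult_right_mono) (auto simp: algebra_simps)
    also have "\<dots> = (\<Sum>p\<in>?I. 59 * card (triangs (A - {p})) * ?C) + (\<Sum>p\<in>?B. 7 * card (triangs (A - {p})) * ?C)"
      by (simp add: distrib_right sum_distrib_right)
    also have "\<dots> \<le> (\<Sum>p\<in>?I. ?R) + (\<Sum>p\<in>?B. ?R)" using I B by (intro add_mono sum_mono) auto
    also have "\<dots> = (card ?I + card ?B) * ?R" by (simp add: distrib_right)
    finally have "(n + 7) * card (triangs A) * ?C \<le> (n + 1) * ?R" unfolding cIB by simp
    moreover have "(n + 7) * card (triangs A) * ?C = (n + 1) * (card (triangs A) * ((n + 7) choose 6))"
      using binomial_step[of n] by (metis mult.assoc mult.commute)
    ultimately have "(n + 1) * (card (triangs A) * ((n + 7) choose 6)) \<le> (n + 1) * ?R" by simp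
    then have "card (triangs A) * ((n + 7) choose 6) \<le> ?R" using mult_le_cancel1[of "n+1"] by simp
    moreover have "card A + 6 = n + 7" using cA by simp
    ultimately show ?thesis by (simp only:)
  qed
qed

section \<open>Simplicial complexes\<close>

definition triangles :: "(real^2) set \<Rightarrow> (real^2) set set \<Rightarrow> (real^2) set set" where
  "triangles A \<K> = {t. t \<subseteq> A \<and> (\<exists>a b c. t = {a,b,c} \<and> orient a b c > 0) \<and> convex hull t \<in> \<K>}"

text \<open>Vertices of \<open>S\<close> are faces of it, hence in the complex and in
  \<open>A\<close>. Conversely the singleton of a point of \<open>A\<close> belongs to the complex,
  so if the point is in \<open>S\<close> it is a face of \<open>S\<close> and thus a vertex.\<close>

lemma triangulation_simplex:
  assumes tri: "triangulation_of A \<K>" and S: "S \<in> \<K>"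
  obtains C where "C \<subseteq> A" "\<not> affine_dependent C" "S = convex hull C" "S \<inter> A \<subseteq> C"
proof -
  have sc: "simplicial_complex \<K>" and vert: "{x. {x} \<in> \<K>} = A"
    using tri by (auto simp: triangulation_of_def)
  obtain C where C: "\<not> affine_dependent C" "S = convex hull C"
    using sc S by (auto simp: simplicial_complex_def simplex)
  have "C \<subseteq> A"
  proof
    fix c assume "c \<in> C"
    with C have "{c} face_of S"
      by (simp add: extreme_point_of_convex_hull_affine_independent face_of_singleton)
    with sc S have "{c} \<in> \<K>" unfolding simplicial_complex_def by blast
    with vert show "c \<in> A" by blast
  qed
  moreover have "S \<inter> A \<subseteq> C"
  proof
    fix a assume a: "a \<in> S \<inter> A"
    then have "{a} \<in> \<K>" using vert by blast
    then have "(S \<inter> {a}) face_of S" using sc S unfolding simplicial_complex_def by blast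
    then have "a extreme_point_of (convex hull C)" using a C by (simp add: face_of_singleton)
    then show "a \<in> C" by (rule extreme_point_of_convex_hull)
  qed
  ultimately show ?thesis using that C by blast
qed

lemma orient_zero_line:
  assumes "orient a b c = 0" "a \<noteq> b" obtains l where "c = a + l *\<^sub>R (b - a)"
proof (cases "a$1 = b$1")
  case True
  then have "a$2 \<noteq> b$2" using assms(2) by (simp add: vec_eq_iff forall_2)
  then have "c = a + ((c$2 - a$2) / (b$2 - a$2)) *\<^sub>R (b - a)"
    using assms(1) True by (simp add: vec_eq_iff forall_2 orient_def)
  then show ?thesis by (rule that)
next
  case False
  then have "c$2 - a$2 = (c$1 - a$1) / (b$1 - a$1) * (b$2 - a$2)"
    using assms(1) by (simp add: orient_def field_simps)
  then have "c = a + ((c$1 - a$1) / (b$1 - a$1)) *\<^sub>R (b - a)"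
    using False by (simp add: vec_eq_iff forall_2)
  then show ?thesis by (rule that)
qed

lemma independent_collinear_card:
  fixes C :: "(real^2) set"
  assumes "\<not> affine_dependent C" "\<And>a b c. a \<in> C \<Longrightarrow> b \<in> C \<Longrightarrow> c \<in> C \<Longrightarrow> orient a b c = 0"
  shows "card C \<le> 2"
proof (cases "\<exists>a\<in>C. \<exists>b\<in>C. a \<noteq> b")
  case True
  then obtain a b where ab: "a \<in> C" "b \<in> C" "a \<noteq> b" by blast
  have "C \<subseteq> affine hull {a,b}"
  proof
    fix c assume "c \<in> C"
    then obtain l where l: "c = a + l *\<^sub>R (b - a)" using orient_zero_line assms(2) ab by metis
    then have "c = (1 - l) *\<^sub>R a + l *\<^sub>R b" by (simp add: algebra_simps)
    then show "c \<in> affine hull {a,b}" unfolding affine_hull_2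
      by (intro CollectI exI[of _ "1 - l"] exI[of _ l]) simp
  qed
  then have "aff_dim C \<le> aff_dim {a,b}" using aff_dim_subset[of C "affine hull {a,b}"] by (simp add: aff_dim_affine_hull)
  also have "\<dots> = 1" using ab by (simp add: aff_dim_2)
  finally show ?thesis using assms(1) by (simp add: affine_independent_iff_card)
next
  case False
  then have "C \<subseteq> {c}" if "c \<in> C" for c using that by blast
  then have "card C \<le> 1" by (cases "C = {}") (use card_mono[of "{_}" C] in \<open>force+\<close>)
  then show ?thesis by simp
qed

lemma independent_triangle:
  fixes C :: "(real^2) set"
  assumes "\<not> affine_dependent C" "a \<in> C" "b \<in> C" "c \<in> C" "orient a b c > 0"
  shows "C = {a,b,c}"
proof -
  have f: "finite C" "aff_dim C = int (card C) - 1" using assms(1) by (auto simp: affine_independent_iff_card)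
  have "card C \<le> 3" using f aff_dim_le_DIM[of C] by simp
  moreover have "card {a,b,c} = 3" using orient_pos_distinct[OF assms(5)] by simp
  ultimately show ?thesis using card_seteq[OF f(1), of "{a,b,c}"] assms by auto
qed

lemma face_with_interior_point:
  fixes F S :: "(real^2) set"
  assumes "F face_of S" "x \<in> F" "x \<in> interior S" shows "F = S"
  using face_of_disjoint_interior[OF assms(1)] assms by blast

lemma triangles_empty_tris:
  assumes tri: "triangulation_of A \<K>" shows "triangles A \<K> \<subseteq> empty_tris A"
proof
  fix t assume "t \<in> triangles A \<K>"
  then have t: "t \<subseteq> A" "\<exists>a b c. t = {a,b,c} \<and> orient a b c > 0" "convex hull t \<in> \<K>" by (auto simp: triangles_def)
  have sc: "simplicial_complex \<K>" and vert: "{x. {x} \<in> \<K>} = A"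
    using tri by (auto simp: triangulation_of_def)
  have "convex hull t \<inter> A \<subseteq> t"
  proof
    fix a assume a: "a \<in> convex hull t \<inter> A"
    then have "{a} \<in> \<K>" using vert by blast
    then have "(convex hull t \<inter> {a}) face_of (convex hull t)" using sc t(3) unfolding simplicial_complex_def by blast
    then have "a extreme_point_of (convex hull t)" using a by (simp add: face_of_singleton)
    then show "a \<in> t" by (rule extreme_point_of_convex_hull)
  qed
  then show "t \<in> empty_tris A" using t unfolding empty_tris_def by blast
qed

text \<open>Off \<open>A\<close> and the lines through its points, a point of the hull can only be
  interior to a triangle. Two triangles sharing it meet in a common face through an interior point,
  so they coincide.\<close>

lemma triangles_triangs:
  assumes tri: "triangulation_of A \<K>" and fin: "finite A"
  shows "triangles A \<K> \<in> triangs A"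
proof -
  have sc: "simplicial_complex \<K>" and un: "\<Union>\<K> = convex hull A"
    using tri by (auto simp: triangulation_of_def)
  let ?N = "all_lines A \<union> A"
  have "negligible ?N" using negligible_all_lines[OF fin] negligible_finite[OF fin] by simp
  moreover have "card {t\<in>triangles A \<K>. x \<in> convex hull t} = 1" if x: "x \<in> convex hull A" "x \<notin> ?N" for x
  proof -
    obtain S where S: "S \<in> \<K>" "x \<in> S" using un x by blast
    obtain C where C: "C \<subseteq> A" "\<not> affine_dependent C" "S = convex hull C" using triangulation_simplex[OF tri S(1)] by metis
    have "\<exists>a\<in>C. \<exists>b\<in>C. \<exists>c\<in>C. orient a b c > 0"
    proof (rule ccontr)
      assume n: "\<not> ?thesis"
      have z: "orient a b c = 0" if "a \<in> C" "b \<in> C" "c \<in> C" for a b c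
        using n that orient_swap(1)[of a c b] by (metis linorder_neqE_linordered_idom neg_0_less_iff_less)
      have "C \<noteq> {}" using S C by auto
      then obtain a where a: "a \<in> C" by blast
      show False
      proof (cases "C = {a}")
        case True
        then show False using S C x by auto
      next
        case False
        then obtain b where b: "b \<in> C" "a \<noteq> b" using a by blast
        have "convex {y. orient a b y = 0}" by (auto simp: convex_def orient_comb)
        then have "convex hull C \<subseteq> {y. orient a b y = 0}" using z a b by (intro hull_minimal) auto
        then show False using all_lines_D[of x A a b] x S C a b by auto
      qed
    qed
    then obtain a b c where abc: "a \<in> C" "b \<in> C" "c \<in> C" "orient a b c > 0" by blast
    have Ct: "C = {a,b,c}" using independent_triangle[OF C(2) abc] .
    have mem: "C \<in> triangles A \<K>" using C S abc Ct unfolding triangles_def by blast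
    have int: "x \<in> interior (convex hull t)" if t: "t \<in> triangles A \<K>" "x \<in> convex hull t" for t
    proof -
      obtain a b c where t': "t = {a,b,c}" "orient a b c > 0" "t \<subseteq> A" using t(1) by (auto simp: triangles_def)
      have ge: "orient a b x \<ge> 0" "orient b c x \<ge> 0" "orient c a x \<ge> 0" using t(2) unfolding t'(1) in_triangle_iff[OF t'(2)] by auto
      have "orient a b x \<noteq> 0" "orient b c x \<noteq> 0" "orient c a x \<noteq> 0"
        using x(2) all_lines_D[of x A] t' orient_pos_distinct[OF t'(2)] by auto
      then have "x \<in> open_tri a b c" using ge by (auto simp: open_tri_def)
      then show ?thesis using open_tri_subset[OF t'(2)] t'(1) by blast
    qed
    have sub: "t \<subseteq> t'" if t: "t \<in> triangles A \<K>" "x \<in> convex hull t" "t' \<in> triangles A \<K>" "x \<in> convex hull t'" for t t'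
    proof -
      have "(convex hull t \<inter> convex hull t') face_of (convex hull t)"
        using sc t unfolding simplicial_complex_def triangles_def by blast
      then have "convex hull t \<inter> convex hull t' = convex hull t"
        using face_with_interior_point int[OF t(1,2)] t by blast
      then have "t \<subseteq> convex hull t'" using hull_subset[of t convex] by blast
      moreover have "t \<subseteq> A" using t by (auto simp: triangles_def)
      ultimately show ?thesis using triangles_empty_tris[OF tri] t(3) unfolding empty_tris_def by blast
    qed
    have "{t\<in>triangles A \<K>. x \<in> convex hull t} = {C}"
    proof (intro set_eqI iffI)
      fix t assume "t \<in> {t\<in>triangles A \<K>. x \<in> convex hull t}"
      then show "t \<in> {C}" using sub[of t C] sub[of C t] mem S(2) C(3) by auto
    qed (use mem S C in auto)
    then show ?thesis by simp
  qed
  ultimately have "negligible {x \<in> convex hull A. card {t\<in>triangles A \<K>. x \<in> convex hull t} \<noteq> 1}"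
    by (elim negligible_subset) blast
  then show ?thesis using triangles_empty_tris[OF tri] by (simp add: triangs_def)
qed

text \<open>The complex is pure. A triangle containing a relative interior point of the simplex
  \<open>S\<close> meets \<open>S\<close> in a face of \<open>S\<close>, hence in all of
  \<open>S\<close>, so \<open>S\<close> is a face of the triangle.\<close>

lemma triangles_determine:
  assumes tri: "triangulation_of A \<K>" and fin: "finite A" and nd: "nondeg A"
  shows "\<K> = {S. \<exists>t\<in>triangles A \<K>. S face_of (convex hull t)}"
proof (intro set_eqI iffI)
  have sc: "simplicial_complex \<K>" and un: "\<Union>\<K> = convex hull A"
    using tri by (auto simp: triangulation_of_def)
  fix S
  show "S \<in> {S. \<exists>t\<in>triangles A \<K>. S face_of (convex hull t)} \<Longrightarrow> S \<in> \<K>"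
    using sc unfolding simplicial_complex_def triangles_def by blast
  assume S: "S \<in> \<K>"
  obtain a b c where abc: "a \<in> A" "b \<in> A" "c \<in> A" "orient a b c > 0" using nd by (auto simp: nondeg_def)
  have ne: "interior (convex hull A) \<noteq> {}" using interior_hull_nonempty[OF abc(4)] abc hull_inc by metis
  have cover: "\<exists>t\<in>triangles A \<K>. x \<in> convex hull t" if "x \<in> convex hull A" for x
    using triangs_covers[OF triangles_triangs[OF tri fin] fin ne that] .
  show "S \<in> {S. \<exists>t\<in>triangles A \<K>. S face_of (convex hull t)}"
  proof (cases "S = {}")
    case True
    have "a \<in> convex hull A" using abc hull_inc by metis
    then show ?thesis using cover True by auto
  next
    case False
    have "convex S" using sc S convex_simplex unfolding simplicial_complex_def by blast
    then obtain x where x: "x \<in> rel_interior S" using False rel_interior_eq_empty by blast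
    then have xS: "x \<in> S" using rel_interior_subset by blast
    then obtain t where t: "t \<in> triangles A \<K>" "x \<in> convex hull t" using cover un S by blast
    have tK: "convex hull t \<in> \<K>" using t by (simp add: triangles_def)
    have "(S \<inter> convex hull t) face_of S" "(convex hull t \<inter> S) face_of (convex hull t)"
      using sc S tK unfolding simplicial_complex_def by blast+
    moreover have "S \<inter> convex hull t = S"
      using face_of_disjoint_rel_interior[OF calculation(1)] x xS t by blast
    ultimately show ?thesis using t by (auto simp: Int_commute)
  qed
qed

text \<open>On a line the only candidate is the chain of segments between consecutive points. Each
  of them occurs, because its midpoint is covered by some segment of the complex, and two segments
  without inner points of \<open>A\<close> that share this midpoint coincide.\<close>

lemma degenerate_determine:
  assumes tri: "triangulation_of A \<K>" and nd: "\<not> nondeg A"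
  shows "\<K> = {{}} \<union> (\<lambda>a. {a}) ` A \<union> {convex hull {a,b} | a b. a \<in> A \<and> b \<in> A \<and> a \<noteq> b \<and> convex hull {a,b} \<inter> A \<subseteq> {a,b}}"
    (is "\<K> = ?R")
proof (intro set_eqI iffI)
  have sc: "simplicial_complex \<K>" and un: "\<Union>\<K> = convex hull A" and vert: "{x. {x} \<in> \<K>} = A" and em: "{} \<in> \<K>"
    using tri by (auto simp: triangulation_of_def)
  have cr0: "orient a b c = 0" if "a \<in> A" "b \<in> A" "c \<in> A" for a b c
    using nd that orient_swap(1)[of a c b] unfolding nondeg_def
    by (metis linorder_neqE_linordered_idom neg_0_less_iff_less)
  have sub: "S \<in> ?R" if S: "S \<in> \<K>" for S
  proof -
    obtain C where C: "C \<subseteq> A" "\<not> affine_dependent C" "S = convex hull C" "S \<inter> A \<subseteq> C"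
      using triangulation_simplex[OF tri S] by blast
    have "card C \<le> 2" using C(1) cr0 by (intro independent_collinear_card[OF C(2)]) blast
    then consider "C = {}" | "card C = 1" | "card C = 2"
      using aff_independent_finite[OF C(2)] by (metis One_nat_def Suc_1 card_0_eq le_SucE le_zero_eq)
    then show ?thesis
    proof cases
      case 1 then show ?thesis using C by simp
    next
      case 2
      then obtain a where "C = {a}" by (auto simp: card_1_singleton_iff)
      then show ?thesis using C by auto
    next
      case 3
      then obtain a b where "C = {a,b}" "a \<noteq> b" by (auto simp: card_2_iff)
      then show ?thesis using C by blast
    qed
  qed
  fix S
  show "S \<in> \<K> \<Longrightarrow> S \<in> ?R" by (rule sub)
  assume "S \<in> ?R"
  then consider "S = {}" | a where "a \<in> A" "S = {a}"
    | a b where "a \<in> A" "b \<in> A" "a \<noteq> b" "convex hull {a,b} \<inter> A \<subseteq> {a,b}" "S = convex hull {a,b}" by blast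
  then show "S \<in> \<K>"
  proof cases
    case 1 then show ?thesis using em by simp
  next
    case 2 then show ?thesis using vert by blast
  next
    case (3 a b)
    \<comment> \<open>An affine coordinate on the line, with \<open>a\<close> at 0 and
      \<open>b\<close> at 1; betweenness becomes an inequality of reals.\<close>
    define g where "g l = a + l *\<^sub>R (b - a)" for l :: real
    have inj: "g x = g y \<longleftrightarrow> x = y" for x y using 3(3) by (simp add: g_def)
    have ab: "g 0 = a" "g 1 = b" by (simp_all add: g_def)
    have seg: "g x \<in> convex hull {g l, g r}" if "l \<le> x" "x \<le> r" for l x r
    proof -
      have "closed_segment l r = {l..r}" using that by (simp add: closed_segment_eq_real_ivl)
      then have "x \<in> closed_segment l r" using that by simp
      then obtain u where u: "0 \<le> u" "u \<le> 1" "x = (1 - u) * l + u * r" by (auto simp: closed_segment_def)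
      have "g x = (1 - u) *\<^sub>R g l + u *\<^sub>R g r" unfolding u g_def by (simp add: algebra_simps)
      then show ?thesis using u unfolding convex_hull_2 by (intro CollectI exI[of _ "1 - u"] exI[of _ u]) auto
    qed
    have seg': "l \<le> x \<and> x \<le> r" if "g x \<in> convex hull {g l, g r}" "l \<le> r" for l x r
    proof -
      have "\<exists>u v. g x = u *\<^sub>R g l + v *\<^sub>R g r \<and> 0 \<le> u \<and> 0 \<le> v \<and> u + v = 1"
        using that(1) unfolding convex_hull_2 mem_Collect_eq .
      then obtain u v where uv: "u \<ge> 0" "v \<ge> 0" "u + v = 1" "g x = u *\<^sub>R g l + v *\<^sub>R g r"
        by (elim exE conjE) rule
      have "u *\<^sub>R g l + v *\<^sub>R g r = (u + v) *\<^sub>R a + (u * l + v * r) *\<^sub>R (b - a)" unfolding g_def by (simp add: algebra_simps)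
      then have "g x = g (u * l + v * r)" using uv by (simp add: g_def)
      then have "x = u * l + v * r" by (simp add: inj)
      moreover have "u * l + v * l \<le> u * l + v * r" "u * l + v * r \<le> u * r + v * r"
        using uv(1,2) that(2) by (simp_all add: mult_left_mono)
      moreover have "u * l + v * l = l" "u * r + v * r = r" using uv(3) by (simp_all add: distrib_right[symmetric])
      ultimately show ?thesis by simp
    qed
    let ?m = "g (1/2)"
    have m_in: "?m \<in> convex hull {a,b}" using seg[of 0 "1/2" 1] ab by simp
    moreover have "convex hull {a,b} \<subseteq> convex hull A" using 3 by (intro hull_mono) auto
    ultimately obtain S' where S': "S' \<in> \<K>" "?m \<in> S'" using un by blast
    have mA: "?m \<notin> A"
    proof
      assume "?m \<in> A"
      then have "?m = a \<or> ?m = b" using m_in 3(4) by blast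
      then show False using inj[of "1/2" 0] inj[of "1/2" 1] ab by simp
    qed
    then obtain c d where cd: "c \<in> A" "d \<in> A" "c \<noteq> d" "convex hull {c,d} \<inter> A \<subseteq> {c,d}" "S' = convex hull {c,d}"
      using sub[OF S'(1)] S'(2) by auto
    \<comment> \<open>No point of \<open>A\<close> is strictly between \<open>a\<close> and
      \<open>b\<close>, so the ends have coordinates at most 0 and at least 1. Then \<open>a\<close>
      and \<open>b\<close> lie in the covering segment and must be its ends.\<close>
    have *: "{c,d} = {a,b}" if cd: "g \<gamma> \<in> A" "g \<delta> \<in> A" "convex hull {g \<gamma>, g \<delta>} \<inter> A \<subseteq> {g \<gamma>, g \<delta>}"
      "?m \<in> convex hull {g \<gamma>, g \<delta>}" "\<gamma> \<le> \<delta>" "{c,d} = {g \<gamma>, g \<delta>}" for \<gamma> \<delta>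
    proof -
      have m: "\<gamma> \<le> 1/2" "1/2 \<le> \<delta>" using seg'[OF cd(4,5)] by auto
      have "\<gamma> \<le> 0"
      proof (rule ccontr)
        assume n: "\<not> \<gamma> \<le> 0"
        then have "g \<gamma> \<in> convex hull {a,b}" using seg[of 0 \<gamma> 1] m ab by simp
        then have "g \<gamma> = g 0 \<or> g \<gamma> = g 1" using 3(4) cd(1) ab by blast
        then show False using n m by (auto simp: inj)
      qed
      moreover have "1 \<le> \<delta>"
      proof (rule ccontr)
        assume n: "\<not> 1 \<le> \<delta>"
        then have "g \<delta> \<in> convex hull {a,b}" using seg[of 0 \<delta> 1] m ab by simp
        then have "g \<delta> = g 0 \<or> g \<delta> = g 1" using 3(4) cd(2) ab by blast
        then show False using n m by (auto simp: inj)
      qed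
      ultimately have "a \<in> convex hull {g \<gamma>, g \<delta>}" "b \<in> convex hull {g \<gamma>, g \<delta>}"
        using seg[of \<gamma> 0 \<delta>] seg[of \<gamma> 1 \<delta>] ab by simp_all
      then have "a \<in> {g \<gamma>, g \<delta>}" "b \<in> {g \<gamma>, g \<delta>}" using cd(3) 3(1,2) by blast+
      then show ?thesis using 3(3) cd(6) by auto
    qed
    obtain \<gamma> where \<gamma>: "c = g \<gamma>" using orient_zero_line[OF cr0[OF 3(1,2) cd(1)] 3(3)] unfolding g_def by blast
    obtain \<delta> where \<delta>: "d = g \<delta>" using orient_zero_line[OF cr0[OF 3(1,2) cd(2)] 3(3)] unfolding g_def by blast
    have "{c,d} = {a,b}"
    proof (cases "\<gamma> \<le> \<delta>")
      case True
      then show ?thesis using *[of \<gamma> \<delta>] cd S'(2) \<gamma> \<delta> by simp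
    next
      case False
      then show ?thesis using *[of \<delta> \<gamma>] cd S'(2) \<gamma> \<delta> by (simp add: insert_commute)
    qed
    then show ?thesis using S'(1) cd(5) 3(5) by simp
  qed
qed

text \<open>An injection suffices. In the collinear case there is at most one complex, and if there
  is one, its triangles form a member of \<open>triangs A\<close>.\<close>

lemma card_triangulations_le:
  assumes fin: "finite A"
  shows "card {\<K>. triangulation_of A \<K>} \<le> card (triangs A)"
proof (cases "nondeg A")
  case True
  have "inj_on (triangles A) {\<K>. triangulation_of A \<K>}"
  proof (rule inj_onI)
    fix \<K> \<K>' assume "\<K> \<in> {\<K>. triangulation_of A \<K>}" "\<K>' \<in> {\<K>. triangulation_of A \<K>}" "triangles A \<K> = triangles A \<K>'"
    then show "\<K> = \<K>'" using triangles_determine[OF _ fin True, of \<K>] triangles_determine[OF _ fin True, of \<K>'] by simp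
  qed
  moreover have "triangles A ` {\<K>. triangulation_of A \<K>} \<subseteq> triangs A" using triangles_triangs[OF _ fin] by blast
  ultimately show ?thesis using finite_triangs[OF fin] by (rule card_inj_on_le)
next
  case False
  show ?thesis
  proof (cases "{\<K>. triangulation_of A \<K>} = {}")
    case True then show ?thesis by simp
  next
    case ne: False
    then obtain \<K> where \<K>: "triangulation_of A \<K>" by blast
    have "\<K>' = \<K>" if "triangulation_of A \<K>'" for \<K>'
      using degenerate_determine[OF that False] degenerate_determine[OF \<K> False] by simp
    then have "{\<K>. triangulation_of A \<K>} \<subseteq> {\<K>}" by blast
    then have "card {\<K>. triangulation_of A \<K>} \<le> 1" using card_mono[of "{\<K>}"] by simp
    moreover have "triangs A \<noteq> {}" using triangles_triangs[OF \<K> fin] by blast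
    then have "card (triangs A) \<ge> 1" using finite_triangs[OF fin] by (simp add: Suc_le_eq card_gt_0_iff)
    ultimately show ?thesis by simp
  qed
qed

theorem theorem1:
  fixes A :: "(real^2) set" and v b :: nat
  assumes "finite A"
    and "v = card (A \<inter> interior (convex hull A))"
    and "b = card (A \<inter> frontier (convex hull A))"
  shows "real (card {\<K>. triangulation_of A \<K>})
           \<le> 59 ^ v * 7 ^ b / real ((v + b + 6) choose 6)"
proof -
  let ?I = "interior (convex hull A)"
  have "closed (convex hull A)" using assms(1) by (simp add: compact_imp_closed finite_imp_compact_convex_hull)
  then have fr: "A \<inter> frontier (convex hull A) = A - ?I"
    using hull_subset[of A convex] by (auto simp: frontier_def)
  have "card (A - ?I) = card A - v" using assms(1,2) by (simp add: card_Diff_subset_Int)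
  then have b: "b = card A - v" using assms(3) fr by simp
  have "v \<le> card A" using assms(1,2) by (auto intro: card_mono)
  then have n: "v + b = card A" using b by simp
  have "card {\<K>. triangulation_of A \<K>} * ((v + b + 6) choose 6) \<le> card (triangs A) * ((v + b + 6) choose 6)"
    using card_triangulations_le[OF assms(1)] by (rule mult_right_mono) simp
  also have "\<dots> \<le> 59 ^ v * 7 ^ b"
    using triangs_bound[OF assms(1)] unfolding assms(2)[symmetric] b[symmetric] n .
  finally have "real (card {\<K>. triangulation_of A \<K>} * ((v + b + 6) choose 6)) \<le> real (59 ^ v * 7 ^ b)"
    by (rule of_nat_mono)
  moreover have "real ((v + b + 6) choose 6) > 0" by simp
  ultimately show ?thesis by (simp add: pos_le_divide_eq)
qed

end
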